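(* Let $X,Z$ be complex Hilbert spaces, let $E\in L(X,Z)$, let $A\colon\mathrm{dom}(A)\subseteq X\to Z$ be closed and densely defined, and assume $\rho(E,A)\neq\emptyset$. Let $(E,A)$ have a complex resolvent index, let $p\in\mathbb{N}$ with $p\ge p_{\mathrm{res}}^{(E,A_{-1})}+1$, and let $f\in H^p([0,\infty);Z_{-1})$. If there are $x_0,x_1,\dots,x_p\in X$ with $$Ex_{j+1}=A_{-1}x_j+f^{(j)}(0),\qquad 0\le j\le p-1,$$ then $\begin{pmatrix}x_0\\ f\end{pmatrix}\in\mathcal C_{(E,A_{-1})}$, where $$\mathcal C_{(E,A_{-1})}=\left\{\begin{pmatrix}x_0\\ f\end{pmatrix}\in X\times L^1([0,\infty);Z_{-1})\;:\;\text{there exists a classical solution } x\colon[0,\infty)\to X \text{ of } \tfrac{\mathrm d}{\mathrm dt}Ex(t)=A_{-1}x(t)+f(t),\ t\ge0,\ Ex(0)=Ex_0\right\}.$$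
   Context: $\rho(E,A)$ is the set of all $\lambda\in\mathbb{C}$ such that $\lambda E-A\colon\mathrm{dom}(A)\to Z$ is bijective with $(\lambda E-A)^{-1}\in L(Z,X)$. $Z_{-1}$ is the completion of $Z$ with respect to the norm $\|z\|_{Z_{-1}}=\|(\mu E-A)^{-1}z\|_X$, $\mu\in\rho(E,A)$ (different $\mu$ give equivalent norms), and $A_{-1}\in L(X,Z_{-1})$ is the unique bounded extension of $A$ to all of $X$. Complex resolvent index: the complex resolvent index of $(E,A)$ is the smallest $q=p_{\mathrm{res}}^{(E,A)}\in\mathbb{N}_0$ such that there exist $\omega\in\mathbb{R}$, $C>0$ with $\{\lambda\in\mathbb{C}:\mathrm{Re}\,\lambda>\omega\}\subseteq\rho(E,A)$ and $\|(\lambda E-A)^{-1}\|_{L(Z,X)}\le C|\lambda|^{q-1}$ whenever $\mathrm{Re}\,\lambda>\omega$. $p_{\mathrm{res}}^{(E,A_{-1})}$ is defined in the same way for the pair $E,A_{-1}\in L(X,Z_{-1})$, using the norm of $L(Z_{-1},X)$; it exists whenever $(E,A)$ has a complex resolvent index. $H^p([0,\infty);Z_{-1})$ is the Sobolev space of $Z_{-1}$-valued functions in $L^2$ whose weak derivatives up to order $p$ are in $L^2$. Classical solution: a function $x\in C([0,\infty);X)$ with $Ex\in C([0,\infty);Z)\cap C^1([0,\infty);Z_{-1})$ which satisfies $\frac{\mathrm d}{\mathrm dt}Ex(t)=A_{-1}x(t)+f(t)$ for $t\ge0$ and $Ex(0)=Ex_0$.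
   Formalization: Since H^p([0,∞);Z_{-1}) is not contained in L^1 (e.g. f(t)=1/(1+t)), membership in C_{(E,A_{-1})} is stated with L^1 replaced by locally integrable functions for every f, and with L^1 itself whenever f is in L^1. *)

theory Defs
  imports "HOL-Analysis.Analysis"
begin

section \<open>Complex Banach and Hilbert spaces\<close>

class complex_normed_vector = real_normed_vector +
  fixes scaleC :: "complex \<Rightarrow> 'a \<Rightarrow> 'a"  (infixr "*\<^sub>C" 75)
  assumes scaleC_add_right: "a *\<^sub>C (x + y) = a *\<^sub>C x + a *\<^sub>C y"
    and scaleC_add_left: "(a + b) *\<^sub>C x = a *\<^sub>C x + b *\<^sub>C x"
    and scaleC_scaleC: "a *\<^sub>C b *\<^sub>C x = (a * b) *\<^sub>C x"
    and scaleC_of_real: "complex_of_real r *\<^sub>C x = r *\<^sub>R x"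
    and norm_scaleC: "norm (a *\<^sub>C x) = cmod a * norm x"

class complex_banach = complex_normed_vector + banach

class complex_hilbert = complex_banach +
  fixes cinner :: "'a \<Rightarrow> 'a \<Rightarrow> complex"
  assumes cinner_commute: "cinner x y = cnj (cinner y x)"
    and cinner_add_right: "cinner x (y + z) = cinner x y + cinner x z"
    and cinner_scaleC_right: "cinner x (a *\<^sub>C y) = a * cinner x y"
    and cinner_norm: "cinner x x = complex_of_real ((norm x)\<^sup>2)"

instantiation complex :: complex_hilbert
begin

definition scaleC_complex :: "complex \<Rightarrow> complex \<Rightarrow> complex"
  where "scaleC_complex a x = a * x"

definition cinner_complex :: "complex \<Rightarrow> complex \<Rightarrow> complex"
  where "cinner_complex x y = cnj x * y"

instance
proof
  fix a b x y z :: complex and r :: real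
  show "a *\<^sub>C (x + y) = a *\<^sub>C x + a *\<^sub>C y" "(a + b) *\<^sub>C x = a *\<^sub>C x + b *\<^sub>C x"
    "a *\<^sub>C b *\<^sub>C x = (a * b) *\<^sub>C x"
    by (simp_all add: scaleC_complex_def algebra_simps)
  show "complex_of_real r *\<^sub>C x = r *\<^sub>R x"
    by (simp add: scaleC_complex_def scaleR_conv_of_real)
  show "norm (a *\<^sub>C x) = cmod a * norm x"
    by (simp add: scaleC_complex_def norm_mult)
  show "cinner x y = cnj (cinner y x)" "cinner x (y + z) = cinner x y + cinner x z"
    "cinner x (a *\<^sub>C y) = a * cinner x y"
    by (simp_all add: cinner_complex_def scaleC_complex_def algebra_simps)
  show "cinner x x = complex_of_real ((norm x)\<^sup>2)"
    by (simp add: cinner_complex_def complex_norm_square mult.commute del: of_real_power)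
qed

end


section \<open>Operators and operator pencils\<close>

definition clinear_on :: "'a::complex_normed_vector set \<Rightarrow> ('a \<Rightarrow> 'b::complex_normed_vector) \<Rightarrow> bool"
  where "clinear_on D A \<longleftrightarrow>
    0 \<in> D \<and> (\<forall>x\<in>D. \<forall>y\<in>D. x + y \<in> D \<and> A (x + y) = A x + A y) \<and>
    (\<forall>c. \<forall>x\<in>D. c *\<^sub>C x \<in> D \<and> A (c *\<^sub>C x) = c *\<^sub>C A x)"

definition bounded_clinear :: "('a::complex_normed_vector \<Rightarrow> 'b::complex_normed_vector) \<Rightarrow> bool"
  where "bounded_clinear f \<longleftrightarrow> bounded_linear f \<and> (\<forall>c x. f (c *\<^sub>C x) = c *\<^sub>C f x)"

text \<open>An unbounded operator is given by its domain \<open>D\<close> and a total function \<open>A\<close> whose values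
  outside \<open>D\<close> are irrelevant.\<close>

definition closed_densely_defined ::
    "'a::complex_normed_vector set \<Rightarrow> ('a \<Rightarrow> 'b::complex_normed_vector) \<Rightarrow> bool"
  where "closed_densely_defined D A \<longleftrightarrow>
    clinear_on D A \<and> closed {(x, A x) |x. x \<in> D} \<and> closure D = UNIV"

definition pencil_resolvent ::
    "('a \<Rightarrow> 'b) \<Rightarrow> 'a::complex_normed_vector set \<Rightarrow> ('a \<Rightarrow> 'b::complex_normed_vector) \<Rightarrow>
      complex \<Rightarrow> 'b \<Rightarrow> 'a"
  where "pencil_resolvent E D A \<zeta> = inv_into D (\<lambda>x. \<zeta> *\<^sub>C E x - A x)"

definition pencil_resolvent_set ::
    "('a \<Rightarrow> 'b) \<Rightarrow> 'a::complex_normed_vector set \<Rightarrow> ('a \<Rightarrow> 'b::complex_normed_vector) \<Rightarrow> complex set"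
  where "pencil_resolvent_set E D A =
    {\<zeta>. bij_betw (\<lambda>x. \<zeta> *\<^sub>C E x - A x) D UNIV \<and> bounded_clinear (pencil_resolvent E D A \<zeta>)}"

text \<open>At \<open>\<zeta> = 0\<close> with \<open>q = 0\<close> the right-hand side is \<open>0\<close> by the convention \<open>0 powi (-1) = 0\<close>;
  since \<open>\<omega>\<close> may be enlarged, the set of admissible \<open>q\<close> does not depend on that value.\<close>

definition resolvent_growth ::
    "('a \<Rightarrow> 'b) \<Rightarrow> 'a::complex_normed_vector set \<Rightarrow> ('a \<Rightarrow> 'b::complex_normed_vector) \<Rightarrow> nat \<Rightarrow> bool"
  where "resolvent_growth E D A q \<longleftrightarrow>
    (\<exists>\<omega>::real. \<exists>C>0. \<forall>\<zeta>. Re \<zeta> > \<omega> \<longrightarrow>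
      \<zeta> \<in> pencil_resolvent_set E D A \<and>
      onorm (pencil_resolvent E D A \<zeta>) \<le> C * cmod \<zeta> powi (int q - 1))"

definition has_complex_resolvent_index ::
    "('a \<Rightarrow> 'b) \<Rightarrow> 'a::complex_normed_vector set \<Rightarrow> ('a \<Rightarrow> 'b::complex_normed_vector) \<Rightarrow> bool"
  where "has_complex_resolvent_index E D A \<longleftrightarrow> (\<exists>q. resolvent_growth E D A q)"

definition complex_resolvent_index ::
    "('a \<Rightarrow> 'b) \<Rightarrow> 'a::complex_normed_vector set \<Rightarrow> ('a \<Rightarrow> 'b::complex_normed_vector) \<Rightarrow> nat"
  where "complex_resolvent_index E D A = (LEAST q. resolvent_growth E D A q)"

text \<open>The complete space \<open>'w\<close> with the embedding \<open>\<iota>\<close> is a completion of \<open>'z\<close> with respect to the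
  norm \<open>\<lambda>z. norm (pencil_resolvent E D A \<mu> z)\<close>.  Such a completion is unique up to an isometric
  isomorphism compatible with the embeddings.\<close>

definition is_extrapolation_space ::
    "('x::complex_normed_vector \<Rightarrow> 'z::complex_normed_vector) \<Rightarrow> 'x set \<Rightarrow> ('x \<Rightarrow> 'z) \<Rightarrow> complex \<Rightarrow>
      ('z \<Rightarrow> 'w::complex_banach) \<Rightarrow> bool"
  where "is_extrapolation_space E D A \<mu> \<iota> \<longleftrightarrow>
    clinear_on UNIV \<iota> \<and> closure (range \<iota>) = UNIV \<and>
    (\<forall>z. norm (\<iota> z) = norm (pencil_resolvent E D A \<mu> z))"

definition bounded_extension ::
    "'x set \<Rightarrow> ('x \<Rightarrow> 'z) \<Rightarrow> ('z \<Rightarrow> 'w) \<Rightarrow> ('x::complex_normed_vector \<Rightarrow> 'w::complex_normed_vector)"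
  where "bounded_extension D A \<iota> = (THE B. bounded_clinear B \<and> (\<forall>x\<in>D. B x = \<iota> (A x)))"


section \<open>Vector-valued function spaces on the half-line\<close>

text \<open>The library's Bochner integral is restricted to second countable target types.  To avoid
  assuming separability, strong measurability and the Bochner integral are stated here for
  arbitrary normed spaces; the definition of the integral is otherwise that of
  \<^const>\<open>has_bochner_integral\<close>.\<close>

definition strongly_measurable :: "'a measure \<Rightarrow> ('a \<Rightarrow> 'b::real_normed_vector) \<Rightarrow> bool"
  where "strongly_measurable M f \<longleftrightarrow>
    (\<exists>s. (\<forall>i::nat. simple_function M (s i)) \<and> (AE t in M. (\<lambda>i. s i t) \<longlonglongrightarrow> f t))"

definition has_strong_integral :: "'a measure \<Rightarrow> ('a \<Rightarrow> 'b::real_normed_vector) \<Rightarrow> 'b \<Rightarrow> bool"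
  where "has_strong_integral M f I \<longleftrightarrow>
    strongly_measurable M f \<and>
    (\<exists>s. (\<forall>i::nat. Bochner_Integration.simple_bochner_integrable M (s i)) \<and>
      (\<lambda>i. \<integral>\<^sup>+t. ennreal (norm (f t - s i t)) \<partial>M) \<longlonglongrightarrow> 0 \<and>
      (\<lambda>i. Bochner_Integration.simple_bochner_integral M (s i)) \<longlonglongrightarrow> I)"

text \<open>Elements of the following spaces are functions rather than classes modulo null sets; only
  the values on \<open>[0,\<infinity>)\<close> matter, and membership is invariant under changes on null sets.\<close>

definition L1_halfline :: "(real \<Rightarrow> 'b::real_normed_vector) set"
  where "L1_halfline = {f. strongly_measurable (lebesgue_on {0..}) f \<and>
    integrable (lebesgue_on {0..}) (\<lambda>t. norm (f t))}"

definition L1_loc_halfline :: "(real \<Rightarrow> 'b::real_normed_vector) set"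
  where "L1_loc_halfline = {f. strongly_measurable (lebesgue_on {0..}) f \<and>
    (\<forall>T\<ge>0. integrable (lebesgue_on {0..T}) (\<lambda>t. norm (f t)))}"

definition L2_halfline :: "(real \<Rightarrow> 'b::real_normed_vector) set"
  where "L2_halfline = {f. strongly_measurable (lebesgue_on {0..}) f \<and>
    integrable (lebesgue_on {0..}) (\<lambda>t. (norm (f t))\<^sup>2)}"

text \<open>The space \<open>C\<^sub>c\<^sup>\<infinity>(0,\<infinity>)\<close>, functions being extended by zero to the real line.\<close>

definition test_function :: "(real \<Rightarrow> real) \<Rightarrow> bool"
  where "test_function \<phi> \<longleftrightarrow>
    (\<forall>k t. (deriv ^^ k) \<phi> field_differentiable (at t)) \<and>
    (\<exists>a b. 0 < a \<and> (\<forall>t. t \<notin> {a..b} \<longrightarrow> \<phi> t = 0))"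

text \<open>\<open>g\<close> is the \<open>j\<close>-th weak derivative of \<open>f\<close> on \<open>(0,\<infinity>)\<close>:
  \<open>\<integral> \<phi>\<^sup>(\<^sup>j\<^sup>) f = (-1)\<^sup>j \<integral> \<phi> g\<close> for all test functions.\<close>

definition weak_derivative ::
    "nat \<Rightarrow> (real \<Rightarrow> 'b::real_normed_vector) \<Rightarrow> (real \<Rightarrow> 'b) \<Rightarrow> bool"
  where "weak_derivative j f g \<longleftrightarrow>
    (\<forall>\<phi>. test_function \<phi> \<longrightarrow>
      (\<exists>I. has_strong_integral (lebesgue_on {0..}) (\<lambda>t. (deriv ^^ j) \<phi> t *\<^sub>R f t) I \<and>
           has_strong_integral (lebesgue_on {0..}) (\<lambda>t. \<phi> t *\<^sub>R g t) ((-1) ^ j *\<^sub>R I)))"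

definition Sobolev_halfline :: "nat \<Rightarrow> (real \<Rightarrow> 'b::real_normed_vector) set"
  where "Sobolev_halfline p =
    {f \<in> L2_halfline. \<forall>j\<le>p. \<exists>g\<in>L2_halfline. weak_derivative j f g}"

text \<open>The value \<open>f\<^sup>(\<^sup>j\<^sup>)(0)\<close>: the value at \<open>0\<close> of the continuous representative on \<open>[0,\<infinity>)\<close> of the
  \<open>j\<close>-th weak derivative, which exists for \<open>f\<close> in \<open>H\<^sup>p\<close> and \<open>j < p\<close>.\<close>

definition initial_derivative :: "nat \<Rightarrow> (real \<Rightarrow> 'b::real_normed_vector) \<Rightarrow> 'b"
  where "initial_derivative j f =
    (THE v. \<exists>g. continuous_on {0..} g \<and> weak_derivative j f g \<and> g 0 = v)"


section \<open>Classical solutions\<close>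

text \<open>The equation \<open>d/dt E x(t) = B x(t) + f(t)\<close> is posed in \<open>'w\<close>, into which \<open>'z\<close> is
  embedded by \<open>\<iota>\<close>; at \<open>t = 0\<close> the derivative is one-sided.\<close>

definition classical_solution ::
    "('x::complex_normed_vector \<Rightarrow> 'z::complex_normed_vector) \<Rightarrow>
      ('z \<Rightarrow> 'w::complex_normed_vector) \<Rightarrow> ('x \<Rightarrow> 'w) \<Rightarrow> 'x \<Rightarrow> (real \<Rightarrow> 'w) \<Rightarrow> (real \<Rightarrow> 'x) \<Rightarrow> bool"
  where "classical_solution E \<iota> B x0 f x \<longleftrightarrow>
    continuous_on {0..} x \<and>
    continuous_on {0..} (\<lambda>t. E (x t)) \<and>
    (\<exists>y. continuous_on {0..} y \<and>
      (\<forall>t\<ge>0. ((\<lambda>s. \<iota> (E (x s))) has_vector_derivative y t) (at t within {0..}) \<and>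
             y t = B (x t) + f t)) \<and>
    E (x 0) = E x0"

text \<open>The initial values and inhomogeneities, the latter taken from the function space \<open>F\<close>, that
  admit a classical solution.  As \<open>f\<close> stands for its class modulo null sets, the equation is
  required for all \<open>t \<ge> 0\<close> for some representative \<open>g\<close> of that class (necessarily
  its continuous one).  The parameter \<open>F\<close> is needed because \<open>H\<^sup>p(0,\<infinity>)\<close> is contained in
  \<open>L\<^sup>1\<^sub>l\<^sub>o\<^sub>c\<close> but not in \<open>L\<^sup>1\<close>.\<close>

definition classical_data ::
    "(real \<Rightarrow> 'w) set \<Rightarrow> ('x::complex_normed_vector \<Rightarrow> 'z::complex_normed_vector) \<Rightarrow>
      ('z \<Rightarrow> 'w::complex_normed_vector) \<Rightarrow> ('x \<Rightarrow> 'w) \<Rightarrow> ('x \<times> (real \<Rightarrow> 'w)) set"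
  where "classical_data F E \<iota> B =
    {(x0, f). f \<in> F \<and>
      (\<exists>g x. (AE t in lebesgue_on {0..}. g t = f t) \<and> classical_solution E \<iota> B x0 g x)}"

end

theory Submission
  imports Defs "HOL-Complex_Analysis.Complex_Analysis"
begin

text \<open>Subtracting the polynomial \<open>\<Sum>\<^sub>j t\<^sup>j/j! x\<^sub>j\<close> reduces the problem to a right-hand side \<open>g\<close> whose
  derivatives up to order \<open>q\<close> vanish at \<open>0\<close>, where \<open>q\<close> is the index of \<open>(E, A\<^sub>-\<^sub>1)\<close>. With
  \<open>G = g\<^sup>(\<^sup>q\<^sup>)\<close>, which is locally of bounded variation, and with \<open>Y(\<lambda>, \<cdot>)\<close> solving \<open>Y' = \<lambda> Y + G'\<close>,
  \<open>Y(\<lambda>, 0) = 0\<close>, the remaining solution is the inverse Laplace integral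
  \<open>z(t) = (2 \<pi>)\<^sup>-\<^sup>1 \<integral> \<lambda>\<^sup>-\<^sup>q\<^sup>-\<^sup>1 (\<lambda> E - A\<^sub>-\<^sub>1)\<^sup>-\<^sup>1 Y(\<lambda>, t) d\<xi>\<close> over \<open>\<lambda> = \<gamma> + i \<xi>\<close>. It converges absolutely because
  the growth bound leaves a factor \<open>|\<lambda>|\<^sup>-\<^sup>2\<close> and \<open>Y\<close> is bounded on the line by the variation of \<open>G\<close>;
  terms not involving \<open>Y\<close> vanish on shifting the line to \<open>Re \<lambda> = \<infinity>\<close>. The Hilbert space structure enters
  only through functionals testing the weak derivatives of \<open>f\<close>.\<close>

text \<open>The bound \<open>p \<ge> q + 1\<close> is the price of absolute convergence. Dividing by
  \<lambda>^(q+1) corresponds to q + 1 integrations in time, so q derivatives of the data go into G,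
  and one more, integrable on bounded intervals, controls the variation of G. A Laplace transform of
  the data over the whole half-line is avoided: Y(\<lambda>, t) sees G only up to time t, so no
  growth condition at infinity enters. The equation holds because Y = G + \<lambda> Q with Q the
  primitive of Y in time. Applying E to the integrand and \<open>A\<^sub>-\<^sub>1\<close> to its
  primitive therefore leaves \<lambda>^(-q-1) Q = \<lambda>^(-q-2) (Y - G) and a resolvent term in
  G(t). The terms in G carry no exponential factor, which is why the line can be moved to the right
  for them. What remains is an inversion formula with a scalar kernel, reduced to the residue of
  exp(\<lambda> \<tau>) / \<lambda>^2 at 0. The space \<open>Z\<^sub>-\<^sub>1\<close> need not be
  separable; measurable functions with values in it are therefore handled through real functionals
  until continuous representatives are available.\<close>

section \<open>Complex scalar multiplication and complex linear maps\<close>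

lemma bounded_bilinear_scaleC: "bounded_bilinear (scaleC :: complex \<Rightarrow> 'a::complex_normed_vector \<Rightarrow> 'a)"
proof
  fix a b :: complex and x y :: 'a and r :: real
  show "(a + b) *\<^sub>C x = a *\<^sub>C x + b *\<^sub>C x" by (rule scaleC_add_left)
  show "a *\<^sub>C (x + y) = a *\<^sub>C x + a *\<^sub>C y" by (rule scaleC_add_right)
  show "(r *\<^sub>R a) *\<^sub>C x = r *\<^sub>R (a *\<^sub>C x)"
    by (metis scaleC_of_real scaleC_scaleC scaleR_conv_of_real)
  show "a *\<^sub>C (r *\<^sub>R x) = r *\<^sub>R (a *\<^sub>C x)"
    by (metis mult.commute scaleC_of_real scaleC_scaleC)
  show "\<exists>K. \<forall>a (x::'a). norm (a *\<^sub>C x) \<le> norm a * norm x * K"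
    by (rule exI[of _ 1]) (simp add: norm_scaleC)
qed

interpretation scaleC: bounded_bilinear "scaleC :: complex \<Rightarrow> 'a::complex_normed_vector \<Rightarrow> 'a"
  by (rule bounded_bilinear_scaleC)

lemma scaleC_one [simp]: "1 *\<^sub>C (x::'a::complex_normed_vector) = x"
  by (metis of_real_1 scaleC_of_real scaleR_one)

lemma scaleC_simps [simp]:
  fixes x :: "'a::complex_normed_vector"
  shows "0 *\<^sub>C x = 0" "a *\<^sub>C (0::'a) = 0"
  by (rule scaleC.zero_left, rule scaleC.zero_right)

lemmas continuous_on_scaleC [continuous_intros] = scaleC.continuous_on
lemmas tendsto_scaleC [tendsto_intros] = scaleC.tendsto

lemma bounded_clinear_bounded_linear: "bounded_clinear f \<Longrightarrow> bounded_linear f"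
  by (simp add: bounded_clinear_def)

lemma bounded_clinear_scaleC: "bounded_clinear f \<Longrightarrow> f (c *\<^sub>C x) = c *\<^sub>C f x"
  by (simp add: bounded_clinear_def)

lemma bounded_clinear_simps:
  assumes "bounded_clinear f"
  shows "f (x + y) = f x + f y" "f (x - y) = f x - f y" "f 0 = 0" "f (- x) = - f x"
    "f (c *\<^sub>C x) = c *\<^sub>C f x" "f (k *\<^sub>R x) = k *\<^sub>R f x"
proof -
  interpret bounded_linear f using assms by (rule bounded_clinear_bounded_linear)
  show "f (x + y) = f x + f y" "f (x - y) = f x - f y" "f 0 = 0" "f (- x) = - f x"
    "f (k *\<^sub>R x) = k *\<^sub>R f x"
    by (rule add diff zero neg scaleR)+
  show "f (c *\<^sub>C x) = c *\<^sub>C f x" using assms by (rule bounded_clinear_scaleC)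
qed

lemma integral_bounded_clinear:
  assumes "bounded_clinear f" "g integrable_on S"
  shows "integral S (\<lambda>x. f (g x)) = f (integral S g)"
  using integral_linear[OF assms(2) bounded_clinear_bounded_linear[OF assms(1)]] by (simp add: o_def)

lemma integral_scaleC_right:
  fixes g :: "real \<Rightarrow> 'a::complex_banach"
  assumes "g integrable_on S"
  shows "integral S (\<lambda>x. c *\<^sub>C g x) = c *\<^sub>C integral S g"
  using integral_linear[OF assms scaleC.bounded_linear_right, of c] by (simp add: o_def)

lemma integral_scaleC_left:
  fixes w :: "'a::complex_banach"
  assumes "g integrable_on S"
  shows "integral S (\<lambda>x. g x *\<^sub>C w) = integral S g *\<^sub>C w"
  using integral_linear[OF assms scaleC.bounded_linear_left, of w] by (simp add: o_def)

section \<open>Integrals along vertical lines\<close>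

text \<open>The limit form needs only integrals of continuous functions over compact intervals, which exist
  in every Banach space.\<close>

definition line_integral :: "(real \<Rightarrow> 'a::banach) \<Rightarrow> 'a"
  where "line_integral u = lim (\<lambda>N::nat. integral {- real N..real N} u)"

text \<open>\<open>arctan\<close> is a primitive of 1 / (1 + \<xi>^2), so each of the two tails
  costs K times a difference of \<open>arctan\<close>. The bound depends on \<open>u\<close> only
  through \<open>K\<close>, which later makes limits uniform in a parameter.\<close>

lemma line_integral_tail:
  fixes u :: "real \<Rightarrow> 'a::banach"
  assumes "continuous_on UNIV u" "\<And>\<xi>. norm (u \<xi>) \<le> K / (1 + \<xi>\<^sup>2)" "m \<le> (n::nat)"
  shows "norm (integral {- real n..real n} u - integral {- real m..real m} u)
    \<le> 2 * K * (arctan n - arctan m)"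
proof -
  have int: "u integrable_on {a..b}" for a b
    by (intro integrable_continuous_real continuous_on_subset[OF assms(1)]) auto
  have bound: "norm (integral {a..b} u) \<le> K * (arctan b - arctan a)" if "a \<le> b" for a b
  proof -
    have I: "((\<lambda>\<xi>. K * (1 / (1 + \<xi>\<^sup>2))) has_integral (K * (arctan b - arctan a))) {a..b}"
      using that by (intro has_integral_mult_right fundamental_theorem_of_calculus)
        (auto intro!: derivative_eq_intros simp: has_real_derivative_iff_has_vector_derivative[symmetric] field_simps)
    have "norm (integral {a..b} u) \<le> integral {a..b} (\<lambda>\<xi>. K * (1 / (1 + \<xi>\<^sup>2)))"
      using I assms(2) int by (intro integral_norm_bound_integral) (auto simp: has_integral_integrable)
    with I show ?thesis by (simp add: integral_unique)
  qed
  have 1: "integral {- real n..- real m} u + integral {- real m..real m} u = integral {- real n..real m} u"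
    using assms(3) int by (intro Henstock_Kurzweil_Integration.integral_combine) auto
  have 2: "integral {- real n..real m} u + integral {real m..real n} u = integral {- real n..real n} u"
    using assms(3) int by (intro Henstock_Kurzweil_Integration.integral_combine) auto
  have "integral {- real n..real n} u - integral {- real m..real m} u
      = integral {- real n..- real m} u + integral {real m..real n} u"
    using 1 2 by (simp add: algebra_simps)
  also have "norm \<dots> \<le> K * (arctan (- real m) - arctan (- real n)) + K * (arctan n - arctan m)"
    by (rule order_trans[OF norm_triangle_ineq add_mono]) (use assms(3) in \<open>auto intro!: bound\<close>)
  finally show ?thesis by (simp add: arctan_minus algebra_simps)
qed

lemma line_integral_converges:
  fixes u :: "real \<Rightarrow> 'a::banach"
  assumes "continuous_on UNIV u" "\<And>\<xi>. norm (u \<xi>) \<le> K / (1 + \<xi>\<^sup>2)"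
  shows "(\<lambda>N. integral {- real N..real N} u) \<longlonglongrightarrow> line_integral u"
    and "norm (line_integral u - integral {- real m..real m} u) \<le> 2 * K * (pi / 2 - arctan m)"
proof -
  have K: "0 \<le> K" using assms(2)[of 0] by simp (metis norm_ge_zero order_trans)
  have at: "(\<lambda>n. arctan (real n)) \<longlonglongrightarrow> pi / 2"
    by (rule filterlim_compose[OF tendsto_arctan_at_top filterlim_real_sequentially])
  have "Cauchy (\<lambda>N. integral {- real N..real N} u)"
  proof (rule metric_CauchyI)
    fix e :: real assume "e > 0"
    from LIMSEQ_imp_Cauchy[OF at] have "Cauchy (\<lambda>n. arctan (real n))" .
    \<comment> \<open>The denominator \<open>2 * K + 1\<close> instead of \<open>2 * K\<close> also
      covers \<open>K = 0\<close>.\<close>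
    then obtain M where M: "dist (arctan (real m)) (arctan (real n)) < e / (2 * K + 1)" if "m \<ge> M" "n \<ge> M" for m n
      using \<open>e > 0\<close> K by (meson metric_CauchyD divide_pos_pos add_nonneg_pos mult_nonneg_nonneg zero_less_one zero_le_numeral)
    have *: "norm (integral {- real n..real n} u - integral {- real m..real m} u) < e"
      if "M \<le> m" "m \<le> n" for m n
    proof -
      have "norm (integral {- real n..real n} u - integral {- real m..real m} u)
          \<le> 2 * K * (arctan n - arctan m)"
        using line_integral_tail[OF assms] that by blast
      also have "\<dots> \<le> 2 * K * (e / (2 * K + 1))"
        using M[of m n] that K by (intro mult_left_mono) (auto simp: dist_real_def)
      also have "\<dots> < e" using K \<open>e > 0\<close> by (simp add: field_simps)
      finally show ?thesis .
    qed
    show "\<exists>M. \<forall>m\<ge>M. \<forall>n\<ge>M. dist (integral {- real m..real m} u) (integral {- real n..real n} u) < e"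
    proof (intro exI[of _ M] allI impI)
      fix m n assume "M \<le> m" "M \<le> n"
      then show "dist (integral {- real m..real m} u) (integral {- real n..real n} u) < e"
        using *[of m n] *[of n m] by (cases "m \<le> n") (auto simp: dist_norm norm_minus_commute)
    qed
  qed
  then show lim: "(\<lambda>N. integral {- real N..real N} u) \<longlonglongrightarrow> line_integral u"
    unfolding line_integral_def by (simp add: Cauchy_convergent_iff convergent_LIMSEQ_iff)
  show "norm (line_integral u - integral {- real m..real m} u) \<le> 2 * K * (pi / 2 - arctan m)"
  proof (rule tendsto_le[OF _ _ _ ])
    show "(\<lambda>n. norm (integral {- real n..real n} u - integral {- real m..real m} u))
       \<longlonglongrightarrow> norm (line_integral u - integral {- real m..real m} u)"
      by (intro tendsto_intros lim)
    show "(\<lambda>n. 2 * K * (arctan n - arctan m)) \<longlonglongrightarrow> 2 * K * (pi / 2 - arctan m)"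
      by (intro tendsto_intros at)
    show "\<forall>\<^sub>F n in sequentially. norm (integral {- real n..real n} u - integral {- real m..real m} u)
        \<le> 2 * K * (arctan n - arctan m)"
      using eventually_ge_at_top[of m] by eventually_elim (rule line_integral_tail[OF assms])
  qed simp
qed

lemma line_integral_eqI: "(\<lambda>N. integral {- real N..real N} u) \<longlonglongrightarrow> l \<Longrightarrow> line_integral u = l"
  unfolding line_integral_def by (rule limI)

lemma uniform_limit_line_integral:
  fixes u :: "real \<Rightarrow> real \<Rightarrow> 'a::banach"
  assumes "\<And>t. t \<in> S \<Longrightarrow> continuous_on UNIV (u t)" "\<And>t \<xi>. t \<in> S \<Longrightarrow> norm (u t \<xi>) \<le> K / (1 + \<xi>\<^sup>2)"
  shows "uniform_limit S (\<lambda>N t. integral {- real N..real N} (u t)) (\<lambda>t. line_integral (u t)) sequentially"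
proof (rule uniform_limitI)
  fix e :: real assume "e > 0"
  have "(\<lambda>n. 2 * K * (pi / 2 - arctan (real n))) \<longlonglongrightarrow> 2 * K * (pi / 2 - pi / 2)"
    by (intro tendsto_intros filterlim_compose[OF tendsto_arctan_at_top filterlim_real_sequentially])
  then have "\<forall>\<^sub>F n in sequentially. 2 * K * (pi / 2 - arctan (real n)) < e"
    using \<open>e > 0\<close> by (intro order_tendstoD) auto
  then show "\<forall>\<^sub>F n in sequentially. \<forall>t\<in>S. dist (integral {- real n..real n} (u t)) (line_integral (u t)) < e"
  proof eventually_elim
    case (elim n)
    show ?case
    proof
      fix t assume "t \<in> S"
      from line_integral_converges(2)[OF assms(1,2)[OF this], of n] elim
      show "dist (integral {- real n..real n} (u t)) (line_integral (u t)) < e"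
        by (simp add: dist_norm norm_minus_commute)
    qed
  qed
qed

section \<open>Vector-valued holomorphic functions and contour shifts\<close>

text \<open>Complex differentiability into a normed space is real differentiability whose derivative
  multiplies \<open>v\<close> by complex numbers; the Cauchy-Riemann equations are thus built
  in.\<close>

definition has_cderiv ::
    "(complex \<Rightarrow> 'a::complex_normed_vector) \<Rightarrow> 'a \<Rightarrow> complex \<Rightarrow> bool"
  where "has_cderiv u v \<zeta> \<longleftrightarrow> (u has_derivative (\<lambda>h. h *\<^sub>C v)) (at \<zeta>)"

text \<open>Shaped for the resolvent identity, which displays the difference quotient
  \<open>q\<close> explicitly, so that only its limit is left to determine.\<close>

lemma has_cderivI:
  fixes u :: "complex \<Rightarrow> 'a::complex_normed_vector"
  assumes "\<forall>\<^sub>F w in at \<zeta>. u w = u \<zeta> + (w - \<zeta>) *\<^sub>C q w" "(q \<longlongrightarrow> v) (at \<zeta>)"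
  shows "has_cderiv u v \<zeta>"
  unfolding has_cderiv_def has_derivative_within
proof (intro conjI)
  show "bounded_linear (\<lambda>h. h *\<^sub>C v)" by (rule scaleC.bounded_linear_left)
  have *: "((\<lambda>w. norm (q w - v)) \<longlongrightarrow> 0) (at \<zeta>)"
    using assms(2) by (simp add: LIM_zero tendsto_norm_zero)
  show "((\<lambda>y. (1 / norm (y - \<zeta>)) *\<^sub>R (u y - (u \<zeta> + (y - \<zeta>) *\<^sub>C v))) \<longlongrightarrow> 0) (at \<zeta>)"
  proof (rule tendsto_norm_zero_cancel, rule Lim_transform_eventually[OF *])
    show "\<forall>\<^sub>F y in at \<zeta>. norm (q y - v) = norm ((1 / norm (y - \<zeta>)) *\<^sub>R (u y - (u \<zeta> + (y - \<zeta>) *\<^sub>C v)))"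
      using assms(1) eventually_neq_at_within[of \<zeta>]
      by eventually_elim (simp add: scaleC.diff_right[symmetric] norm_scaleC)
  qed
qed

lemma has_cderiv_scaleC:
  assumes "(f has_field_derivative f') (at \<zeta>)" "has_cderiv u v \<zeta>"
  shows "has_cderiv (\<lambda>\<zeta>. f \<zeta> *\<^sub>C u \<zeta>) (f' *\<^sub>C u \<zeta> + f \<zeta> *\<^sub>C v) \<zeta>"
  using scaleC.FDERIV[OF assms(1)[unfolded has_field_derivative_def] assms(2)[unfolded has_cderiv_def]]
  unfolding has_cderiv_def
  by (rule has_derivative_eq_rhs) (auto simp: scaleC_scaleC scaleC_add_right algebra_simps)

lemma has_cderiv_const: "has_cderiv (\<lambda>_. w) 0 \<zeta>"
  unfolding has_cderiv_def by simp

text \<open>The directions \<open>1\<close> and \<open>\<i>\<close> turn the complex derivative into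
  derivatives along the horizontal and vertical sides of a rectangle.\<close>

lemma has_cderiv_line:
  assumes "has_cderiv u v (a + of_real s * d)"
  shows "((\<lambda>s. u (a + of_real s * d)) has_vector_derivative d *\<^sub>C v) (at s within S)"
proof -
  have "((\<lambda>s. a + of_real s * d) has_derivative (\<lambda>h. of_real h * d)) (at s within S)"
    by (auto intro!: derivative_eq_intros)
  from has_derivative_compose[OF this assms[unfolded has_cderiv_def]]
  show ?thesis unfolding has_vector_derivative_def
    by (rule has_derivative_eq_rhs)
      (auto simp: scaleC_scaleC[symmetric] scaleC_of_real)
qed

lemma norm_Complex_square: "norm (Complex x y) ^ 2 = x\<^sup>2 + y\<^sup>2"
  by (simp add: cmod_def)

text \<open>The integral is pushed to the right along the half-plane: the line \<open>Re \<lambda> = n\<close> together with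
  the two horizontal segments of the rectangle contribute \<open>O(1/n)\<close>.\<close>

lemma integral_vertical_line_tendsto_0:
  fixes u :: "complex \<Rightarrow> 'a::complex_banach"
  assumes der: "\<And>\<zeta>. Re \<zeta> > \<omega> \<Longrightarrow> has_cderiv u (u' \<zeta>) \<zeta>"
    and cont: "continuous_on {\<zeta>. Re \<zeta> > \<omega>} u'"
    and bound: "\<And>\<zeta>. Re \<zeta> > \<omega> \<Longrightarrow> norm (u \<zeta>) \<le> K / (cmod \<zeta>)\<^sup>2"
    and \<gamma>: "\<gamma> > \<omega>" "\<omega> \<ge> 0"
  shows "(\<lambda>N. integral {- real N..real N} (\<lambda>\<xi>. u (Complex \<gamma> \<xi>))) \<longlonglongrightarrow> 0"
proof (rule Lim_null_comparison)
  have K: "K \<ge> 0"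
  proof -
    have "0 \<le> K / (cmod (of_real \<gamma>))\<^sup>2" using bound[of "of_real \<gamma>"] \<gamma> norm_ge_zero order_trans
      by (metis Re_complex_of_real)
    then show ?thesis using \<gamma> by (simp add: zero_le_divide_iff)
  qed
  have contu: "continuous_on {\<zeta>. Re \<zeta> > \<omega>} u"
    using der unfolding has_cderiv_def
    by (auto intro!: continuous_at_imp_continuous_on has_derivative_continuous)
  have boundn: "norm (u \<zeta>) \<le> K / (real n)\<^sup>2" if "Re \<zeta> > \<omega>" "n > 0" "cmod \<zeta> \<ge> n" for \<zeta> n
    using bound[OF that(1)] that K
    by (smt (verit, best) frac_le of_nat_0_less_iff power_mono zero_less_power of_nat_0_le_iff)
  \<comment> \<open>This is twice 2 * K / n: once for the two horizontal sides, of length at most n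
    with values at most K / n^2, and once for the right side, of length 2 * n.\<close>
  show "\<forall>\<^sub>F n in sequentially. norm (integral {- real n..real n} (\<lambda>\<xi>. u (Complex \<gamma> \<xi>))) \<le> 4 * K / real n"
    using eventually_gt_at_top[of "nat \<lceil>\<gamma>\<rceil>"]
  proof eventually_elim
    case (elim n)
    then have n: "\<gamma> < real n" "n > 0" using \<gamma> by linarith+
    have contN: "continuous_on ({- real n..real n} \<times> {\<gamma>..real n}) (\<lambda>(\<xi>, x). u' (Complex x \<xi>))"
      unfolding split_beta
      by (rule continuous_on_compose2[OF cont])
        (use \<gamma> in \<open>auto intro!: continuous_intros simp: Complex_eq\<close>)
    have cu: "continuous_on {- real n..real n} (\<lambda>\<xi>. u (Complex x \<xi>))" if "x \<ge> \<gamma>" for x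
      by (rule continuous_on_compose2[OF contu])
        (use \<gamma> that in \<open>auto intro!: continuous_intros simp: Complex_eq\<close>)
    have cu': "continuous_on {- real n..real n} (\<lambda>\<xi>. u' (Complex x \<xi>))" if "x \<ge> \<gamma>" for x
      by (rule continuous_on_compose2[OF cont])
        (use \<gamma> that in \<open>auto intro!: continuous_intros simp: Complex_eq\<close>)
    \<comment> \<open>Cauchy's theorem on the rectangle comes from integrating \<open>u'\<close>
      over it in both orders. Horizontally first, this gives the difference of two vertical line
      integrals; vertically first, it involves \<open>u\<close> only on the two horizontal
      sides.\<close>
    have H: "integral {\<gamma>..real n} (\<lambda>x. u' (Complex x \<xi>)) = u (Complex n \<xi>) - u (Complex \<gamma> \<xi>)" for \<xi>
    proof (rule integral_unique, rule fundamental_theorem_of_calculus)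
      show "((\<lambda>x. u (Complex x \<xi>)) has_vector_derivative u' (Complex x \<xi>)) (at x within {\<gamma>..real n})"
        if "x \<in> {\<gamma>..real n}" for x
        using has_cderiv_line[OF der, of "\<i> * \<xi>" x 1 "{\<gamma>..real n}"] that \<gamma>
        by (simp add: Complex_eq add.commute)
    qed (use n in auto)
    have V: "norm (integral {- real n..real n} (\<lambda>\<xi>. u' (Complex x \<xi>))) \<le> 2 * K / (real n)\<^sup>2"
      if "x \<in> {\<gamma>..real n}" for x
    proof -
      have "((\<lambda>\<xi>. \<i> *\<^sub>C u' (Complex x \<xi>)) has_integral (u (Complex x n) - u (Complex x (- real n)))) {- real n..real n}"
      proof (rule fundamental_theorem_of_calculus)
        show "((\<lambda>\<xi>. u (Complex x \<xi>)) has_vector_derivative \<i> *\<^sub>C u' (Complex x \<xi>)) (at \<xi> within {- real n..real n})"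
          if "\<xi> \<in> {- real n..real n}" for \<xi>
          using has_cderiv_line[OF der, of x \<xi> \<i> "{- real n..real n}"] \<open>x \<in> _\<close> \<gamma>
          by (simp add: Complex_eq mult.commute)
      qed auto
      then have "\<i> *\<^sub>C integral {- real n..real n} (\<lambda>\<xi>. u' (Complex x \<xi>)) = u (Complex x n) - u (Complex x (- real n))"
        using that cu' by (subst integral_scaleC_right[symmetric]) (auto intro!: integrable_continuous_real integral_unique)
      then have "norm (integral {- real n..real n} (\<lambda>\<xi>. u' (Complex x \<xi>))) = norm (u (Complex x n) - u (Complex x (- real n)))"
        by (metis mult_1 norm_ii norm_scaleC)
      also have "\<dots> \<le> K / (real n)\<^sup>2 + K / (real n)\<^sup>2"
        by (rule order_trans[OF norm_triangle_ineq4 add_mono])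
          (use that \<gamma> n in \<open>auto intro!: boundn order_trans[OF _ abs_Im_le_cmod]\<close>)
      finally show ?thesis by simp
    qed
    have "integral {- real n..real n} (\<lambda>\<xi>. u (Complex n \<xi>)) - integral {- real n..real n} (\<lambda>\<xi>. u (Complex \<gamma> \<xi>))
        = integral {- real n..real n} (\<lambda>\<xi>. integral {\<gamma>..real n} (\<lambda>x. u' (Complex x \<xi>)))"
      unfolding H using n cu[of "real n"] cu[of \<gamma>]
      by (intro Henstock_Kurzweil_Integration.integral_diff[symmetric] integrable_continuous_real) auto
    also have "\<dots> = integral {\<gamma>..real n} (\<lambda>x. integral {- real n..real n} (\<lambda>\<xi>. u' (Complex x \<xi>)))"
      using integral_swap_continuous[of "- real n" \<gamma> "real n" "real n" "\<lambda>\<xi> x. u' (Complex x \<xi>)"] contN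
      by (simp add: cbox_Pair_eq)
    also have "norm \<dots> \<le> integral {\<gamma>..real n} (\<lambda>x. 2 * K / (real n)\<^sup>2)"
    proof (rule integral_norm_bound_integral[OF _ _ V])
      have "continuous_on {\<gamma>..real n} (\<lambda>x. integral (cbox (- real n) (real n)) (\<lambda>\<xi>. u' (Complex x \<xi>)))"
        by (rule integral_continuous_on_param, unfold split_beta, rule continuous_on_compose2[OF cont])
          (use \<gamma> in \<open>auto intro!: continuous_intros simp: Complex_eq\<close>)
      then show "(\<lambda>x. integral {- real n..real n} (\<lambda>\<xi>. u' (Complex x \<xi>))) integrable_on {\<gamma>..real n}"
        by (simp add: integrable_continuous_real)
    qed auto
    also have "\<dots> = (real n - \<gamma>) * (2 * K / (real n)\<^sup>2)"
      using n by simp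
    also have "\<dots> \<le> real n * (2 * K / (real n)\<^sup>2)"
      using \<gamma> K by (intro mult_right_mono) auto
    finally have 1: "norm (integral {- real n..real n} (\<lambda>\<xi>. u (Complex n \<xi>)) - integral {- real n..real n} (\<lambda>\<xi>. u (Complex \<gamma> \<xi>)))
        \<le> 2 * K / real n"
      using n by (simp add: power2_eq_square)
    have "norm (integral {- real n..real n} (\<lambda>\<xi>. u (Complex n \<xi>))) \<le> integral {- real n..real n} (\<lambda>x. K / (real n)\<^sup>2)"
      by (rule integral_norm_bound_integral)
        (use n \<gamma> cu[of "real n"] in \<open>auto intro!: boundn integrable_continuous_real order_trans[OF _ abs_Re_le_cmod]\<close>)
    also have "\<dots> = 2 * K / real n" using n by (simp add: power2_eq_square)
    finally show ?case using 1 by (simp add: norm_minus_commute) (smt (verit) norm_triangle_sub add_divide_distrib)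
  qed
  show "(\<lambda>n. 4 * K / real n) \<longlonglongrightarrow> 0"
    by (rule tendsto_divide_0[OF tendsto_const filterlim_real_sequentially[THEN filterlim_at_top_imp_at_infinity]])
qed

text \<open>The segment is closed to a rectangle on its left, where |exp(\<lambda> \<tau>)| stays
  below exp(\<gamma> \<tau>) because \<tau> \<ge> 0. The double pole at 0 has residue \<tau>, and
  the square in the denominator outweighs the length of the added sides.\<close>

lemma exp_over_square_line_integral:
  fixes \<gamma> \<tau> :: real
  assumes \<gamma>: "\<gamma> > 0" and \<tau>: "\<tau> \<ge> 0"
  shows "(\<lambda>N. integral {- real N..real N} (\<lambda>\<xi>. exp (Complex \<gamma> \<xi> * of_real \<tau>) * inverse (Complex \<gamma> \<xi>) ^ 2))
    \<longlonglongrightarrow> of_real (2 * pi * \<tau>)"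
proof -
  define f where "f z = exp (z * of_real \<tau>) / z ^ 2" for z :: complex
  define k where "k n = integral {- real n..real n} (\<lambda>\<xi>. exp (Complex \<gamma> \<xi> * of_real \<tau>) * inverse (Complex \<gamma> \<xi>) ^ 2)" for n :: nat
  \<comment> \<open>The constant \<open>6\<close> counts three added sides of length at most 2 * n
    each, on which |f| is at most exp(\<gamma> \<tau>) / n^2.\<close>
  have est: "norm (of_real (2 * pi * \<tau>) - k n) \<le> 6 * exp (\<gamma> * \<tau>) / real n" if n: "real n > \<gamma>" "n > 0" for n
  proof -
    define B where "B = exp (\<gamma> * \<tau>) / (real n)\<^sup>2"
    define a1 a2 a3 a4 where a: "a1 = Complex (- n) (- n)" "a2 = Complex \<gamma> (- n)" "a3 = Complex \<gamma> n" "a4 = Complex (- n) n"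
    have rp: "rectpath a1 a3 = linepath a1 a2 +++ linepath a2 a3 +++ linepath a3 a4 +++ linepath a4 a1"
      by (simp add: rectpath_def Let_def a)
    have seg: "closed_segment a1 a2 \<subseteq> {z. Im z = - n \<and> Re z \<le> \<gamma>}" "closed_segment a2 a3 \<subseteq> {z. Re z = \<gamma>}"
        "closed_segment a3 a4 \<subseteq> {z. Im z = n \<and> Re z \<le> \<gamma>}" "closed_segment a4 a1 \<subseteq> {z. Re z = - n}"
      using n \<gamma> by (auto simp: a closed_segment_same_Re closed_segment_same_Im closed_segment_eq_real_ivl)
    have ci: "f contour_integrable_on linepath a b" if "0 \<notin> closed_segment a b" for a b
      unfolding f_def using that by (intro contour_integrable_continuous_linepath continuous_intros) auto
    have nz: "0 \<notin> closed_segment a1 a2" "0 \<notin> closed_segment a2 a3" "0 \<notin> closed_segment a3 a4" "0 \<notin> closed_segment a4 a1"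
      using seg n \<gamma> by auto
    note cis = ci[OF nz(1)] ci[OF nz(2)] ci[OF nz(3)] ci[OF nz(4)]
    have sum: "contour_integral (rectpath a1 a3) f = contour_integral (linepath a1 a2) f
        + (contour_integral (linepath a2 a3) f + (contour_integral (linepath a3 a4) f + contour_integral (linepath a4 a1) f))"
      unfolding rp using cis by (simp add: contour_integrable_joinI)
    have res: "contour_integral (rectpath a1 a3) f = 2 * pi * \<i> * \<tau>"
    proof -
      have "contour_integral (rectpath a1 a3) f = 2 * pi * \<i> * (\<Sum>p\<in>{0}. winding_number (rectpath a1 a3) p * residue f p)"
      proof (rule Residue_theorem[of UNIV])
        show "path_image (rectpath a1 a3) \<subseteq> UNIV - {0}"
          using n \<gamma> by (subst path_image_rectpath) (auto simp: a)
        show "f holomorphic_on UNIV - {0}" unfolding f_def by (intro holomorphic_intros) auto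
      qed auto
      moreover have "winding_number (rectpath a1 a3) 0 = 1"
        using n \<gamma> by (intro winding_number_rectpath) (auto simp: a in_box_complex_iff)
      moreover have "residue f 0 = \<tau>"
      proof -
        have "residue (\<lambda>z. exp (z * of_real \<tau>) / z ^ Suc 1) 0 = (deriv ^^ 1) (\<lambda>z. exp (z * of_real \<tau>)) 0 / fact 1"
          by (rule residue_holomorphic_over_power'[of UNIV]) (auto intro!: holomorphic_intros)
        moreover have "deriv (\<lambda>z. exp (z * complex_of_real \<tau>)) 0 = \<tau>"
          by (rule DERIV_imp_deriv) (auto intro!: derivative_eq_intros)
        ultimately show ?thesis by (simp add: f_def[abs_def] numeral_2_eq_2)
      qed
      ultimately show ?thesis by simp
    qed
    have line: "contour_integral (linepath a2 a3) f = \<i> * k n"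
    proof -
      have "(f has_contour_integral contour_integral (linepath a2 a3) f) (linepath a2 a3)"
        using cis(2) by (rule has_contour_integral_integral)
      then have "((\<lambda>x. f (Complex \<gamma> x)) has_integral (-\<i> * contour_integral (linepath a2 a3) f)) {- real n..real n}"
        using n by (subst (asm) has_contour_integral_linepath_same_Re_iff[of _ \<gamma> _ "- n" n]) (auto simp: a)
      then have "k n = -\<i> * contour_integral (linepath a2 a3) f"
        unfolding k_def by (intro integral_unique) (simp add: f_def power_inverse divide_inverse)
      then show ?thesis by simp
    qed
    have B: "B \<ge> 0" by (simp add: B_def)
    have fB: "norm (f z) \<le> B" if "Re z \<le> \<gamma>" "\<bar>Re z\<bar> = n \<or> \<bar>Im z\<bar> = n" for z
    proof -
      have "real n \<le> cmod z" using that(2) abs_Re_le_cmod[of z] abs_Im_le_cmod[of z] by auto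
      then have "(real n)\<^sup>2 \<le> (cmod z)\<^sup>2" by (intro power_mono) auto
      moreover have "exp (Re z * \<tau>) \<le> exp (\<gamma> * \<tau>)" using that \<tau> by (simp add: mult_right_mono)
      ultimately show ?thesis unfolding f_def B_def norm_divide norm_power
        using n by (intro frac_le) auto
    qed
    have len: "norm (a2 - a1) \<le> 2 * n" "norm (a4 - a3) \<le> 2 * n" "norm (a1 - a4) \<le> 2 * n"
      using n \<gamma> by (auto simp: a cmod_def real_sqrt_mult)
    have b1: "norm (contour_integral (linepath a1 a2) f) \<le> B * (2 * n)"
      by (rule order_trans[OF contour_integral_bound_linepath[OF cis(1) B fB] mult_left_mono[OF len(1) B]])
        (use seg(1) in auto)
    have b3: "norm (contour_integral (linepath a3 a4) f) \<le> B * (2 * n)"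
      by (rule order_trans[OF contour_integral_bound_linepath[OF cis(3) B fB] mult_left_mono[OF len(2) B]])
        (use seg(3) in auto)
    have b4: "norm (contour_integral (linepath a4 a1) f) \<le> B * (2 * n)"
      by (rule order_trans[OF contour_integral_bound_linepath[OF cis(4) B fB] mult_left_mono[OF len(3) B]])
        (use seg(4) n \<gamma> in auto)
    have "\<i> * (of_real (2 * pi * \<tau>) - k n) = contour_integral (linepath a1 a2) f
        + contour_integral (linepath a3 a4) f + contour_integral (linepath a4 a1) f"
      using sum res line by (simp add: algebra_simps)
    then have "norm (of_real (2 * pi * \<tau>) - k n) = norm (contour_integral (linepath a1 a2) f
        + contour_integral (linepath a3 a4) f + contour_integral (linepath a4 a1) f)"
      by (metis mult_1 norm_ii norm_mult)
    also have "\<dots> \<le> B * (2 * n) + B * (2 * n) + B * (2 * n)"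
      by (intro order_trans[OF norm_triangle_ineq] add_mono b1 b3 b4)
    also have "\<dots> = 6 * exp (\<gamma> * \<tau>) / real n"
      using n by (simp add: B_def power2_eq_square)
    finally show ?thesis .
  qed
  have "(\<lambda>n. of_real (2 * pi * \<tau>) - k n) \<longlonglongrightarrow> 0"
  proof (rule Lim_null_comparison)
    show "\<forall>\<^sub>F n in sequentially. norm (of_real (2 * pi * \<tau>) - k n) \<le> 6 * exp (\<gamma> * \<tau>) / real n"
      using eventually_gt_at_top[of "nat \<lceil>\<gamma>\<rceil>"]
      by eventually_elim (rule est, use \<gamma> in linarith, use \<gamma> in linarith)
    show "(\<lambda>n. 6 * exp (\<gamma> * \<tau>) / real n) \<longlonglongrightarrow> 0"
      by (rule tendsto_divide_0[OF tendsto_const filterlim_real_sequentially[THEN filterlim_at_top_imp_at_infinity]])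
  qed
  from tendsto_diff[OF tendsto_const[of "of_real (2 * pi * \<tau>)"] this]
  show ?thesis by (simp add: k_def)
qed

section \<open>The scalar resolvent equation with a continuous right-hand side\<close>

text \<open>For continuous \<open>G\<close> with \<open>G 0 = 0\<close>, \<open>resp G \<zeta>\<close> is the mild solution of \<open>Y' = \<zeta> Y + G'\<close>,
  \<open>Y 0 = 0\<close>, i.e. \<open>\<integral>\<^sub>0\<^sup>t exp (\<zeta> (t - s)) dG(s)\<close> integrated by parts, so that no derivative of \<open>G\<close>
  occurs; \<open>resp_int G \<zeta>\<close> is its primitive.\<close>

definition resp_int :: "(real \<Rightarrow> 'w::complex_banach) \<Rightarrow> complex \<Rightarrow> real \<Rightarrow> 'w"
  where "resp_int G \<zeta> t = exp (\<zeta> * of_real t) *\<^sub>C integral {0..t} (\<lambda>s. exp (- \<zeta> * of_real s) *\<^sub>C G s)"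

definition resp :: "(real \<Rightarrow> 'w::complex_banach) \<Rightarrow> complex \<Rightarrow> real \<Rightarrow> 'w"
  where "resp G \<zeta> t = G t + \<zeta> *\<^sub>C resp_int G \<zeta> t"

lemma has_vector_derivative_within_Ici:
  fixes t :: real
  assumes "t < T" "(f has_vector_derivative v) (at t within {0..T})"
  shows "(f has_vector_derivative v) (at t within {0..})"
proof -
  have "at t within {0..T} = at t within {0..}"
    by (rule at_within_nhd[of _ "{..<T}"]) (use assms(1) in auto)
  with assms(2) show ?thesis by simp
qed

lemma integral_has_vector_derivative_Ici:
  fixes g :: "real \<Rightarrow> 'a::banach"
  assumes "continuous_on {0..} g" "t \<ge> 0"
  shows "((\<lambda>t. integral {0..t} g) has_vector_derivative g t) (at t within {0..})"
  by (rule has_vector_derivative_within_Ici[of _ "t + 1"], simp, rule integral_has_vector_derivative)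
    (use assms in \<open>auto intro: continuous_on_subset\<close>)

lemma continuous_on_integral_Ici:
  fixes g :: "real \<Rightarrow> 'a::banach"
  assumes "continuous_on {0..} g"
  shows "continuous_on {0..} (\<lambda>t. integral {0..t} g)"
  using integral_has_vector_derivative_Ici[OF assms]
  by (auto simp: continuous_on_eq_continuous_within intro!: has_vector_derivative_continuous)

text \<open>Both primitives are differentiated within the half-line, where each point is a limit
  point and the derivative is therefore unique. This lets pointwise identities be checked after one
  integration in time.\<close>

lemma integral_determines_continuous:
  fixes g h :: "real \<Rightarrow> 'a::banach"
  assumes "continuous_on {0..} g" "continuous_on {0..} h"
    "\<And>t. t \<ge> 0 \<Longrightarrow> integral {0..t} g = integral {0..t} h" "t \<ge> 0"
  shows "g t = h t"
proof -
  have "((\<lambda>t. integral {0..t} g) has_vector_derivative h t) (at t within {0..})"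
    by (rule has_vector_derivative_transform[OF _ _ integral_has_vector_derivative_Ici[OF assms(2,4)]])
      (use assms in auto)
  moreover have "t islimpt {0..}"
  proof -
    have "t islimpt {t..t+1}" by (simp add: islimpt_finite islimpt_greaterThanLessThan1 trivial_limit_within[symmetric])
    then show ?thesis using assms(4) by (meson Icc_subset_Ici_iff islimpt_subset le_add_same_cancel1 zero_le_one)
  qed
  ultimately show ?thesis
    using integral_has_vector_derivative_Ici[OF assms(1,4)] vector_derivative_unique_within
    by (metis trivial_limit_within)
qed

context
  fixes G :: "real \<Rightarrow> 'w::complex_banach"
  assumes G: "continuous_on {0..} G"
begin

lemma continuous_on_exp_G: "continuous_on {0..} (\<lambda>s. exp (\<zeta> * of_real s) *\<^sub>C G s)"
  by (intro continuous_intros G)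

text \<open>The substitution s = t \<sigma> moves t from the upper limit into the integrand;
  continuity of parameter integrals over the fixed interval [0, 1] then gives joint
  continuity.\<close>

lemma continuous_on_resp_int: "continuous_on (UNIV \<times> {0..}) (\<lambda>(\<zeta>, t). resp_int G \<zeta> t)"
proof -
  have sub: "integral {0..t} (\<lambda>s. exp (- \<zeta> * of_real s) *\<^sub>C G s)
      = t *\<^sub>R integral (cbox 0 1) (\<lambda>\<sigma>. exp (- \<zeta> * of_real (t * \<sigma>)) *\<^sub>C G (t * \<sigma>))" if "t \<ge> 0" for \<zeta> t
  proof (cases "t = 0")
    case False
    have "(\<lambda>x. x / t) ` {0..t} = {0..1}"
      using False that by (simp add: image_divide_atLeastAtMost)
    moreover have "((\<lambda>s. exp (- \<zeta> * of_real s) *\<^sub>C G s) has_integral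
        integral {0..t} (\<lambda>s. exp (- \<zeta> * of_real s) *\<^sub>C G s)) {0..t}"
      by (intro integrable_integral integrable_continuous_real continuous_on_subset[OF continuous_on_exp_G]) auto
    ultimately have "((\<lambda>\<sigma>. exp (- \<zeta> * of_real (t * \<sigma>)) *\<^sub>C G (t * \<sigma>)) has_integral
        (1 / t) *\<^sub>R integral {0..t} (\<lambda>s. exp (- \<zeta> * of_real s) *\<^sub>C G s)) {0..1}"
      using has_integral_stretch_real[of "\<lambda>s. exp (- \<zeta> * of_real s) *\<^sub>C G s" _ 0 t t] that False by auto
    then show ?thesis using False by (simp add: integral_unique)
  qed simp
  have "continuous_on (UNIV \<times> {0..}) (\<lambda>p. integral (cbox 0 1) (\<lambda>\<sigma>. exp (- fst p * of_real (snd p * \<sigma>)) *\<^sub>C G (snd p * \<sigma>)))"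
    by (rule integral_continuous_on_param, unfold split_beta)
      (auto intro!: continuous_intros continuous_on_compose2[OF G])
  then have "continuous_on (UNIV \<times> {0..}) (\<lambda>p. exp (fst p * of_real (snd p)) *\<^sub>C (snd p *\<^sub>R
      integral (cbox 0 1) (\<lambda>\<sigma>. exp (- fst p * of_real (snd p * \<sigma>)) *\<^sub>C G (snd p * \<sigma>))))"
    by (intro continuous_intros)
  then show ?thesis
  proof (rule continuous_on_eq)
    fix p :: "complex \<times> real" assume "p \<in> UNIV \<times> {0..}"
    then have "snd p \<ge> 0" by auto
    from sub[OF this, of "fst p"] show "exp (fst p * of_real (snd p)) *\<^sub>C (snd p *\<^sub>R
      integral (cbox 0 1) (\<lambda>\<sigma>. exp (- fst p * of_real (snd p * \<sigma>)) *\<^sub>C G (snd p * \<sigma>)))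
      = (case p of (\<zeta>, t) \<Rightarrow> resp_int G \<zeta> t)"
      unfolding resp_int_def split_beta by simp
  qed
qed

lemma continuous_on_resp: "continuous_on (UNIV \<times> {0..}) (\<lambda>(\<zeta>, t). resp G \<zeta> t)"
  unfolding resp_def split_beta
  by (intro continuous_intros continuous_on_compose2[OF G] continuous_on_resp_int[unfolded split_beta]) auto

lemma has_vector_derivative_resp_int:
  assumes "t \<ge> 0"
  shows "(resp_int G \<zeta> has_vector_derivative resp G \<zeta> t) (at t within {0..})"
proof -
  have 1: "((\<lambda>t. exp (\<zeta> * of_real t)) has_vector_derivative \<zeta> * exp (\<zeta> * of_real t)) (at t within {0..})"
    by (auto intro!: derivative_eq_intros has_vector_derivative_real_field)
  show ?thesis unfolding resp_int_def[abs_def]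
    by (rule has_vector_derivative_eq_rhs[OF scaleC.has_vector_derivative[OF 1
          integral_has_vector_derivative_Ici[OF continuous_on_exp_G assms]]])
      (simp add: resp_def resp_int_def scaleC_scaleC flip: exp_add)
qed

lemma integral_resp:
  assumes "t \<ge> 0"
  shows "(resp G \<zeta> has_integral resp_int G \<zeta> t) {0..t}"
proof -
  have "(resp G \<zeta> has_integral (resp_int G \<zeta> t - resp_int G \<zeta> 0)) {0..t}"
    using assms
    by (intro fundamental_theorem_of_calculus has_vector_derivative_within_subset[OF has_vector_derivative_resp_int]) auto
  then show ?thesis by (simp add: resp_int_def)
qed

lemma resp_0: "G 0 = 0 \<Longrightarrow> resp G \<zeta> 0 = 0"
  by (simp add: resp_def resp_int_def)

text \<open>This replaces \<open>norm (\<integral> exp (\<zeta> (t - s)) dG(s)) \<le> exp (Re \<zeta> t) \<integral> norm dG\<close>, with \<open>M\<close> a majorant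
  of the variation of \<open>G\<close>.\<close>

lemma norm_resp_le:
  assumes M: "\<And>a b. 0 \<le> a \<Longrightarrow> a \<le> b \<Longrightarrow> norm (G b - G a) \<le> M b - M a"
    and "G 0 = 0" "Re \<zeta> \<ge> 0" "t \<ge> 0"
  shows "norm (resp G \<zeta> t) \<le> exp (Re \<zeta> * t) * (M t - M 0)"
proof -
  \<comment> \<open>Undoing the exponential turns \<open>resp\<close> into the Stieltjes integral of
    exp(- \<zeta> s) dG(s), written by parts.\<close>
  define h where "h t = exp (- \<zeta> * of_real t) *\<^sub>C resp G \<zeta> t" for t
  have exp1: "norm (exp (- \<zeta> * complex_of_real s)) \<le> 1" if "s \<ge> 0" for s
    using that assms(3) by simp
  have h: "h t = exp (- \<zeta> * of_real t) *\<^sub>C G t + \<zeta> *\<^sub>C integral {0..t} (\<lambda>s. exp (- \<zeta> * of_real s) *\<^sub>C G s)" for t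
    by (simp add: h_def resp_def resp_int_def scaleC_add_right scaleC_scaleC flip: exp_add)
      (simp add: mult.left_commute flip: exp_add)
  have mono: "M a \<le> M b" if "0 \<le> a" "a \<le> b" for a b
    using M[OF that] norm_ge_zero[of "G b - G a"] by linarith
  \<comment> \<open>The excess over \<open>M b - M a\<close> is of second order on short intervals:
    after summation over n equal pieces of [0, t] it disappears as n grows.\<close>
  have inc: "norm (h b - h a) \<le> (M b - M a) * (1 + cmod \<zeta> * (b - a))" if ab: "0 \<le> a" "a \<le> b" for a b
  proof -
    have ci: "(\<lambda>s. exp (- \<zeta> * of_real s) *\<^sub>C G s) integrable_on {u..v}" if "u \<ge> 0" for u v
      by (intro integrable_continuous_real continuous_on_subset[OF continuous_on_exp_G]) (use that in auto)
    have ci2: "(\<lambda>s. exp (- \<zeta> * of_real s) *\<^sub>C G a) integrable_on {a..b}"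
      by (intro integrable_continuous_real continuous_intros)
    \<comment> \<open>The exponential is integrated exactly against the constant \<open>G a\<close>;
      subtracting this under the integral leaves only increments of \<open>G\<close>.\<close>
    have "((\<lambda>s. - \<zeta> * exp (- \<zeta> * of_real s)) has_integral (exp (- \<zeta> * of_real b) - exp (- \<zeta> * of_real a))) {a..b}"
      using ab by (intro fundamental_theorem_of_calculus)
        (auto intro!: derivative_eq_intros has_vector_derivative_real_field)
    from has_integral_linear[OF this scaleC.bounded_linear_left[of "G a"]]
    have "integral {a..b} (\<lambda>s. (- \<zeta>) *\<^sub>C exp (- \<zeta> * of_real s) *\<^sub>C G a)
        = (exp (- \<zeta> * of_real b) - exp (- \<zeta> * of_real a)) *\<^sub>C G a"
      unfolding o_def scaleC_scaleC by (rule integral_unique)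
    then have e: "\<zeta> *\<^sub>C integral {a..b} (\<lambda>s. exp (- \<zeta> * of_real s) *\<^sub>C G a)
        = - ((exp (- \<zeta> * of_real b) - exp (- \<zeta> * of_real a)) *\<^sub>C G a)"
      unfolding scaleC.minus_left Henstock_Kurzweil_Integration.integral_neg integral_scaleC_right[OF ci2]
      by (rule minus_equation_iff[THEN iffD1, THEN sym])
    have "h b - h a = exp (- \<zeta> * of_real b) *\<^sub>C G b - exp (- \<zeta> * of_real a) *\<^sub>C G a
        + \<zeta> *\<^sub>C integral {a..b} (\<lambda>s. exp (- \<zeta> * of_real s) *\<^sub>C G s)"
      unfolding h Henstock_Kurzweil_Integration.integral_combine[OF ab ci[of 0 b], symmetric, OF order_refl]
        scaleC_add_right by simp
    also have "\<dots> = exp (- \<zeta> * of_real b) *\<^sub>C (G b - G a)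
        + \<zeta> *\<^sub>C integral {a..b} (\<lambda>s. exp (- \<zeta> * of_real s) *\<^sub>C (G s - G a))"
    proof -
      have "integral {a..b} (\<lambda>s. exp (- \<zeta> * of_real s) *\<^sub>C (G s - G a))
        = integral {a..b} (\<lambda>s. exp (- \<zeta> * of_real s) *\<^sub>C G s) - integral {a..b} (\<lambda>s. exp (- \<zeta> * of_real s) *\<^sub>C G a)"
        unfolding scaleC.diff_right using ab by (intro Henstock_Kurzweil_Integration.integral_diff ci ci2)
      then show ?thesis using e by (simp add: scaleC.diff_right scaleC.diff_left)
    qed
    also have "norm \<dots> \<le> 1 * (M b - M a) + cmod \<zeta> * ((M b - M a) * (b - a))"
    proof (intro order_trans[OF norm_triangle_ineq] add_mono)
      show "norm (exp (- \<zeta> * of_real b) *\<^sub>C (G b - G a)) \<le> 1 * (M b - M a)"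
        unfolding norm_scaleC using M[OF ab] exp1[of b] ab by (intro mult_mono) auto
      have "norm (integral {a..b} (\<lambda>s. exp (- \<zeta> * of_real s) *\<^sub>C (G s - G a))) \<le> (M b - M a) * (b - a)"
      proof (rule integral_bound)
        show "continuous_on {a..b} (\<lambda>s. exp (- \<zeta> * of_real s) *\<^sub>C (G s - G a))"
          by (intro continuous_intros continuous_on_subset[OF G]) (use ab in auto)
        show "norm (exp (- \<zeta> * of_real s) *\<^sub>C (G s - G a)) \<le> M b - M a" if "s \<in> {a..b}" for s
        proof -
          have "norm (exp (- \<zeta> * of_real s) *\<^sub>C (G s - G a)) \<le> 1 * (M s - M a)"
            unfolding norm_scaleC using M[of a s] exp1[of s] ab that by (intro mult_mono) auto
          also have "\<dots> \<le> M b - M a" using mono[of s b] that ab by auto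
          finally show ?thesis .
        qed
      qed (use ab in auto)
      then show "norm (\<zeta> *\<^sub>C integral {a..b} (\<lambda>s. exp (- \<zeta> * of_real s) *\<^sub>C (G s - G a)))
          \<le> cmod \<zeta> * ((M b - M a) * (b - a))"
        unfolding norm_scaleC by (intro mult_left_mono) auto
    qed
    finally show ?thesis by (simp add: algebra_simps)
  qed
  have mesh: "norm (h t) \<le> (M t - M 0) * (1 + cmod \<zeta> * (t / real n))" if n: "n > 0" for n :: nat
  proof -
    define x where "x i = real i * t / real n" for i
    have x: "0 \<le> x i" "x i \<le> x (Suc i)" "x (Suc i) - x i = t / real n" for i
      using assms(4) n by (auto simp: x_def field_simps)
    have "h t - h 0 = h (x n) - h (x 0)" using n by (simp add: x_def)
    also have "\<dots> = (\<Sum>i<n. h (x (Suc i)) - h (x i))" by (rule sum_lessThan_telescope[symmetric])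
    also have "norm \<dots> \<le> (\<Sum>i<n. (M (x (Suc i)) - M (x i)) * (1 + cmod \<zeta> * (t / real n)))"
      by (intro sum_norm_le) (metis inc x)
    also have "\<dots> = (M (x n) - M (x 0)) * (1 + cmod \<zeta> * (t / real n))"
      unfolding sum_distrib_right[symmetric] sum_lessThan_telescope[of "\<lambda>i. M (x i)"] ..
    also have "\<dots> = (M t - M 0) * (1 + cmod \<zeta> * (t / real n))" using n by (simp add: x_def)
    finally show ?thesis using resp_0[OF assms(2)] by (simp add: h_def)
  qed
  have "norm (h t) \<le> M t - M 0"
  proof (rule tendsto_lowerbound)
    have "(\<lambda>n. t / real n) \<longlonglongrightarrow> 0"
      by (rule tendsto_divide_0[OF tendsto_const filterlim_real_sequentially[THEN filterlim_at_top_imp_at_infinity]])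
    then have "(\<lambda>n. (M t - M 0) * (1 + cmod \<zeta> * (t / real n))) \<longlonglongrightarrow> (M t - M 0) * (1 + cmod \<zeta> * 0)"
      by (intro tendsto_intros)
    then show "(\<lambda>n. (M t - M 0) * (1 + cmod \<zeta> * (t / real n))) \<longlonglongrightarrow> M t - M 0" by simp
    show "\<forall>\<^sub>F n in sequentially. norm (h t) \<le> (M t - M 0) * (1 + cmod \<zeta> * (t / real n))"
      using eventually_gt_at_top[of 0] by eventually_elim (rule mesh)
  qed simp
  moreover have "resp G \<zeta> t = exp (\<zeta> * of_real t) *\<^sub>C h t"
    by (simp add: h_def scaleC_scaleC flip: exp_add)
  ultimately show ?thesis by (simp add: norm_scaleC)
qed

end

text \<open>A majorant K / (1 + \<xi>^2) common to all t in a bounded interval makes the truncated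
  integrals converge uniformly there. Continuity in t and the interchange with integration over t
  are thus inherited from the truncations, where they concern continuous functions on compact
  rectangles.\<close>

lemma line_integral_param:
  fixes v :: "real \<Rightarrow> real \<Rightarrow> 'a::banach"
  assumes cont: "continuous_on (UNIV \<times> {0..}) (\<lambda>(\<xi>, t). v \<xi> t)"
    and bound: "\<And>T. \<exists>K. \<forall>t\<in>{0..T}. \<forall>\<xi>. norm (v \<xi> t) \<le> K / (1 + \<xi>\<^sup>2)"
  shows "continuous_on {0..} (\<lambda>t. line_integral (\<lambda>\<xi>. v \<xi> t))"
    and "t \<ge> 0 \<Longrightarrow> (\<lambda>N. integral {- real N..real N} (\<lambda>\<xi>. integral {0..t} (v \<xi>)))
      \<longlonglongrightarrow> integral {0..t} (\<lambda>t. line_integral (\<lambda>\<xi>. v \<xi> t))"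
    and "t \<ge> 0 \<Longrightarrow> (\<lambda>N. integral {- real N..real N} (\<lambda>\<xi>. v \<xi> t)) \<longlonglongrightarrow> line_integral (\<lambda>\<xi>. v \<xi> t)"
proof -
  have cu: "continuous_on UNIV (\<lambda>\<xi>. v \<xi> t)" if "t \<ge> 0" for t
  proof -
    have "continuous_on UNIV (\<lambda>\<xi>. case (\<xi>, t) of (\<xi>, t) \<Rightarrow> v \<xi> t)"
      by (rule continuous_on_compose2[OF cont]) (use that in \<open>auto intro!: continuous_intros\<close>)
    then show ?thesis by simp
  qed
  have lim: "uniform_limit {0..T} (\<lambda>N t. integral {- real N..real N} (\<lambda>\<xi>. v \<xi> t))
      (\<lambda>t. line_integral (\<lambda>\<xi>. v \<xi> t)) sequentially" for T
  proof -
    obtain K where "\<forall>t\<in>{0..T}. \<forall>\<xi>. norm (v \<xi> t) \<le> K / (1 + \<xi>\<^sup>2)" using bound by blast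
    then show ?thesis by (intro uniform_limit_line_integral[of _ "\<lambda>t \<xi>. v \<xi> t" K] cu) auto
  qed
  have cN: "continuous_on {0..T} (\<lambda>t. integral {- real N..real N} (\<lambda>\<xi>. v \<xi> t))" for N T
  proof -
    have "continuous_on {0..T} (\<lambda>t. integral (cbox (- real N) (real N)) (\<lambda>\<xi>. v \<xi> t))"
      by (rule integral_continuous_on_param, unfold split_beta,
          rule continuous_on_compose2[OF cont, of _ "\<lambda>p. (snd p, fst p)", simplified])
        (auto intro!: continuous_intros)
    then show ?thesis by simp
  qed
  have cT: "continuous_on {0..T} (\<lambda>t. line_integral (\<lambda>\<xi>. v \<xi> t))" for T
    by (rule uniform_limit_theorem[OF _ lim]) (simp_all add: cN)
  show "continuous_on {0..} (\<lambda>t. line_integral (\<lambda>\<xi>. v \<xi> t))"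
  proof (rule continuous_on_eq_continuous_within[THEN iffD2, rule_format])
    fix t :: real assume "t \<in> {0..}"
    then have "continuous (at t within {0..t + 1}) (\<lambda>t. line_integral (\<lambda>\<xi>. v \<xi> t))"
      using cT[of "t + 1"] by (simp add: continuous_on_eq_continuous_within)
    moreover have "at t within {0..t + 1} = at t within {0..}"
      by (rule at_within_nhd[of _ "{..<t + 1}"]) auto
    ultimately show "continuous (at t within {0..}) (\<lambda>t. line_integral (\<lambda>\<xi>. v \<xi> t))" by simp
  qed
  {
    assume t: "t \<ge> 0"
    have swap: "integral {- real N..real N} (\<lambda>\<xi>. integral {0..t} (v \<xi>))
        = integral {0..t} (\<lambda>t. integral {- real N..real N} (\<lambda>\<xi>. v \<xi> t))" for N
    proof -
      have "continuous_on ({- real N..real N} \<times> {0..t}) (\<lambda>(\<xi>, t). v \<xi> t)"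
        by (rule continuous_on_subset[OF cont]) auto
      then show ?thesis
        using integral_swap_continuous[of "- real N" 0 "real N" t v] by (simp add: cbox_Pair_eq)
    qed
    obtain I J where IJ: "\<And>N. ((\<lambda>t. integral {- real N..real N} (\<lambda>\<xi>. v \<xi> t)) has_integral I N) {0..t}"
        "((\<lambda>t. line_integral (\<lambda>\<xi>. v \<xi> t)) has_integral J) {0..t}" "I \<longlonglongrightarrow> J"
      by (rule uniform_limit_integral[OF lim cN]) auto
    moreover have "I = (\<lambda>N. integral {0..t} (\<lambda>t. integral {- real N..real N} (\<lambda>\<xi>. v \<xi> t)))"
      using integral_unique[OF IJ(1)] by (intro ext) (rule sym)
    ultimately show "(\<lambda>N. integral {- real N..real N} (\<lambda>\<xi>. integral {0..t} (v \<xi>)))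
        \<longlonglongrightarrow> integral {0..t} (\<lambda>t. line_integral (\<lambda>\<xi>. v \<xi> t))"
      unfolding swap by (simp add: integral_unique)
    obtain K where K: "\<forall>s\<in>{0..t}. \<forall>\<xi>. norm (v \<xi> s) \<le> K / (1 + \<xi>\<^sup>2)" using bound by blast
    show "(\<lambda>N. integral {- real N..real N} (\<lambda>\<xi>. v \<xi> t)) \<longlonglongrightarrow> line_integral (\<lambda>\<xi>. v \<xi> t)"
      by (rule line_integral_converges(1)[OF cu]) (use K t in auto)
  }
qed

lemma has_field_derivative_inverse_power:
  "\<zeta> \<noteq> 0 \<Longrightarrow> ((\<lambda>\<zeta>. inverse \<zeta> ^ m) has_field_derivative
    (of_nat m * inverse \<zeta> ^ (m - 1) * - (inverse \<zeta> ^ 2))) (at (\<zeta>::complex))"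
  by (auto intro!: derivative_eq_intros simp: power2_eq_square)

section \<open>Inverse Laplace integrals of the response\<close>

text \<open>Bounded variation is encoded by any real function whose increments dominate those of
  \<open>G\<close>. The primitive of a norm plus a linear term can then serve as \<open>M\<close>
  without computing a total variation.\<close>

locale variation_bounded =
  fixes G :: "real \<Rightarrow> 'w::complex_banach" and M :: "real \<Rightarrow> real"
  assumes G: "continuous_on {0..} G" and G0: "G 0 = 0"
    and M: "\<And>a b. 0 \<le> a \<Longrightarrow> a \<le> b \<Longrightarrow> norm (G b - G a) \<le> M b - M a"
begin

lemma norm_resp_le_uniform:
  assumes "\<gamma> \<ge> 0" "t \<in> {0..T}"
  shows "norm (resp G (Complex \<gamma> \<xi>) t) \<le> exp (\<gamma> * T) * (M T - M 0)"
proof -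
  have "M 0 \<le> M t" "M t \<le> M T"
    using order_trans[OF norm_ge_zero M[of 0 t]] order_trans[OF norm_ge_zero M[of t T]] assms by auto
  have "norm (resp G (Complex \<gamma> \<xi>) t) \<le> exp (Re (Complex \<gamma> \<xi>) * t) * (M t - M 0)"
    by (rule norm_resp_le[OF G M G0]) (use assms in auto)
  also have "\<dots> \<le> exp (\<gamma> * T) * (M T - M 0)"
    using \<open>M 0 \<le> M t\<close> \<open>M t \<le> M T\<close> assms by (intro mult_mono) (auto intro: mult_left_mono)
  finally show ?thesis .
qed

lemma inverse_power_le:
  assumes "\<gamma> \<ge> 1" "m \<ge> 2"
  shows "norm (inverse (Complex \<gamma> \<xi>) ^ m) \<le> 1 / (1 + \<xi>\<^sup>2)"
proof -
  have 1: "1 \<le> cmod (Complex \<gamma> \<xi>)" using abs_Re_le_cmod[of "Complex \<gamma> \<xi>"] assms by simp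
  have "1 + \<xi>\<^sup>2 \<le> (cmod (Complex \<gamma> \<xi>))\<^sup>2" unfolding norm_Complex_square using assms by simp
  also have "\<dots> \<le> cmod (Complex \<gamma> \<xi>) ^ m" by (rule power_increasing[OF assms(2) 1])
  finally have "1 / cmod (Complex \<gamma> \<xi>) ^ m \<le> 1 / (1 + \<xi>\<^sup>2)"
    by (intro divide_left_mono mult_pos_pos zero_less_power) (use 1 in \<open>auto simp: add_pos_nonneg\<close>)
  then show ?thesis by (simp add: norm_power norm_inverse divide_inverse power_inverse)
qed

lemma resp_int_eq: "\<zeta> \<noteq> 0 \<Longrightarrow> inverse \<zeta> *\<^sub>C (resp G \<zeta> t - G t) = resp_int G \<zeta> t"
  by (simp add: resp_def scaleC_scaleC)

lemma continuous_resp_line: "continuous_on (UNIV \<times> {0..}) (\<lambda>(\<xi>, t). resp G (Complex \<gamma> \<xi>) t)"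
  unfolding split_beta
  by (rule continuous_on_compose2[OF continuous_on_resp[OF G], unfolded split_beta, of _ "\<lambda>p. (Complex \<gamma> (fst p), snd p)", simplified])
    (auto intro!: continuous_intros simp: Complex_eq)

lemma inverse_power_scaleC_line_tendsto_0:
  fixes w :: 'w
  assumes "\<gamma> \<ge> 1" "m \<ge> 2"
  shows "(\<lambda>N. integral {- real N..real N} (\<lambda>\<xi>. inverse (Complex \<gamma> \<xi>) ^ m *\<^sub>C w)) \<longlonglongrightarrow> 0"
\<comment> \<open>The half-plane Re \<zeta> > 1/2 contains the line and stays away from the pole.
  There |\<zeta>| \<ge> 1/2, so the m - 2 excess powers of 1/|\<zeta>| cost at most 2^m.\<close>
proof (rule integral_vertical_line_tendsto_0[of "1 / 2" "\<lambda>\<zeta>. inverse \<zeta> ^ m *\<^sub>C w"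
      "\<lambda>\<zeta>. (of_nat m * inverse \<zeta> ^ (m - 1) * - (inverse \<zeta> ^ 2)) *\<^sub>C w" "2 ^ m * norm w"])
  show "has_cderiv (\<lambda>\<zeta>. inverse \<zeta> ^ m *\<^sub>C w) ((of_nat m * inverse \<zeta> ^ (m - 1) * - (inverse \<zeta> ^ 2)) *\<^sub>C w) \<zeta>"
    if "Re \<zeta> > 1 / 2" for \<zeta>
  proof -
    have "\<zeta> \<noteq> 0" using that by auto
    note has_field_derivative_inverse_power[OF this, of m]
    from has_cderiv_scaleC[OF this has_cderiv_const[of w]] show ?thesis by simp
  qed
  show "continuous_on {\<zeta>. 1 / 2 < Re \<zeta>} (\<lambda>\<zeta>. (of_nat m * inverse \<zeta> ^ (m - 1) * - (inverse \<zeta> ^ 2)) *\<^sub>C w)"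
    by (intro continuous_intros) auto
  show "norm (inverse \<zeta> ^ m *\<^sub>C w) \<le> 2 ^ m * norm w / (cmod \<zeta>)\<^sup>2" if "1 / 2 < Re \<zeta>" for \<zeta>
  proof -
    have z: "1 / 2 \<le> cmod \<zeta>" using that abs_Re_le_cmod[of \<zeta>] by linarith
    obtain k where k: "m = k + 2" using assms(2) le_Suc_ex by (metis add.commute)
    have "inverse (cmod \<zeta>) ^ k \<le> 2 ^ k" by (rule power_mono) (use z le_imp_inverse_le[OF z] in auto)
    also have "\<dots> \<le> 2 ^ m" by (rule power_increasing) (auto simp: k)
    finally have "inverse (cmod \<zeta>) ^ k * (inverse (cmod \<zeta>) ^ 2 * norm w) \<le> 2 ^ m * (inverse (cmod \<zeta>) ^ 2 * norm w)"
      by (rule mult_right_mono) auto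
    then show ?thesis
      unfolding norm_scaleC norm_power norm_inverse by (simp add: k power_add divide_inverse power_inverse mult_ac power2_eq_square)
  qed
qed (use assms in auto)

text \<open>This turns out to be 2 \<pi> times G integrated m - 1 times. The finite-time response
  stands where an inverse Laplace integral would have exp(\<lambda> t) times the transform of
  G'.\<close>

abbreviation (input) resp_moment :: "real \<Rightarrow> nat \<Rightarrow> real \<Rightarrow> 'w"
  where "resp_moment \<gamma> m t \<equiv> line_integral (\<lambda>\<xi>. inverse (Complex \<gamma> \<xi>) ^ m *\<^sub>C resp G (Complex \<gamma> \<xi>) t)"

lemma
  assumes "\<gamma> \<ge> 1" "m \<ge> 2"
  shows continuous_resp_moment: "continuous_on {0..} (resp_moment \<gamma> m)"
    and resp_moment_lim: "t \<ge> 0 \<Longrightarrow>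
      (\<lambda>N. integral {- real N..real N} (\<lambda>\<xi>. inverse (Complex \<gamma> \<xi>) ^ m *\<^sub>C resp G (Complex \<gamma> \<xi>) t))
      \<longlonglongrightarrow> resp_moment \<gamma> m t"
    and integral_resp_moment_lim: "t \<ge> 0 \<Longrightarrow>
      (\<lambda>N. integral {- real N..real N} (\<lambda>\<xi>. inverse (Complex \<gamma> \<xi>) ^ m *\<^sub>C resp_int G (Complex \<gamma> \<xi>) t))
      \<longlonglongrightarrow> integral {0..t} (resp_moment \<gamma> m)"
proof -
  have nz: "Complex \<gamma> \<xi> \<noteq> 0" for \<xi> using assms by (simp add: complex_eq_iff)
  have c: "continuous_on (UNIV \<times> {0..}) (\<lambda>(\<xi>, t). inverse (Complex \<gamma> \<xi>) ^ m *\<^sub>C resp G (Complex \<gamma> \<xi>) t)"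
    using continuous_resp_line[of \<gamma>] nz unfolding split_beta
    by (intro continuous_intros) (auto intro!: continuous_intros simp: Complex_eq)
  have b: "\<exists>K. \<forall>t\<in>{0..T}. \<forall>\<xi>. norm (inverse (Complex \<gamma> \<xi>) ^ m *\<^sub>C resp G (Complex \<gamma> \<xi>) t) \<le> K / (1 + \<xi>\<^sup>2)" for T
  proof (intro exI ballI allI)
    fix t \<xi> assume "t \<in> {0..T}"
    then show "norm (inverse (Complex \<gamma> \<xi>) ^ m *\<^sub>C resp G (Complex \<gamma> \<xi>) t) \<le> exp (\<gamma> * T) * (M T - M 0) / (1 + \<xi>\<^sup>2)"
      using mult_mono[OF inverse_power_le[OF assms] norm_resp_le_uniform[of \<gamma> t T]] assms
      by (simp add: norm_scaleC)
  qed
  show "continuous_on {0..} (resp_moment \<gamma> m)" by (rule line_integral_param(1)[OF c b])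
  assume t: "t \<ge> 0"
  show "(\<lambda>N. integral {- real N..real N} (\<lambda>\<xi>. inverse (Complex \<gamma> \<xi>) ^ m *\<^sub>C resp G (Complex \<gamma> \<xi>) t))
      \<longlonglongrightarrow> resp_moment \<gamma> m t" by (rule line_integral_param(3)[OF c b t])
  have "integral {0..t} (\<lambda>t. inverse (Complex \<gamma> \<xi>) ^ m *\<^sub>C resp G (Complex \<gamma> \<xi>) t)
      = inverse (Complex \<gamma> \<xi>) ^ m *\<^sub>C resp_int G (Complex \<gamma> \<xi>) t" for \<xi>
    using has_integral_integrable[OF integral_resp[OF G t]] integral_unique[OF integral_resp[OF G t]]
    by (simp add: integral_scaleC_right)
  then show "(\<lambda>N. integral {- real N..real N} (\<lambda>\<xi>. inverse (Complex \<gamma> \<xi>) ^ m *\<^sub>C resp_int G (Complex \<gamma> \<xi>) t))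
      \<longlonglongrightarrow> integral {0..t} (resp_moment \<gamma> m)"
    using line_integral_param(2)[OF c b t] by simp
qed

text \<open>The primitive of the response is (Y - G) / \<lambda>, so integrating in t raises the
  power of 1/\<lambda> by one, and the extra term in \<open>G t\<close> vanishes when the line is
  moved to the right.\<close>

lemma integral_resp_moment:
  assumes "\<gamma> \<ge> 1" "m \<ge> 2" "t \<ge> 0"
  shows "integral {0..t} (resp_moment \<gamma> m) = resp_moment \<gamma> (Suc m) t"
proof (rule LIMSEQ_unique[OF integral_resp_moment_lim[OF assms]])
  have nz: "Complex \<gamma> \<xi> \<noteq> 0" for \<xi> using assms by (simp add: complex_eq_iff)
  have "inverse (Complex \<gamma> \<xi>) ^ m *\<^sub>C resp_int G (Complex \<gamma> \<xi>) t
      = inverse (Complex \<gamma> \<xi>) ^ Suc m *\<^sub>C resp G (Complex \<gamma> \<xi>) t - inverse (Complex \<gamma> \<xi>) ^ Suc m *\<^sub>C G t" for \<xi>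
    by (simp add: resp_int_eq[OF nz, symmetric] scaleC_scaleC scaleC.diff_right mult.commute)
  moreover have "(\<lambda>\<xi>. inverse (Complex \<gamma> \<xi>) ^ Suc m *\<^sub>C resp G (Complex \<gamma> \<xi>) t) integrable_on {a..b}" for a b
  proof -
    have "continuous_on {a..b} (\<lambda>\<xi>. case (\<xi>, t) of (\<xi>, t) \<Rightarrow> resp G (Complex \<gamma> \<xi>) t)"
      by (rule continuous_on_compose2[OF continuous_resp_line]) (use assms in \<open>auto intro!: continuous_intros\<close>)
    then have "continuous_on {a..b} (\<lambda>\<xi>. resp G (Complex \<gamma> \<xi>) t)" by simp
    then show ?thesis
      using nz by (intro integrable_continuous_real continuous_intros) (auto intro!: continuous_intros simp: Complex_eq)
  qed
  moreover have "(\<lambda>\<xi>. inverse (Complex \<gamma> \<xi>) ^ Suc m *\<^sub>C G t) integrable_on {a..b}" for a b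
    using nz by (intro integrable_continuous_real continuous_intros) (auto intro!: continuous_intros simp: Complex_eq)
  ultimately have "integral {- real N..real N} (\<lambda>\<xi>. inverse (Complex \<gamma> \<xi>) ^ m *\<^sub>C resp_int G (Complex \<gamma> \<xi>) t)
     = integral {- real N..real N} (\<lambda>\<xi>. inverse (Complex \<gamma> \<xi>) ^ Suc m *\<^sub>C resp G (Complex \<gamma> \<xi>) t)
      - integral {- real N..real N} (\<lambda>\<xi>. inverse (Complex \<gamma> \<xi>) ^ Suc m *\<^sub>C G t)" for N
    by (simp only: Henstock_Kurzweil_Integration.integral_diff)
  then show "(\<lambda>N. integral {- real N..real N} (\<lambda>\<xi>. inverse (Complex \<gamma> \<xi>) ^ m *\<^sub>C resp_int G (Complex \<gamma> \<xi>) t))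
      \<longlonglongrightarrow> resp_moment \<gamma> (Suc m) t"
    using tendsto_diff[OF resp_moment_lim[of \<gamma> "Suc m" t] inverse_power_scaleC_line_tendsto_0[of \<gamma> "Suc m" "G t"]] assms
    by simp
qed

text \<open>Differentiating (t - s) times the primitive of \<open>G\<close> at s yields the
  difference of the two integrands, and this product vanishes at both ends.\<close>

lemma integral_mult_diff:
  assumes "t \<ge> 0"
  shows "integral {0..t} (\<lambda>s. (t - s) *\<^sub>R G s) = integral {0..t} (\<lambda>s. integral {0..s} G)"
proof -
  let ?H = "\<lambda>s. integral {0..s} G"
  have "((\<lambda>s. (t - s) *\<^sub>R G s + - 1 *\<^sub>R ?H s) has_integral ((t - t) *\<^sub>R ?H t - (t - 0) *\<^sub>R ?H 0)) {0..t}"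
  proof (rule fundamental_theorem_of_calculus[OF assms])
    fix s assume s: "s \<in> {0..t}"
    have "((\<lambda>s. t - s) has_real_derivative - 1) (at s within {0..t})"
      by (auto intro!: derivative_eq_intros)
    moreover have "(?H has_vector_derivative G s) (at s within {0..t})"
      by (rule has_vector_derivative_within_subset[OF integral_has_vector_derivative_Ici[OF G]]) (use s in auto)
    ultimately show "((\<lambda>s. (t - s) *\<^sub>R ?H s) has_vector_derivative (t - s) *\<^sub>R G s + - 1 *\<^sub>R ?H s) (at s within {0..t})"
      by (rule has_vector_derivative_scaleR)
  qed
  moreover have "(\<lambda>s. (t - s) *\<^sub>R G s) integrable_on {0..t}" "?H integrable_on {0..t}"
    by (auto intro!: integrable_continuous_real continuous_intros continuous_on_subset[OF G]
        continuous_on_subset[OF continuous_on_integral_Ici[OF G]])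
  ultimately show ?thesis by (simp add: has_integral_iff Henstock_Kurzweil_Integration.integral_diff)
qed

text \<open>The comparison is made after one more integration in t, since it replaces Y by the
  convolution of exp(\<lambda> t) with \<open>G\<close> and leaves the scalar kernel exp(\<lambda>
  \<tau>) / \<lambda>^2, whose line integral is 2 \<pi> \<tau>. Convolving \<tau> with
  \<open>G\<close> is integrating \<open>G\<close> twice; continuity then removes the additional
  integration.\<close>

lemma resp_moment_2:
  assumes \<gamma>: "\<gamma> \<ge> 1" and t: "t \<ge> 0"
  shows "resp_moment \<gamma> 2 t = (2 * pi) *\<^sub>R integral {0..t} G"
proof (rule integral_determines_continuous[OF continuous_resp_moment[OF \<gamma>] _ _ t])
  show "continuous_on {0..} (\<lambda>t. (2 * pi) *\<^sub>R integral {0..t} G)"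
    by (intro continuous_intros continuous_on_integral_Ici G)
  fix t :: real assume t: "t \<ge> 0"
  have nz: "Complex \<gamma> \<xi> \<noteq> 0" for \<xi> using assms by (simp add: complex_eq_iff)
  define k where "k \<tau> \<xi> = exp (Complex \<gamma> \<xi> * of_real \<tau>) * inverse (Complex \<gamma> \<xi>) ^ 2" for \<tau> \<xi>
  have kc: "continuous_on UNIV (k \<tau>)" for \<tau>
    unfolding k_def using nz by (intro continuous_intros) (auto intro!: continuous_intros simp: Complex_eq)
  have "uniform_limit {0..t} (\<lambda>N \<tau>. integral {- real N..real N} (k \<tau>)) (\<lambda>\<tau>. line_integral (k \<tau>)) sequentially"
  proof (rule uniform_limit_line_integral[OF kc])
    show "norm (k \<tau> \<xi>) \<le> exp (\<gamma> * t) / (1 + \<xi>\<^sup>2)" if "\<tau> \<in> {0..t}" for \<tau> \<xi>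
    proof -
      have "exp (\<gamma> * \<tau>) \<le> exp (\<gamma> * t)" using that \<gamma> by auto
      from mult_mono[OF this inverse_power_le[OF \<gamma> order_refl]] show ?thesis
        by (simp add: k_def norm_mult)
    qed
  qed
  note ul1 = this
  have lk: "line_integral (k \<tau>) = of_real (2 * pi * \<tau>)" if "\<tau> \<in> {0..t}" for \<tau>
    using that \<gamma> exp_over_square_line_integral[of \<gamma> \<tau>] by (intro line_integral_eqI) (simp add: k_def[abs_def])
  have ul: "uniform_limit {0..t} (\<lambda>N \<tau>. integral {- real N..real N} (k \<tau>)) (\<lambda>\<tau>. of_real (2 * pi * \<tau>)) sequentially"
    by (rule uniform_limit_cong'[THEN iffD1, OF refl lk ul1])
  have ul2: "uniform_limit {0..t} (\<lambda>N s. integral {- real N..real N} (k (t - s)) *\<^sub>C G s) (\<lambda>s. of_real (2 * pi * (t - s)) *\<^sub>C G s) sequentially"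
  proof (rule bounded_bilinear.bounded_uniform_limit[OF bounded_bilinear_scaleC])
    show "uniform_limit {0..t} (\<lambda>N s. integral {- real N..real N} (k (t - s))) (\<lambda>s. of_real (2 * pi * (t - s))) sequentially"
      by (rule uniform_limit_compose'[OF ul]) auto
    show "bounded (G ` {0..t})"
      by (intro compact_imp_bounded compact_continuous_image continuous_on_subset[OF G]) auto
    show "bounded ((\<lambda>s. complex_of_real (2 * pi * (t - s))) ` {0..t})"
      by (intro compact_imp_bounded compact_continuous_image continuous_intros) auto
  qed (rule uniform_limit_const)
  have kjoint: "continuous_on UNIV (\<lambda>p. k (fst p) (snd p))"
    unfolding k_def using nz by (intro continuous_intros) (auto intro!: continuous_intros simp: Complex_eq)
  have cc: "continuous_on {0..t} (\<lambda>s. integral {- real N..real N} (k (t - s)) *\<^sub>C G s)" for N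
  proof -
    have "continuous_on {0..t} (\<lambda>s. integral (cbox (- real N) (real N)) (k (t - s)))"
      by (rule integral_continuous_on_param, unfold split_beta)
        (rule continuous_on_compose2[OF kjoint, of _ "\<lambda>p. (t - fst p, snd p)", simplified], auto intro!: continuous_intros)
    then show ?thesis using G by (intro continuous_intros) (auto intro: continuous_on_subset)
  qed
  obtain I J where IJ: "\<And>N. ((\<lambda>s. integral {- real N..real N} (k (t - s)) *\<^sub>C G s) has_integral I N) {0..t}"
      "((\<lambda>s. complex_of_real (2 * pi * (t - s)) *\<^sub>C G s) has_integral J) {0..t}" "I \<longlonglongrightarrow> J"
    by (rule uniform_limit_integral[OF ul2 cc]) auto
  have "I N = integral {- real N..real N} (\<lambda>\<xi>. inverse (Complex \<gamma> \<xi>) ^ 2 *\<^sub>C resp_int G (Complex \<gamma> \<xi>) t)" for N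
  proof -
    have "I N = integral {0..t} (\<lambda>s. integral {- real N..real N} (\<lambda>\<xi>. k (t - s) \<xi> *\<^sub>C G s))"
      using IJ(1)[of N] kc by (subst integral_scaleC_left)
        (auto intro!: integrable_continuous_real integral_unique[symmetric] intro: continuous_on_subset)
    also have "\<dots> = integral {- real N..real N} (\<lambda>\<xi>. integral {0..t} (\<lambda>s. k (t - s) \<xi> *\<^sub>C G s))"
    proof -
      have "continuous_on ({0..t} \<times> {- real N..real N}) (\<lambda>(s, \<xi>). k (t - s) \<xi> *\<^sub>C G s)"
        unfolding split_beta
        by (rule continuous_on_scaleC, rule continuous_on_compose2[OF kjoint, of _ "\<lambda>p. (t - fst p, snd p)", simplified])
          (auto intro!: continuous_intros continuous_on_compose2[OF G])
      then show ?thesis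
        using integral_swap_continuous[of 0 "- real N" t "real N" "\<lambda>s \<xi>. k (t - s) \<xi> *\<^sub>C G s"] by (simp add: cbox_Pair_eq)
    qed
    also have "(\<lambda>\<xi>. integral {0..t} (\<lambda>s. k (t - s) \<xi> *\<^sub>C G s)) = (\<lambda>\<xi>. inverse (Complex \<gamma> \<xi>) ^ 2 *\<^sub>C resp_int G (Complex \<gamma> \<xi>) t)"
    proof
      fix \<xi>
      have "k (t - s) \<xi> = (inverse (Complex \<gamma> \<xi>) ^ 2 * exp (Complex \<gamma> \<xi> * of_real t)) * exp (- Complex \<gamma> \<xi> * of_real s)" for s
        by (simp add: k_def right_diff_distrib exp_diff exp_minus divide_inverse mult_ac)
      then have "(\<lambda>s. k (t - s) \<xi> *\<^sub>C G s) = (\<lambda>s. (inverse (Complex \<gamma> \<xi>) ^ 2 * exp (Complex \<gamma> \<xi> * of_real t)) *\<^sub>C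
          exp (- Complex \<gamma> \<xi> * of_real s) *\<^sub>C G s)" by (simp add: scaleC_scaleC)
      moreover have "(\<lambda>s. exp (- Complex \<gamma> \<xi> * of_real s) *\<^sub>C G s) integrable_on {0..t}"
        by (intro integrable_continuous_real continuous_on_subset[OF continuous_on_exp_G[OF G]]) auto
      ultimately show "integral {0..t} (\<lambda>s. k (t - s) \<xi> *\<^sub>C G s) = inverse (Complex \<gamma> \<xi>) ^ 2 *\<^sub>C resp_int G (Complex \<gamma> \<xi>) t"
        by (simp only: integral_scaleC_right resp_int_def) (simp only: scaleC_scaleC)
    qed
    finally show ?thesis .
  qed
  then have "I = (\<lambda>N. integral {- real N..real N} (\<lambda>\<xi>. inverse (Complex \<gamma> \<xi>) ^ 2 *\<^sub>C resp_int G (Complex \<gamma> \<xi>) t))"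
    by (rule ext)
  with IJ(3) have "integral {0..t} (resp_moment \<gamma> 2) = J"
    by (intro LIMSEQ_unique[OF integral_resp_moment_lim[OF \<gamma> order_refl t]]) simp
  also have "J = integral {0..t} (\<lambda>s. complex_of_real (2 * pi * (t - s)) *\<^sub>C G s)"
    using IJ(2) by (simp add: integral_unique)
  also have "\<dots> = (2 * pi) *\<^sub>R integral {0..t} (\<lambda>s. (t - s) *\<^sub>R G s)"
    unfolding scaleC_of_real by (simp only: scaleR_scaleR[symmetric] Henstock_Kurzweil_Integration.integral_cmul)
  also have "\<dots> = integral {0..t} (\<lambda>t. (2 * pi) *\<^sub>R integral {0..t} G)"
    by (simp only: integral_mult_diff[OF t] Henstock_Kurzweil_Integration.integral_cmul)
  finally show "integral {0..t} (resp_moment \<gamma> 2) = integral {0..t} (\<lambda>t. (2 * pi) *\<^sub>R integral {0..t} G)" .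
qed simp

lemma resp_moment_eq:
  assumes \<gamma>: "\<gamma> \<ge> 1" and t: "t \<ge> 0"
    and H: "\<And>t. t \<ge> 0 \<Longrightarrow> H 0 t = G t" "\<And>k t. t \<ge> 0 \<Longrightarrow> H (Suc k) t = integral {0..t} (H k)"
  shows "resp_moment \<gamma> (m + 2) t = (2 * pi) *\<^sub>R H (Suc m) t"
  using t
proof (induction m arbitrary: t)
  case 0
  have "integral {0..t} G = integral {0..t} (H 0)"
    by (rule Henstock_Kurzweil_Integration.integral_cong) (simp add: H)
  then show ?case using resp_moment_2[OF \<gamma> 0] 0 by (simp add: H(2) numeral_2_eq_2)
next
  case (Suc m)
  have "resp_moment \<gamma> (Suc m + 2) t = integral {0..t} (resp_moment \<gamma> (m + 2))"
    using integral_resp_moment[OF \<gamma> _ Suc.prems, of "m + 2"] by simp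
  also have "\<dots> = integral {0..t} (\<lambda>t. (2 * pi) *\<^sub>R H (Suc m) t)"
    by (rule Henstock_Kurzweil_Integration.integral_cong) (use Suc.IH in auto)
  finally show ?case using Suc.prems by (simp add: H(2))
qed

end

section \<open>Integrated solutions from polynomial growth of the resolvent\<close>

text \<open>An abstract pencil \<zeta> e - b with inverse \<open>r\<close>, to be instantiated with
  the embedded E and the extended A. The growth rate |\<zeta>|^(q-1) is written with natural
  exponents so that it also makes sense for \<open>q = 0\<close>, and \<omega> \<ge> 1 keeps \<zeta>
  away from 0.\<close>

locale pencil_growth =
  fixes e b :: "'x::complex_banach \<Rightarrow> 'w::complex_banach" and r :: "complex \<Rightarrow> 'w \<Rightarrow> 'x"
    and \<omega> C :: real and q :: nat
  assumes e: "bounded_clinear e" and b: "bounded_clinear b"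
    and r: "\<And>\<zeta>. Re \<zeta> > \<omega> \<Longrightarrow> bounded_clinear (r \<zeta>)"
    and right_inverse: "\<And>\<zeta> w. Re \<zeta> > \<omega> \<Longrightarrow> \<zeta> *\<^sub>C e (r \<zeta> w) - b (r \<zeta> w) = w"
    and left_inverse: "\<And>\<zeta> x. Re \<zeta> > \<omega> \<Longrightarrow> r \<zeta> (\<zeta> *\<^sub>C e x - b x) = x"
    and growth: "\<And>\<zeta> w. Re \<zeta> > \<omega> \<Longrightarrow> norm (r \<zeta> w) \<le> C * (cmod \<zeta> ^ (q + 1) / (cmod \<zeta>)\<^sup>2) * norm w"
    and \<omega>: "\<omega> \<ge> 1" and C: "C \<ge> 0"
begin

text \<open>The left inverse \<open>r \<zeta>\<close> recovers \<open>r \<zeta>0 w0\<close> from its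
  image under the pencil at \<zeta>. Allowing different vectors lets one identity serve both the
  joint continuity of the resolvent and, for \<open>w0 = w\<close>, its derivative.\<close>

lemma resolvent_identity:
  assumes "Re \<zeta> > \<omega>" "Re \<zeta>0 > \<omega>"
  shows "r \<zeta> w - r \<zeta>0 w0 = r \<zeta> (w - w0 + (\<zeta>0 - \<zeta>) *\<^sub>C e (r \<zeta>0 w0))"
proof -
  have "w - w0 + (\<zeta>0 - \<zeta>) *\<^sub>C e (r \<zeta>0 w0) = w - (\<zeta> *\<^sub>C e (r \<zeta>0 w0) - b (r \<zeta>0 w0))"
    using right_inverse[OF assms(2), of w0] by (simp add: scaleC.diff_left algebra_simps)
  then show ?thesis
    by (simp only: bounded_clinear_simps(2)[OF r[OF assms(1)], of w] left_inverse[OF assms(1)])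
qed

lemma continuous_on_resolvent: "continuous_on ({\<zeta>. Re \<zeta> > \<omega>} \<times> UNIV) (\<lambda>(\<zeta>, w). r \<zeta> w)"
  unfolding continuous_on_def
proof
  fix p0 :: "complex \<times> 'w" assume p0: "p0 \<in> {\<zeta>. Re \<zeta> > \<omega>} \<times> UNIV"
  let ?F = "at p0 within {\<zeta>. Re \<zeta> > \<omega>} \<times> UNIV"
  have nz: "fst p0 \<noteq> 0" using p0 \<omega> by auto
  let ?g = "\<lambda>p. C * (cmod (fst p) ^ (q + 1) / (cmod (fst p))\<^sup>2)
      * norm (snd p - snd p0 + (fst p0 - fst p) *\<^sub>C e (r (fst p0) (snd p0)))"
  have "(?g \<longlongrightarrow> C * (cmod (fst p0) ^ (q + 1) / (cmod (fst p0))\<^sup>2)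
      * norm (snd p0 - snd p0 + (fst p0 - fst p0) *\<^sub>C e (r (fst p0) (snd p0)))) ?F"
    by (intro tendsto_intros) (use nz in auto)
  then have lim: "(?g \<longlongrightarrow> 0) ?F" by simp
  have "\<forall>\<^sub>F p in ?F. norm ((case p of (\<zeta>, w) \<Rightarrow> r \<zeta> w) - (case p0 of (\<zeta>, w) \<Rightarrow> r \<zeta> w)) \<le> ?g p"
    unfolding eventually_at_filter
  proof (intro always_eventually allI impI)
    fix p :: "complex \<times> 'w" assume "p \<in> {\<zeta>. Re \<zeta> > \<omega>} \<times> UNIV"
    then have 1: "Re (fst p) > \<omega>" and 2: "Re (fst p0) > \<omega>" using p0 by auto
    show "norm ((case p of (\<zeta>, w) \<Rightarrow> r \<zeta> w) - (case p0 of (\<zeta>, w) \<Rightarrow> r \<zeta> w)) \<le> ?g p"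
      unfolding split_beta resolvent_identity[OF 1 2] by (rule growth[OF 1])
  qed
  from Lim_null_comparison[OF this lim]
  show "((\<lambda>(\<zeta>, w). r \<zeta> w) \<longlongrightarrow> (case p0 of (\<zeta>, w) \<Rightarrow> r \<zeta> w)) ?F"
    by (rule LIM_zero_cancel)
qed

lemma continuous_on_resolvent_compose:
  assumes "continuous_on S f" "continuous_on S g" "\<And>s. s \<in> S \<Longrightarrow> Re (f s) > \<omega>"
  shows "continuous_on S (\<lambda>s. r (f s) (g s))"
  by (rule continuous_on_compose2[OF continuous_on_resolvent, of S "\<lambda>s. (f s, g s)", simplified])
    (use assms in \<open>auto intro!: continuous_intros\<close>)

lemma has_cderiv_resolvent:
  assumes "Re \<zeta> > \<omega>"
  shows "has_cderiv (\<lambda>\<zeta>. r \<zeta> w) (- r \<zeta> (e (r \<zeta> w))) \<zeta>"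
proof (rule has_cderivI)
  have op: "open {\<zeta>. Re \<zeta> > \<omega>}" by (rule open_halfspace_Re_gt)
  have "\<forall>\<^sub>F v in at \<zeta>. Re v > \<omega>"
    using eventually_at_in_open'[OF op] assms by simp
  then show "\<forall>\<^sub>F v in at \<zeta>. r v w = r \<zeta> w + (v - \<zeta>) *\<^sub>C (- r v (e (r \<zeta> w)))"
  proof eventually_elim
    case (elim v)
    note v = this
    have "r v w - r \<zeta> w = r v ((\<zeta> - v) *\<^sub>C e (r \<zeta> w))"
      using resolvent_identity[OF v assms, of w w] by (simp only: diff_self add_0_left)
    also have "\<dots> = (\<zeta> - v) *\<^sub>C r v (e (r \<zeta> w))"
      by (rule bounded_clinear_simps(5)[OF r[OF v]])
    also have "\<dots> = (v - \<zeta>) *\<^sub>C (- r v (e (r \<zeta> w)))"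
      by (simp only: scaleC.minus_right scaleC.minus_left[symmetric] minus_diff_eq)
    finally show ?case by (simp only: diff_eq_eq add.commute)
  qed
  have "continuous_on {\<zeta>. Re \<zeta> > \<omega>} (\<lambda>v. - r v (e (r \<zeta> w)))"
    by (intro continuous_intros continuous_on_resolvent_compose) auto
  then show "((\<lambda>v. - r v (e (r \<zeta> w))) \<longlongrightarrow> - r \<zeta> (e (r \<zeta> w))) (at \<zeta>)"
    using assms op by (simp add: continuous_on_eq_continuous_at isCont_def)
qed

definition scaled_resolvent :: "complex \<Rightarrow> 'w \<Rightarrow> 'x"
  where "scaled_resolvent \<zeta> w = inverse \<zeta> ^ (q + 1) *\<^sub>C r \<zeta> w"

lemma norm_scaled_resolvent_le:
  assumes "Re \<zeta> > \<omega>"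
  shows "norm (scaled_resolvent \<zeta> w) \<le> C * norm w / (cmod \<zeta>)\<^sup>2"
proof -
  have z: "cmod \<zeta> > 0" using assms \<omega> by auto
  have "norm (scaled_resolvent \<zeta> w) \<le> inverse (cmod \<zeta>) ^ (q + 1) * (C * (cmod \<zeta> ^ (q + 1) / (cmod \<zeta>)\<^sup>2) * norm w)"
    unfolding scaled_resolvent_def norm_scaleC norm_power norm_inverse
    by (intro mult_left_mono growth assms) simp
  also have "\<dots> = (inverse (cmod \<zeta>) * cmod \<zeta>) ^ (q + 1) * (C * norm w / (cmod \<zeta>)\<^sup>2)"
    unfolding power_mult_distrib by (simp add: mult_ac)
  finally show ?thesis using z by simp
qed

lemma continuous_on_scaled_resolvent_compose:
  assumes "continuous_on S f" "continuous_on S g" "\<And>s. s \<in> S \<Longrightarrow> Re (f s) > \<omega>"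
  shows "continuous_on S (\<lambda>s. scaled_resolvent (f s) (g s))"
  unfolding scaled_resolvent_def
  by (intro continuous_intros continuous_on_resolvent_compose assms) (use assms(3) \<omega> in force)

lemma scaled_resolvent_line_tendsto_0:
  assumes "\<gamma> > \<omega>"
  shows "(\<lambda>N. integral {- real N..real N} (\<lambda>\<xi>. scaled_resolvent (Complex \<gamma> \<xi>) w)) \<longlonglongrightarrow> 0"
proof (rule integral_vertical_line_tendsto_0)
  fix \<zeta> assume \<zeta>: "Re \<zeta> > \<omega>"
  then have "\<zeta> \<noteq> 0" using \<omega> by auto
  then have "((\<lambda>\<zeta>. inverse \<zeta> ^ (q + 1)) has_field_derivative (of_nat (q + 1) * inverse \<zeta> ^ q * - (inverse \<zeta> ^ 2))) (at \<zeta>)"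
    using has_field_derivative_inverse_power[of \<zeta> "q + 1"] by simp
  from has_cderiv_scaleC[OF this has_cderiv_resolvent[OF \<zeta>, of w]]
  show "has_cderiv (\<lambda>\<zeta>. scaled_resolvent \<zeta> w) ((of_nat (q + 1) * inverse \<zeta> ^ q * - (inverse \<zeta> ^ 2)) *\<^sub>C r \<zeta> w
      + inverse \<zeta> ^ (q + 1) *\<^sub>C (- r \<zeta> (e (r \<zeta> w)))) \<zeta>"
    unfolding scaled_resolvent_def .
  show "norm (scaled_resolvent \<zeta> w) \<le> C * norm w / (cmod \<zeta>)\<^sup>2"
    by (rule norm_scaled_resolvent_le[OF \<zeta>])
next
  show "continuous_on {\<zeta>. Re \<zeta> > \<omega>} (\<lambda>\<zeta>. (of_nat (q + 1) * inverse \<zeta> ^ q * - (inverse \<zeta> ^ 2)) *\<^sub>C r \<zeta> w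
      + inverse \<zeta> ^ (q + 1) *\<^sub>C (- r \<zeta> (e (r \<zeta> w))))"
    using \<omega> by (intro continuous_intros continuous_on_resolvent_compose
        bounded_linear.continuous_on[OF bounded_clinear_bounded_linear[OF e]]) auto
qed (use assms \<omega> in auto)

text \<open>The equation appears in integrated form because the construction only yields continuity
  of \<open>z\<close>; differentiability of \<open>e \<circ> z\<close> is read off from the
  right-hand side afterwards.\<close>

theorem integrated_solution:
  assumes "variation_bounded G M"
    and H: "\<And>t. t \<ge> 0 \<Longrightarrow> H 0 t = G t" "\<And>k t. t \<ge> 0 \<Longrightarrow> H (Suc k) t = integral {0..t} (H k)"
  obtains z where "continuous_on {0..} z" "z 0 = 0"
    "\<And>t. t \<ge> 0 \<Longrightarrow> e (z t) = b (integral {0..t} z) + H (q + 1) t"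
proof -
  interpret variation_bounded G M by fact
  \<comment> \<open>Any abscissa beyond \<omega> would do; \<omega> \<ge> 1 ensures \<gamma> \<ge>
    1, as the moment lemmas require.\<close>
  define \<gamma> where "\<gamma> = \<omega> + 1"
  have \<gamma>: "\<gamma> \<ge> 1" "\<gamma> > \<omega>" "\<And>\<xi>. Re (Complex \<gamma> \<xi>) > \<omega>" "\<And>\<xi>. Complex \<gamma> \<xi> \<noteq> 0"
    using \<omega> by (auto simp: \<gamma>_def complex_eq_iff)
  define v where "v \<xi> t = scaled_resolvent (Complex \<gamma> \<xi>) (resp G (Complex \<gamma> \<xi>) t)" for \<xi> t
  have c: "continuous_on (UNIV \<times> {0..}) (\<lambda>(\<xi>, t). v \<xi> t)"
    unfolding v_def split_beta
    by (rule continuous_on_scaled_resolvent_compose)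
      (use continuous_resp_line[of \<gamma>] \<gamma> in \<open>auto simp: split_beta Complex_eq intro!: continuous_intros\<close>)
  have bnd: "\<exists>K. \<forall>t\<in>{0..T}. \<forall>\<xi>. norm (v \<xi> t) \<le> K / (1 + \<xi>\<^sup>2)" for T
  proof (intro exI ballI allI)
    fix t \<xi> assume t: "t \<in> {0..T}"
    let ?K = "exp (\<gamma> * T) * (M T - M 0)"
    have "norm (v \<xi> t) \<le> C * norm (resp G (Complex \<gamma> \<xi>) t) / (cmod (Complex \<gamma> \<xi>))\<^sup>2"
      unfolding v_def by (rule norm_scaled_resolvent_le) (rule \<gamma>)
    also have "\<dots> \<le> C * ?K * norm (inverse (Complex \<gamma> \<xi>) ^ 2)"
      using norm_resp_le_uniform[OF _ t, of \<gamma> \<xi>] \<gamma> C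
      by (auto simp: divide_inverse norm_power norm_inverse power_inverse intro!: mult_right_mono mult_left_mono)
    also have "\<dots> \<le> C * ?K * (1 / (1 + \<xi>\<^sup>2))"
      by (intro mult_left_mono inverse_power_le mult_nonneg_nonneg \<gamma> C)
        (use t order_trans[OF norm_ge_zero M[of 0 T]] in auto)
    finally show "norm (v \<xi> t) \<le> (C * ?K) / (1 + \<xi>\<^sup>2)" by simp
  qed
  define z0 where "z0 t = line_integral (\<lambda>\<xi>. v \<xi> t)" for t
  note z0 = line_integral_param[OF c bnd, folded z0_def]
  have eq0: "e (z0 t) - b (integral {0..t} z0) = (2 * pi) *\<^sub>R H (q + 1) t" if t: "t \<ge> 0" for t
  proof -
    have cy: "continuous_on S (\<lambda>\<xi>. resp G (Complex \<gamma> \<xi>) t)" for S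
    proof -
      have "continuous_on S (\<lambda>\<xi>. case (\<xi>, t) of (\<xi>, t) \<Rightarrow> resp G (Complex \<gamma> \<xi>) t)"
        by (rule continuous_on_compose2[OF continuous_resp_line]) (use t in \<open>auto intro!: continuous_intros\<close>)
      then show ?thesis by simp
    qed
    have intv: "integral {0..t} (v \<xi>) = scaled_resolvent (Complex \<gamma> \<xi>) (resp_int G (Complex \<gamma> \<xi>) t)" for \<xi>
    proof -
      have I: "(resp G (Complex \<gamma> \<xi>) has_integral resp_int G (Complex \<gamma> \<xi>) t) {0..t}"
        by (rule integral_resp[OF G t])
      have "((\<lambda>s. r (Complex \<gamma> \<xi>) (resp G (Complex \<gamma> \<xi>) s)) has_integral r (Complex \<gamma> \<xi>) (resp_int G (Complex \<gamma> \<xi>) t)) {0..t}"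
        using has_integral_linear[OF I bounded_clinear_bounded_linear[OF r[OF \<gamma>(3)]]] by (simp add: o_def)
      from has_integral_linear[OF this scaleC.bounded_linear_right]
      show ?thesis unfolding v_def scaled_resolvent_def by (intro integral_unique) (simp add: o_def)
    qed
    have civ: "continuous_on S (\<lambda>\<xi>. integral {0..t} (v \<xi>))" for S
      unfolding intv resp_int_eq[OF \<gamma>(4), symmetric]
      by (intro continuous_on_scaled_resolvent_compose continuous_intros cy \<gamma>) (use \<gamma> in \<open>auto simp: Complex_eq intro!: continuous_intros\<close>)
    have cv: "continuous_on S (\<lambda>\<xi>. v \<xi> t)" for S
      unfolding v_def by (intro continuous_on_scaled_resolvent_compose cy \<gamma>) (auto simp: Complex_eq intro!: continuous_intros)
    \<comment> \<open>The response is split as \<open>G\<close> plus \<zeta> times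
      \<open>resp_int\<close>; on the second part the pencil undoes its inverse exactly. The order q
      + 2 of the first summand corresponds to q + 1 integrations of \<open>G\<close>.\<close>
    have alg: "e (v \<xi> t) - b (integral {0..t} (v \<xi>)) = inverse (Complex \<gamma> \<xi>) ^ (q + 2) *\<^sub>C resp G (Complex \<gamma> \<xi>) t
        - inverse (Complex \<gamma> \<xi>) ^ (q + 2) *\<^sub>C G t + e (scaled_resolvent (Complex \<gamma> \<xi>) (G t))" for \<xi>
    proof -
      let ?z = "Complex \<gamma> \<xi>" let ?Q = "resp_int G (Complex \<gamma> \<xi>) t" let ?c = "inverse ?z ^ (q + 1)"
      have "e (v \<xi> t) - b (integral {0..t} (v \<xi>)) = ?c *\<^sub>C (?z *\<^sub>C e (r ?z ?Q) - b (r ?z ?Q)) + ?c *\<^sub>C e (r ?z (G t))"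
        unfolding intv unfolding v_def scaled_resolvent_def resp_def
        by (simp add: bounded_clinear_simps[OF e] bounded_clinear_simps[OF b] bounded_clinear_simps[OF r[OF \<gamma>(3)]]
            scaleC_add_right scaleC.diff_right scaleC_scaleC)
      also have "\<dots> = ?c *\<^sub>C ?Q + e (scaled_resolvent ?z (G t))"
        by (simp add: right_inverse[OF \<gamma>(3)] scaled_resolvent_def bounded_clinear_simps[OF e])
      also have "?c *\<^sub>C ?Q = inverse ?z ^ (q + 2) *\<^sub>C resp G ?z t - inverse ?z ^ (q + 2) *\<^sub>C G t"
        by (simp add: resp_int_eq[OF \<gamma>(4), symmetric] scaleC.diff_right scaleC_scaleC mult_ac)
      finally show ?thesis .
    qed
    let ?I = "\<lambda>N f. integral {- real N..real N} f"
    have L: "(\<lambda>N. e (?I N (\<lambda>\<xi>. v \<xi> t)) - b (?I N (\<lambda>\<xi>. integral {0..t} (v \<xi>))))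
        \<longlonglongrightarrow> e (z0 t) - b (integral {0..t} z0)"
      by (intro tendsto_diff bounded_linear.tendsto[OF bounded_clinear_bounded_linear[OF e] z0(3)[OF t]]
          bounded_linear.tendsto[OF bounded_clinear_bounded_linear[OF b] z0(2)[OF t]])
    have "e (?I N (\<lambda>\<xi>. v \<xi> t)) - b (?I N (\<lambda>\<xi>. integral {0..t} (v \<xi>)))
       = ?I N (\<lambda>\<xi>. inverse (Complex \<gamma> \<xi>) ^ (q + 2) *\<^sub>C resp G (Complex \<gamma> \<xi>) t)
        - ?I N (\<lambda>\<xi>. inverse (Complex \<gamma> \<xi>) ^ (q + 2) *\<^sub>C G t)
        + e (?I N (\<lambda>\<xi>. scaled_resolvent (Complex \<gamma> \<xi>) (G t)))" for N
    proof -
      have i1: "(\<lambda>\<xi>. inverse (Complex \<gamma> \<xi>) ^ (q + 2) *\<^sub>C resp G (Complex \<gamma> \<xi>) t) integrable_on {- real N..real N}"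
        "(\<lambda>\<xi>. inverse (Complex \<gamma> \<xi>) ^ (q + 2) *\<^sub>C G t) integrable_on {- real N..real N}"
        using \<gamma>(4) by (auto intro!: integrable_continuous_real continuous_intros cy[unfolded Complex_eq] simp: Complex_eq)
      have i2: "(\<lambda>\<xi>. scaled_resolvent (Complex \<gamma> \<xi>) (G t)) integrable_on {- real N..real N}"
        by (intro integrable_continuous_real continuous_on_scaled_resolvent_compose \<gamma>) (auto simp: Complex_eq intro!: continuous_intros)
      have i3: "(\<lambda>\<xi>. e (scaled_resolvent (Complex \<gamma> \<xi>) (G t))) integrable_on {- real N..real N}"
        using integrable_linear[OF i2 bounded_clinear_bounded_linear[OF e]] by (simp add: o_def)
      have i4: "(\<lambda>\<xi>. v \<xi> t) integrable_on {- real N..real N}" "(\<lambda>\<xi>. integral {0..t} (v \<xi>)) integrable_on {- real N..real N}"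
        by (intro integrable_continuous_real cv civ)+
      have i5: "(\<lambda>\<xi>. e (v \<xi> t)) integrable_on {- real N..real N}" "(\<lambda>\<xi>. b (integral {0..t} (v \<xi>))) integrable_on {- real N..real N}"
        using integrable_linear[OF i4(1) bounded_clinear_bounded_linear[OF e]]
          integrable_linear[OF i4(2) bounded_clinear_bounded_linear[OF b]] by (simp_all add: o_def)
      have "e (?I N (\<lambda>\<xi>. v \<xi> t)) - b (?I N (\<lambda>\<xi>. integral {0..t} (v \<xi>)))
          = ?I N (\<lambda>\<xi>. e (v \<xi> t) - b (integral {0..t} (v \<xi>)))"
        by (simp add: integral_bounded_clinear[OF e i4(1)] integral_bounded_clinear[OF b i4(2)]
            Henstock_Kurzweil_Integration.integral_diff[OF i5])
      also have "\<dots> = ?I N (\<lambda>\<xi>. inverse (Complex \<gamma> \<xi>) ^ (q + 2) *\<^sub>C resp G (Complex \<gamma> \<xi>) t)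
          - ?I N (\<lambda>\<xi>. inverse (Complex \<gamma> \<xi>) ^ (q + 2) *\<^sub>C G t)
          + ?I N (\<lambda>\<xi>. e (scaled_resolvent (Complex \<gamma> \<xi>) (G t)))"
        unfolding alg Henstock_Kurzweil_Integration.integral_add[OF Henstock_Kurzweil_Integration.integrable_diff[OF i1] i3]
          Henstock_Kurzweil_Integration.integral_diff[OF i1] ..
      finally show ?thesis by (simp only: integral_bounded_clinear[OF e i2])
    qed
    moreover have "(\<lambda>N. ?I N (\<lambda>\<xi>. inverse (Complex \<gamma> \<xi>) ^ (q + 2) *\<^sub>C resp G (Complex \<gamma> \<xi>) t)
        - ?I N (\<lambda>\<xi>. inverse (Complex \<gamma> \<xi>) ^ (q + 2) *\<^sub>C G t)
        + e (?I N (\<lambda>\<xi>. scaled_resolvent (Complex \<gamma> \<xi>) (G t)))) \<longlonglongrightarrow> (2 * pi) *\<^sub>R H (q + 1) t - 0 + e 0"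
    proof (intro tendsto_add tendsto_diff bounded_linear.tendsto[OF bounded_clinear_bounded_linear[OF e]])
      show "(\<lambda>N. ?I N (\<lambda>\<xi>. inverse (Complex \<gamma> \<xi>) ^ (q + 2) *\<^sub>C resp G (Complex \<gamma> \<xi>) t)) \<longlonglongrightarrow> (2 * pi) *\<^sub>R H (q + 1) t"
        using resp_moment_lim[OF \<gamma>(1) _ t, of "q + 2"] resp_moment_eq[where H = H and m = q, OF \<gamma>(1) t H] by simp
      show "(\<lambda>N. ?I N (\<lambda>\<xi>. inverse (Complex \<gamma> \<xi>) ^ (q + 2) *\<^sub>C G t)) \<longlonglongrightarrow> 0"
        by (rule inverse_power_scaleC_line_tendsto_0[OF \<gamma>(1)]) simp
      show "(\<lambda>N. ?I N (\<lambda>\<xi>. scaled_resolvent (Complex \<gamma> \<xi>) (G t))) \<longlonglongrightarrow> 0"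
        by (rule scaled_resolvent_line_tendsto_0[OF \<gamma>(2)])
    qed
    ultimately have "e (z0 t) - b (integral {0..t} z0) = (2 * pi) *\<^sub>R H (q + 1) t - 0 + e 0"
      using LIMSEQ_unique[OF L] by simp
    then show ?thesis by (simp add: bounded_clinear_simps[OF e])
  qed
  define z where "z t = (1 / (2 * pi)) *\<^sub>R z0 t" for t
  have z_int: "integral {0..t} z = (1 / (2 * pi)) *\<^sub>R integral {0..t} z0" for t
    unfolding z_def by simp
  show thesis
  proof
    show "continuous_on {0..} z" unfolding z_def by (intro continuous_intros z0)
    have "v \<xi> 0 = 0" for \<xi>
      using bounded_clinear_simps(3)[OF r[OF \<gamma>(3)]] by (simp add: v_def resp_0[OF G G0] scaled_resolvent_def)
    then have "z0 0 = 0" unfolding z0_def by (intro line_integral_eqI) simp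
    then show "z 0 = 0" by (simp add: z_def)
    fix t :: real assume t: "t \<ge> 0"
    have "e (z t) - b (integral {0..t} z) = (1 / (2 * pi)) *\<^sub>R (e (z0 t) - b (integral {0..t} z0))"
      unfolding z_int by (simp add: z_def bounded_clinear_simps[OF e] bounded_clinear_simps[OF b] scaleR_diff_right)
    also have "\<dots> = H (q + 1) t" using eq0[OF t] by simp
    finally show "e (z t) = b (integral {0..t} z) + H (q + 1) t" by (simp add: algebra_simps)
  qed
qed

end

section \<open>Test functions\<close>

lemma tendsto_poly_times_exp_minus:
  fixes p :: "real poly"
  shows "((\<lambda>x. poly p x * exp (- x)) \<longlongrightarrow> 0) at_top"
proof -
  have "((\<lambda>x. x ^ k * poly p x * exp (- x)) \<longlongrightarrow> 0) at_top" for k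
  proof (induction p arbitrary: k)
    case (pCons a p)
    have "((\<lambda>x. a * (x ^ k / exp x) + x ^ Suc k * poly p x * exp (- x)) \<longlongrightarrow> a * 0 + 0) at_top"
      by (intro tendsto_intros tendsto_power_div_exp_0 pCons.IH)
    then show ?case by (simp add: algebra_simps exp_minus divide_inverse)
  qed simp
  from this[of 0] show ?thesis by simp
qed

text \<open>Polynomials in 1/t times exp(-1/t) form a family closed under differentiation: the
  factor p becomes X^2 (p - p').\<close>

definition flat_exp :: "real poly \<Rightarrow> real \<Rightarrow> real"
  where "flat_exp p t = (if t > 0 then poly p (1 / t) * exp (- (1 / t)) else 0)"

lemma flat_exp_derivative:
  "(flat_exp p has_real_derivative flat_exp ([:0, 0, 1:] * (p - pderiv p)) t) (at t)"
proof -
  consider "t > 0" | "t < 0" | "t = 0" by linarith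
  then show ?thesis
  proof cases
    case 1
    have "((\<lambda>t. poly p (1 / t) * exp (- (1 / t))) has_real_derivative flat_exp ([:0, 0, 1:] * (p - pderiv p)) t) (at t)"
      using 1 by (auto intro!: derivative_eq_intros poly_DERIV[THEN DERIV_chain2]
          simp: flat_exp_def field_simps power2_eq_square)
    then show ?thesis
      by (rule has_field_derivative_transform_within_open[of _ _ _ "{0<..}"]) (use 1 in \<open>auto simp: flat_exp_def\<close>)
  next
    case 2
    have "((\<lambda>_. 0) has_real_derivative 0) (at t)" by simp
    then have "(flat_exp p has_real_derivative 0) (at t)"
      by (rule has_field_derivative_transform_within_open[of _ _ _ "{..<0}"]) (use 2 in \<open>auto simp: flat_exp_def\<close>)
    with 2 show ?thesis by (simp add: flat_exp_def)
  next
    case 3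
    have "((\<lambda>h. flat_exp p h / h) \<longlongrightarrow> 0) (at_right 0)"
    proof (rule Lim_transform_eventually)
      \<comment> \<open>Dividing by h multiplies the polynomial in 1/h by X, so the difference
        quotient at 0 is a function of the same kind.\<close>
      show "((\<lambda>h. poly (pCons 0 p) (inverse h) * exp (- inverse h)) \<longlongrightarrow> 0) (at_right 0)"
        by (rule filterlim_compose[OF tendsto_poly_times_exp_minus filterlim_inverse_at_top_right])
      show "\<forall>\<^sub>F h in at_right 0. poly (pCons 0 p) (inverse h) * exp (- inverse h) = flat_exp p h / h"
        by (auto simp: eventually_at_filter flat_exp_def divide_inverse)
    qed
    moreover have "((\<lambda>h. flat_exp p h / h) \<longlongrightarrow> 0) (at_left 0)"
      by (rule Lim_transform_eventually[OF tendsto_const]) (auto simp: eventually_at_filter flat_exp_def)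
    ultimately have "((\<lambda>h. flat_exp p h / h) \<longlongrightarrow> 0) (at 0)" by (simp add: filterlim_split_at)
    then show ?thesis by (simp add: 3 has_field_derivative_iff flat_exp_def)
  qed
qed

text \<open>A class that contains a derivative of each of its members, so smoothness follows without
  formulas for higher derivatives.\<close>

inductive elementary_smooth :: "(real \<Rightarrow> real) \<Rightarrow> bool" where
  flat: "elementary_smooth (\<lambda>t. flat_exp p (\<alpha> * t + c))"
| const: "elementary_smooth (\<lambda>_. c)"
| add: "elementary_smooth f \<Longrightarrow> elementary_smooth g \<Longrightarrow> elementary_smooth (\<lambda>t. f t + g t)"
| mult: "elementary_smooth f \<Longrightarrow> elementary_smooth g \<Longrightarrow> elementary_smooth (\<lambda>t. f t * g t)"

lemma elementary_smooth_derivative: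
  "elementary_smooth f \<Longrightarrow> \<exists>f'. elementary_smooth f' \<and> (\<forall>t. (f has_real_derivative f' t) (at t))"
proof (induction rule: elementary_smooth.induct)
  case (flat p \<alpha> c)
  have "((\<lambda>t. flat_exp p (\<alpha> * t + c)) has_real_derivative
      flat_exp ([:0, 0, 1:] * (p - pderiv p)) (\<alpha> * t + c) * \<alpha>) (at t)" for t
    by (rule DERIV_chain2[OF flat_exp_derivative]) (auto intro!: derivative_eq_intros)
  moreover have "elementary_smooth (\<lambda>t. flat_exp ([:0, 0, 1:] * (p - pderiv p)) (\<alpha> * t + c) * \<alpha>)"
    by (intro elementary_smooth.intros)
  ultimately show ?case by blast
next
  case (const c)
  show ?case by (rule exI[of _ "\<lambda>_. 0"]) (auto intro: elementary_smooth.const)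
next
  case (add f g)
  then obtain f' g' where "elementary_smooth f'" "elementary_smooth g'"
    "\<And>t. (f has_real_derivative f' t) (at t)" "\<And>t. (g has_real_derivative g' t) (at t)" by blast
  then show ?case by (intro exI[of _ "\<lambda>t. f' t + g' t"]) (auto intro: elementary_smooth.add DERIV_add)
next
  case (mult f g)
  then obtain f' g' where "elementary_smooth f'" "elementary_smooth g'"
    "\<And>t. (f has_real_derivative f' t) (at t)" "\<And>t. (g has_real_derivative g' t) (at t)" by blast
  with mult show ?case
    by (intro exI[of _ "\<lambda>t. f' t * g t + g' t * f t"]) (auto intro: elementary_smooth.intros DERIV_mult)
qed

lemma elementary_smooth_continuous:
  assumes "elementary_smooth f"
  shows "continuous_on S f"
proof -
  obtain f' where "\<And>t. (f has_real_derivative f' t) (at t)"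
    using elementary_smooth_derivative[OF assms] by blast
  from has_field_derivative_at_within[OF this] show ?thesis by (rule DERIV_continuous_on)
qed

text \<open>Closure under differentiation carries all iterated derivatives along. The set is left
  arbitrary so that a single primitive can be adjoined to the elementary functions.\<close>

lemma iterated_deriv_differentiable:
  fixes F :: "(real \<Rightarrow> real) set"
  assumes "\<And>f. f \<in> F \<Longrightarrow> \<exists>f'\<in>F. \<forall>t. (f has_real_derivative f' t) (at t)" "f \<in> F"
  shows "(deriv ^^ k) f field_differentiable (at t)"
proof -
  have *: "(deriv ^^ k) f \<in> F"
  proof (induction k)
    case (Suc k)
    from assms(1)[OF this] obtain f' where f': "f' \<in> F" "\<forall>t. ((deriv ^^ k) f has_real_derivative f' t) (at t)" by blast
    then have "deriv ((deriv ^^ k) f) = f'" by (intro ext DERIV_imp_deriv) blast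
    with f' show ?case by simp
  qed (simp add: assms)
  show ?thesis using assms(1)[OF *] by (auto simp: field_differentiable_def)
qed

definition bump :: "real \<Rightarrow> real \<Rightarrow> nat \<Rightarrow> real \<Rightarrow> real"
  where "bump a b n t = flat_exp 1 (real n * t + - real n * a) * flat_exp 1 (- real n * t + real n * b)"

lemma elementary_smooth_bump: "elementary_smooth (bump a b n)"
  unfolding bump_def[abs_def] by (intro elementary_smooth.intros)

lemma bump_eq_0: "t \<notin> {a<..<b} \<Longrightarrow> bump a b n t = 0"
proof -
  assume "t \<notin> {a<..<b}"
  then have "real n * (t - a) \<le> 0 \<or> real n * (b - t) \<le> 0"
    by (auto simp: mult_le_0_iff)
  then show ?thesis by (auto simp: bump_def flat_exp_def algebra_simps)
qed

lemma bump_bounds: "0 \<le> bump a b n t" "bump a b n t \<le> 1"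
  by (auto simp: bump_def flat_exp_def intro!: mult_le_one)

lemma bump_pos: "t \<in> {a<..<b} \<Longrightarrow> 0 < bump a b (Suc n) t"
proof -
  assume "t \<in> {a<..<b}"
  then have "real (Suc n) * (t - a) > 0" "real (Suc n) * (b - t) > 0" by auto
  then show ?thesis by (simp add: bump_def flat_exp_def algebra_simps)
qed

lemma flat_exp_limit: "x > 0 \<Longrightarrow> (\<lambda>n. flat_exp 1 (real n * x)) \<longlonglongrightarrow> 1"
proof (rule Lim_transform_eventually)
  assume x: "x > 0"
  have "(\<lambda>n. 1 / (real n * x)) \<longlonglongrightarrow> 0"
    by (rule tendsto_divide_0[OF tendsto_const] filterlim_at_top_imp_at_infinity)+
      (use x in \<open>auto intro!: filterlim_tendsto_pos_mult_at_top[OF tendsto_const] filterlim_real_sequentially simp: mult.commute\<close>)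
  then have "(\<lambda>n. exp (- (1 / (real n * x)))) \<longlonglongrightarrow> exp (- 0)" by (intro tendsto_intros)
  then show "(\<lambda>n. exp (- (1 / (real n * x)))) \<longlonglongrightarrow> 1" by simp
  show "\<forall>\<^sub>F n in sequentially. exp (- (1 / (real n * x))) = flat_exp 1 (real n * x)"
    using eventually_gt_at_top[of 0] by eventually_elim (use x in \<open>simp add: flat_exp_def\<close>)
qed

lemma bump_tendsto_indicator: "(\<lambda>n. bump a b n t) \<longlonglongrightarrow> indicator {a<..<b} t"
proof (cases "t \<in> {a<..<b}")
  case True
  have "(\<lambda>n. flat_exp 1 (real n * (t - a)) * flat_exp 1 (real n * (b - t))) \<longlonglongrightarrow> 1 * 1"
    by (intro tendsto_mult flat_exp_limit) (use True in auto)
  with True show ?thesis by (simp add: bump_def algebra_simps)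
qed (simp add: bump_eq_0)

lemma test_function_bump: "0 < a \<Longrightarrow> test_function (bump a b n)"
  unfolding test_function_def
proof (intro conjI allI)
  show "(deriv ^^ k) (bump a b n) field_differentiable at t" for k t
    by (rule iterated_deriv_differentiable[of "Collect elementary_smooth"])
      (use elementary_smooth_derivative elementary_smooth_bump in auto)
  assume "0 < a"
  then show "\<exists>a' b'. 0 < a' \<and> (\<forall>t. t \<notin> {a'..b'} \<longrightarrow> bump a b n t = 0)"
    by (intro exI[of _ a] exI[of _ b]) (auto intro!: bump_eq_0)
qed

text \<open>The mean of \<open>\<eta>\<close> being zero is what brings its primitive back to 0 to
  the right of b.\<close>

lemma test_function_antiderivative:
  assumes \<eta>: "elementary_smooth \<eta>" and "0 < a" "a \<le> b" and supp: "\<And>t. t \<notin> {a..b} \<Longrightarrow> \<eta> t = 0"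
    and zero: "integral {a..b} \<eta> = 0"
  obtains \<phi> where "test_function \<phi>" "deriv \<phi> = \<eta>" "\<And>t. t \<notin> {a..b} \<Longrightarrow> \<phi> t = 0"
proof -
  define \<phi> where "\<phi> t = integral {0..t} \<eta>" for t
  have int: "\<eta> integrable_on {x..y}" for x y
    by (intro integrable_continuous_real elementary_smooth_continuous \<eta>)
  have left: "\<phi> t = 0" if "t < a" for t
    unfolding \<phi>_def using that by (intro Henstock_Kurzweil_Integration.integral_unique[OF has_integral_is_0]) (auto intro!: supp)
  have right: "\<phi> t = 0" if "t > b" for t
  proof -
    have "integral {0..a} \<eta> = 0"
      unfolding integral_open_interval_real
      by (intro Henstock_Kurzweil_Integration.integral_unique[OF has_integral_is_0]) (auto intro!: supp)
    moreover have "integral {b..t} \<eta> = 0"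
      unfolding integral_open_interval_real
      by (intro Henstock_Kurzweil_Integration.integral_unique[OF has_integral_is_0]) (auto intro!: supp)
    moreover have "integral {0..a} \<eta> + integral {a..b} \<eta> = integral {0..b} \<eta>"
      "integral {0..b} \<eta> + integral {b..t} \<eta> = integral {0..t} \<eta>"
      using assms(2,3) that by (auto intro!: Henstock_Kurzweil_Integration.integral_combine int)
    ultimately show ?thesis using zero by (simp add: \<phi>_def)
  qed
  have der: "(\<phi> has_real_derivative \<eta> t) (at t)" for t
  proof (cases "t > 0")
    case True
    have "((\<lambda>t. integral {0..t} \<eta>) has_real_derivative \<eta> t) (at t within {0..t + 1})"
      by (rule integral_has_real_derivative) (use True elementary_smooth_continuous[OF \<eta>] in auto)
    moreover have "at t within {0..t + 1} = at t"
      by (rule at_within_interior) (use True in auto)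
    ultimately show ?thesis by (simp add: \<phi>_def[abs_def])
  next
    case False
    have "((\<lambda>_. 0) has_real_derivative 0) (at t)" by simp
    then have "(\<phi> has_real_derivative 0) (at t)"
      by (rule has_field_derivative_transform_within_open[of _ _ _ "{..<a}"]) (use False assms(2) left in auto)
    with False show ?thesis using supp[of t] assms(2) by auto
  qed
  show thesis
  proof
    show z: "\<phi> t = 0" if "t \<notin> {a..b}" for t using that left right by auto
    show "deriv \<phi> = \<eta>" using der by (intro ext DERIV_imp_deriv)
    have "(deriv ^^ k) \<phi> field_differentiable at t" for k t
    proof (rule iterated_deriv_differentiable[of "insert \<phi> (Collect elementary_smooth)"])
      fix f assume "f \<in> insert \<phi> (Collect elementary_smooth)"
      then consider "f = \<phi>" | "elementary_smooth f" by auto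
      then show "\<exists>f'\<in>insert \<phi> (Collect elementary_smooth). \<forall>t. (f has_real_derivative f' t) (at t)"
      proof cases
        case 1
        then show ?thesis using der \<eta> by (intro bexI[of _ \<eta>]) auto
      next
        case 2
        from elementary_smooth_derivative[OF this] show ?thesis by auto
      qed
    qed simp
    then show "test_function \<phi>" unfolding test_function_def using assms(2) z by blast
  qed
qed

section \<open>Weak derivatives of scalar functions\<close>

text \<open>Passes from Lebesgue to Borel measurability, so that Fubini's theorem and the uniqueness
  of densities can be applied over \<open>lborel\<close>.\<close>

lemma borel_representative:
  fixes w :: "real \<Rightarrow> real"
  assumes "w absolutely_integrable_on {c..d}"
  obtains w' where "w' \<in> borel_measurable borel" "integrable lborel w'"
    "AE t in lborel. w' t = indicator {c..d} t * w t"
    "\<And>a b. c \<le> a \<Longrightarrow> b \<le> d \<Longrightarrow> integral {a..b} w = (\<integral>t. indicator {a..b} t * w' t \<partial>lborel)"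
proof -
  have L: "integrable lebesgue (\<lambda>t. indicator {c..d} t * w t)"
    using assms by (simp add: set_integrable_def)
  then obtain w' where w': "w' \<in> borel_measurable lborel" "AE t in lborel. indicator {c..d} t * w t = w' t"
    using completion_ex_borel_measurable_real[of "\<lambda>t. indicator {c..d} t * w t" lborel] by auto
  have ae: "AE t in lebesgue. indicator {c..d} t * w t = w' t"
    using w'(2) by (rule AE_completion)
  have m: "w' \<in> borel_measurable lebesgue" using w'(1) by (rule measurable_completion)
  show thesis
  proof
    show "w' \<in> borel_measurable borel" using w' by simp
    have "integrable lebesgue w'"
      using L integrable_cong_AE[OF borel_measurable_integrable[OF L] m ae] by simp
    then show "integrable lborel w'" using w'(1) by (simp add: integrable_completion)
    show "AE t in lborel. w' t = indicator {c..d} t * w t" using w'(2) by auto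
    fix a b assume ab: "c \<le> a" "b \<le> d"
    have "w absolutely_integrable_on {a..b}"
      by (rule absolutely_integrable_on_subinterval[OF assms]) (use ab in auto)
    then have "integral {a..b} w = (\<integral>t. indicator {a..b} t * w t \<partial>lebesgue)"
      by (metis (no_types, lifting) Bochner_Integration.integral_cong real_scaleR_def
          set_lebesgue_integral_def set_lebesgue_integral_eq_integral(2))
    also have "\<dots> = (\<integral>t. indicator {a..b} t * w' t \<partial>lebesgue)"
    proof (rule integral_cong_AE)
      show "(\<lambda>t. indicator {a..b} t * w t) \<in> borel_measurable lebesgue"
        using \<open>w absolutely_integrable_on {a..b}\<close> by (auto simp: set_integrable_def dest: borel_measurable_integrable)
      have "indicator {a..b} \<in> borel_measurable (lebesgue :: real measure)" by (rule borel_measurable_indicator) simp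
      then show "(\<lambda>t. indicator {a..b} t * w' t) \<in> borel_measurable lebesgue" using m by (rule borel_measurable_times)
      show "AE t in lebesgue. indicator {a..b} t * w t = indicator {a..b} t * w' t"
        using ae by eventually_elim (use ab in \<open>auto simp: indicator_def split: if_splits\<close>)
    qed
    also have "\<dots> = (\<integral>t. indicator {a..b} t * w' t \<partial>lborel)"
      by (rule integral_completion) (use w'(1) in simp)
    finally show "integral {a..b} w = (\<integral>t. indicator {a..b} t * w' t \<partial>lborel)" .
  qed
qed

text \<open>The positive and negative parts of \<open>w\<close> are densities of measures that agree
  on all rays, hence coincide. The two parts are then equal almost everywhere, and as one of them is
  always zero, both vanish.\<close>

lemma AE_eq_0_if_integrals_0:
  fixes w :: "real \<Rightarrow> real"
  assumes w: "w absolutely_integrable_on {0..T}"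
    and zero: "\<And>x. x \<in> {0..T} \<Longrightarrow> integral {x..T} w = 0"
  shows "AE t in lebesgue. t \<in> {0..T} \<longrightarrow> w t = 0"
proof -
  obtain w' where w': "w' \<in> borel_measurable borel" "integrable lborel w'"
    "AE t in lborel. w' t = indicator {0..T} t * w t"
    "\<And>a b. 0 \<le> a \<Longrightarrow> b \<le> T \<Longrightarrow> integral {a..b} w = (\<integral>t. indicator {a..b} t * w' t \<partial>lborel)"
    using borel_representative[OF w] by blast
  note [measurable] = w'(1)
  define P N where "P t = max 0 (w' t)" and "N t = max 0 (- w' t)" for t
  have PN: "integrable lborel (\<lambda>t. indicator {x<..} t * P t)" "integrable lborel (\<lambda>t. indicator {x<..} t * N t)" for x :: real
    by (rule Bochner_Integration.integrable_bound[OF w'(2)]; auto simp: P_def N_def indicator_def)+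
  have "(\<integral>t. indicator {x<..} t * w' t \<partial>lborel) = 0" for x
  proof -
    have "(\<integral>t. indicator {x<..} t * w' t \<partial>lborel) = (\<integral>t. indicator {max 0 x..T} t * w' t \<partial>lborel)"
    proof (rule integral_cong_AE)
      have "AE t in lborel. t \<noteq> x" by (rule AE_lborel_singleton)
      with w'(3) show "AE t in lborel. indicator {x<..} t * w' t = indicator {max 0 x..T} t * w' t"
        by eventually_elim (auto simp: indicator_def)
    qed auto
    also have "\<dots> = integral {max 0 x..T} w" using w'(4)[of "max 0 x" T] by simp
    also have "\<dots> = 0" using zero[of "max 0 x"] by (cases "max 0 x \<le> T") auto
    finally show ?thesis .
  qed
  moreover have "(\<integral>t. indicator {x<..} t * w' t \<partial>lborel)
      = (\<integral>t. indicator {x<..} t * P t \<partial>lborel) - (\<integral>t. indicator {x<..} t * N t \<partial>lborel)" for x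
    by (subst Bochner_Integration.integral_diff[symmetric, OF PN])
      (auto simp: P_def N_def right_diff_distrib[symmetric] intro!: Bochner_Integration.integral_cong)
  ultimately have eq: "(\<integral>t. indicator {x<..} t * P t \<partial>lborel) = (\<integral>t. indicator {x<..} t * N t \<partial>lborel)" for x
    by simp
  have em: "emeasure (density lborel (\<lambda>t. ennreal (g t))) {x<..} = ennreal (\<integral>t. indicator {x<..} t * g t \<partial>lborel)"
    if "g \<in> borel_measurable borel" "\<And>t. g t \<ge> 0" "integrable lborel (\<lambda>t. indicator {x<..} t * g t)" for g and x :: real
  proof -
    have "emeasure (density lborel (\<lambda>t. ennreal (g t))) {x<..} = (\<integral>\<^sup>+t. ennreal (indicator {x<..} t * g t) \<partial>lborel)"
      using that(1) by (subst emeasure_density) (auto intro!: nn_integral_cong simp: indicator_def)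
    also have "\<dots> = ennreal (\<integral>t. indicator {x<..} t * g t \<partial>lborel)"
      by (rule nn_integral_eq_integral[OF that(3)]) (use that(2) in auto)
    finally show ?thesis .
  qed
  have mP: "P \<in> borel_measurable borel" "N \<in> borel_measurable borel" unfolding P_def[abs_def] N_def[abs_def] by measurable
  have pos: "P t \<ge> 0" "N t \<ge> 0" for t by (auto simp: P_def N_def)
  have "density lborel (\<lambda>t. ennreal (P t)) = density lborel (\<lambda>t. ennreal (N t))"
    by (rule measure_eqI_lessThan) (use em[OF mP(1) pos(1) PN(1)] em[OF mP(2) pos(2) PN(2)] eq in auto)
  then have "AE t in lborel. ennreal (P t) = ennreal (N t)"
    using mP by (intro sigma_finite_measure.density_unique[OF sigma_finite_lborel]) auto
  then have "AE t in lborel. w' t = 0"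
    by eventually_elim (auto simp: P_def N_def max_def split: if_splits)
  with w'(3) have "AE t in lborel. t \<in> {0..T} \<longrightarrow> w t = 0"
    by eventually_elim (auto simp: indicator_def)
  then show ?thesis by (rule AE_completion)
qed

text \<open>Dominated convergence replaces the bumps by the indicator of an interval away from 0,
  the only ones that test functions reach. The endpoint 0 is then attained by continuity of the
  indefinite integral.\<close>

lemma integral_Icc_eq_0_if_bump_integrals_0:
  fixes w :: "real \<Rightarrow> real"
  assumes w: "\<And>T. w absolutely_integrable_on {0..T}"
    and zero: "\<And>a b n. 0 < a \<Longrightarrow> a < b \<Longrightarrow> integral {a..b} (\<lambda>t. bump a b n t * w t) = 0"
    and T: "T \<ge> 0"
  shows "integral {0..T} w = 0"
proof -
  have pos: "integral {a..b} w = 0" if ab: "0 < a" "a < b" for a b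
  proof -
    have wab: "w absolutely_integrable_on {a..b}"
      by (rule absolutely_integrable_on_subinterval[OF w[of b]]) (use ab in auto)
    have lim: "(\<lambda>n. integral {a..b} (\<lambda>t. bump a b n t * w t)) \<longlonglongrightarrow> integral {a..b} (\<lambda>t. indicator {a<..<b} t * w t)"
    proof (rule dominated_convergence(2)[where h = "\<lambda>t. \<bar>w t\<bar>"])
      show "(\<lambda>t. bump a b k t * w t) integrable_on {a..b}" for k
      proof -
        have "bounded (bump a b k ` {a..b})"
          by (rule boundedI[of _ 1]) (use bump_bounds in auto)
        then have "(\<lambda>t. bump a b k t * w t) absolutely_integrable_on {a..b}"
          by (intro absolutely_integrable_bounded_measurable_product_real wab
              continuous_imp_measurable_on_sets_lebesgue elementary_smooth_continuous elementary_smooth_bump) auto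
        then show ?thesis using set_lebesgue_integral_eq_integral(1) by blast
      qed
      show "(\<lambda>t. \<bar>w t\<bar>) integrable_on {a..b}"
        using absolutely_integrable_norm[OF wab] set_lebesgue_integral_eq_integral(1) by (auto simp: o_def)
      show "norm (bump a b k t * w t) \<le> \<bar>w t\<bar>" for k t
        using bump_bounds[of a b k t] by (simp add: abs_mult mult_left_le_one_le)
      show "(\<lambda>k. bump a b k t * w t) \<longlonglongrightarrow> indicator {a<..<b} t * w t" for t
        by (intro tendsto_mult bump_tendsto_indicator tendsto_const)
    qed
    have "integral {a..b} w = integral {a..b} (\<lambda>t. indicator {a<..<b} t * w t)"
      unfolding integral_open_interval_real by (rule Henstock_Kurzweil_Integration.integral_cong) simp
    also have "\<dots> = 0"
      using LIMSEQ_unique[OF lim] zero[OF ab] by simp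
    finally show ?thesis .
  qed
  show ?thesis
  proof (cases "T = 0")
    case False
    have wi: "w integrable_on {0..T}" using w set_lebesgue_integral_eq_integral(1) by blast
    have c: "continuous_on {0..T} (\<lambda>x. integral {x..T} w)" by (rule indefinite_integral_continuous_1'[OF wi])
    have cl: "closure {0<..<T} = {0..T}" using T False by simp
    have "(\<lambda>x. integral {x..T} w) 0 = 0"
    proof (rule continuous_constant_on_closure[where S = "{0<..<T}" and f = "\<lambda>x. integral {x..T} w" and x = 0])
      show "continuous_on (closure {0<..<T}) (\<lambda>x. integral {x..T} w)" unfolding cl by (rule c)
      show "integral {x..T} w = 0" if "x \<in> {0<..<T}" for x by (rule pos) (use that in auto)
      show "0 \<in> closure {0<..<T}" unfolding cl using T by simp
    qed
    then show ?thesis by simp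
  qed simp
qed

lemma AE_eq_0_if_bump_integrals_0:
  fixes w :: "real \<Rightarrow> real"
  assumes w: "\<And>T. w absolutely_integrable_on {0..T}"
    and zero: "\<And>a b n. 0 < a \<Longrightarrow> a < b \<Longrightarrow> integral {a..b} (\<lambda>t. bump a b n t * w t) = 0"
  shows "AE t in lebesgue. t \<ge> 0 \<longrightarrow> w t = 0"
proof -
  note Z = integral_Icc_eq_0_if_bump_integrals_0[OF w zero]
  have "AE t in lebesgue. t \<in> {0..real n} \<longrightarrow> w t = 0" for n
  proof (rule AE_eq_0_if_integrals_0[OF w])
    fix x assume x: "x \<in> {0..real n}"
    have "w integrable_on {0..real n}" using w set_lebesgue_integral_eq_integral(1) by blast
    then have "integral {0..x} w + integral {x..real n} w = integral {0..real n} w"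
      using x by (intro Henstock_Kurzweil_Integration.integral_combine) auto
    then show "integral {x..real n} w = 0" using Z[of x] Z[of "real n"] x by simp
  qed
  then have "AE t in lebesgue. \<forall>n. t \<in> {0..real n} \<longrightarrow> w t = 0"
    unfolding AE_all_countable by blast
  then show ?thesis
    by eventually_elim (meson atLeastAtMost_iff real_arch_simple)
qed

lemma elementary_smooth_times_integrable:
  fixes w :: "real \<Rightarrow> real"
  assumes "elementary_smooth \<eta>" "w absolutely_integrable_on {0..b}" "0 \<le> a"
  shows "(\<lambda>t. \<eta> t * w t) integrable_on {a..b}"
proof -
  have wab: "w absolutely_integrable_on {a..b}"
    by (rule absolutely_integrable_on_subinterval[OF assms(2)]) (use assms(3) in auto)
  have c: "continuous_on {a..b} \<eta>" by (rule elementary_smooth_continuous[OF assms(1)])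
  have "(\<lambda>t. \<eta> t * w t) absolutely_integrable_on {a..b}"
    by (intro absolutely_integrable_bounded_measurable_product_real wab
        continuous_imp_measurable_on_sets_lebesgue compact_imp_bounded compact_continuous_image c) auto
  then show ?thesis using set_lebesgue_integral_eq_integral(1) by blast
qed

lemma integral_zero_extension:
  fixes f :: "real \<Rightarrow> real"
  assumes "S \<subseteq> T" "\<And>t. t \<in> T \<Longrightarrow> t \<notin> S \<Longrightarrow> f t = 0"
  shows "integral T f = integral S f"
proof -
  have "integral T f = integral T (\<lambda>t. if t \<in> S then f t else 0)"
    by (rule Henstock_Kurzweil_Integration.integral_cong) (use assms(2) in auto)
  also have "\<dots> = integral S f" by (simp add: integral_restrict_Int Int_absorb2 assms(1))
  finally show ?thesis .
qed

text \<open>The du Bois-Reymond argument: an arbitrary bump, corrected by a multiple of one fixed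
  bump to have mean zero, is the derivative of a test function. Hence \<open>w\<close> minus a
  constant is orthogonal to every bump.\<close>

lemma AE_const_if_weak_derivative_0:
  fixes w :: "real \<Rightarrow> real"
  assumes w: "\<And>T. w absolutely_integrable_on {0..T}"
    and weak: "\<And>\<phi> T. test_function \<phi> \<Longrightarrow> elementary_smooth (deriv \<phi>) \<Longrightarrow> (\<And>t. t \<ge> T \<Longrightarrow> \<phi> t = 0) \<Longrightarrow>
      (\<And>t. t \<ge> T \<Longrightarrow> deriv \<phi> t = 0) \<Longrightarrow> integral {0..T} (\<lambda>t. deriv \<phi> t * w t) = 0"
  obtains c where "AE t in lebesgue. t \<ge> 0 \<longrightarrow> w t = c"
proof -
  \<comment> \<open>Any interval in the open half-line would serve as support; the index is
    \<open>Suc 0\<close> because the bump of index 0 is the zero function.\<close>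
  define \<theta> where "\<theta> = bump 1 2 (Suc 0)"
  have \<theta>: "elementary_smooth \<theta>" unfolding \<theta>_def by (rule elementary_smooth_bump)
  define m where "m = integral {1..2} \<theta>"
  have m: "m \<noteq> 0"
  proof
    assume "m = 0"
    moreover have "\<theta> integrable_on {1..2}" by (intro integrable_continuous_real elementary_smooth_continuous \<theta>)
    ultimately have "(\<theta> has_integral 0) (cbox 1 2)" by (simp add: m_def has_integral_iff)
    then have "\<theta> (3 / 2) = 0"
      by (rule has_integral_0_cbox_imp_0[rotated 2])
        (auto intro!: elementary_smooth_continuous \<theta>, auto simp: \<theta>_def bump_bounds)
    then show False using bump_pos[of "3 / 2" 1 2 0] by (simp add: \<theta>_def)
  qed
  \<comment> \<open>If \<open>w\<close> is constant, the constant must be its mean with weight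
    \<open>\<theta>\<close>.\<close>
  define c where "c = integral {1..2} (\<lambda>t. \<theta> t * w t) / m"
  have "AE t in lebesgue. t \<ge> 0 \<longrightarrow> w t - c = 0"
  proof (rule AE_eq_0_if_bump_integrals_0)
    show "(\<lambda>t. w t - c) absolutely_integrable_on {0..T}" for T
      by (intro set_integral_diff w absolutely_integrable_on_const) auto
    fix a b :: real and n assume ab: "0 < a" "a < b"
    define \<beta> where "\<beta> = bump a b n"
    have \<beta>: "elementary_smooth \<beta>" unfolding \<beta>_def by (rule elementary_smooth_bump)
    define i where "i = integral {a..b} \<beta>"
    \<comment> \<open>The coefficient removes the mean: \<open>i\<close> and \<open>m\<close> are
      the integrals of \<open>\<beta>\<close> and \<open>\<theta>\<close>.\<close>
    define \<eta> where "\<eta> t = \<beta> t + (- (i / m)) * \<theta> t" for t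
    have \<eta>: "elementary_smooth \<eta>" unfolding \<eta>_def[abs_def] by (intro elementary_smooth.intros \<beta> \<theta>)
    define lo hi where "lo = min a 1" and "hi = max b 2"
    have lohi: "0 < lo" "lo \<le> hi" "lo \<le> a" "lo \<le> 1" "b \<le> hi" "2 \<le> hi" using ab by (auto simp: lo_def hi_def)
    have supp\<beta>: "\<beta> t = 0" if "t \<notin> {a..b}" for t using that by (auto simp: \<beta>_def intro!: bump_eq_0)
    have supp\<theta>: "\<theta> t = 0" if "t \<notin> {1..2}" for t using that by (auto simp: \<theta>_def intro!: bump_eq_0)
    have supp: "\<eta> t = 0" if "t \<notin> {lo..hi}" for t
      using supp\<beta>[of t] supp\<theta>[of t] that lohi by (auto simp: \<eta>_def)
    have 1: "\<beta> integrable_on {lo..hi}" "\<theta> integrable_on {lo..hi}"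
      by (intro integrable_continuous_real elementary_smooth_continuous \<beta> \<theta>)+
    have "integral {lo..hi} \<eta> = integral {lo..hi} \<beta> + (- (i / m)) * integral {lo..hi} \<theta>"
      using Henstock_Kurzweil_Integration.integral_add[OF 1(1) integrable_on_mult_right[OF 1(2), of "- (i / m)"]]
      by (simp add: \<eta>_def[abs_def])
    also have "\<dots> = 0"
      using integral_zero_extension[of "{a..b}" "{lo..hi}" \<beta>] integral_zero_extension[of "{1..2}" "{lo..hi}" \<theta>]
        supp\<beta> supp\<theta> lohi m by (auto simp: i_def m_def)
    finally obtain \<phi> where \<phi>: "test_function \<phi>" "deriv \<phi> = \<eta>" "\<And>t. t \<notin> {lo..hi} \<Longrightarrow> \<phi> t = 0"
      using test_function_antiderivative[OF \<eta> lohi(1,2) supp] by blast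
    have "0 = integral {0..hi + 1} (\<lambda>t. \<eta> t * w t)"
      using weak[of \<phi> "hi + 1"] \<phi> supp \<eta> by simp
    also have "\<dots> = integral {0..hi + 1} (\<lambda>t. \<beta> t * w t) + (- (i / m)) * integral {0..hi + 1} (\<lambda>t. \<theta> t * w t)"
    proof -
      have 1: "(\<lambda>t. \<beta> t * w t) integrable_on {0..hi + 1}" "(\<lambda>t. \<theta> t * w t) integrable_on {0..hi + 1}"
        by (intro elementary_smooth_times_integrable \<beta> \<theta> w order_refl)+
      have "(\<lambda>t. \<eta> t * w t) = (\<lambda>t. \<beta> t * w t + (- (i / m)) * (\<theta> t * w t))"
        by (simp add: \<eta>_def algebra_simps)
      then show ?thesis
        using Henstock_Kurzweil_Integration.integral_add[OF 1(1) integrable_on_mult_right[OF 1(2), of "- (i / m)"]] by simp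
    qed
    also have "integral {0..hi + 1} (\<lambda>t. \<theta> t * w t) = m * c"
      using integral_zero_extension[of "{1..2}" "{0..hi + 1}" "\<lambda>t. \<theta> t * w t"] supp\<theta> lohi m by (auto simp: c_def)
    also have "integral {0..hi + 1} (\<lambda>t. \<beta> t * w t) = integral {a..b} (\<lambda>t. \<beta> t * w t)"
      using supp\<beta> lohi ab by (intro integral_zero_extension) auto
    finally have "integral {a..b} (\<lambda>t. \<beta> t * w t) = i * c" using m by simp
    moreover have "integral {a..b} (\<lambda>t. \<beta> t * (w t - c)) = integral {a..b} (\<lambda>t. \<beta> t * w t) - integral {a..b} (\<lambda>t. \<beta> t * c)"
      unfolding right_diff_distrib using ab
      by (intro Henstock_Kurzweil_Integration.integral_diff elementary_smooth_times_integrable \<beta> w)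
        (auto intro!: integrable_on_mult_left integrable_continuous_real elementary_smooth_continuous \<beta>)
    ultimately show "integral {a..b} (\<lambda>t. bump a b n t * (w t - c)) = 0" by (simp add: \<beta>_def[symmetric] i_def)
  qed
  then have "AE t in lebesgue. t \<ge> 0 \<longrightarrow> w t = c" by eventually_elim auto
  then show thesis by (rule that)
qed

text \<open>Since \<open>v\<close> is merely integrable, its primitive need not be differentiable
  everywhere; Fubini on the triangle s \<le> t replaces the product rule. The boundary terms vanish
  by \<open>\<phi> b = 0\<close> and because the primitive starts at 0.\<close>

lemma integral_by_parts_indefinite:
  fixes v :: "real \<Rightarrow> real"
  assumes v: "v absolutely_integrable_on {0..b}" and "0 \<le> b"
    and \<phi>: "\<And>t. (\<phi> has_real_derivative \<eta> t) (at t)" "\<phi> b = 0" and \<eta>: "continuous_on UNIV \<eta>"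
  shows "integral {0..b} (\<lambda>t. \<eta> t * integral {0..t} v) = - integral {0..b} (\<lambda>t. \<phi> t * v t)"
proof -
  obtain w where w: "w \<in> borel_measurable borel" "integrable lborel w"
    "AE t in lborel. w t = indicator {0..b} t * v t"
    "\<And>x y. 0 \<le> x \<Longrightarrow> y \<le> b \<Longrightarrow> integral {x..y} v = (\<integral>t. indicator {x..y} t * w t \<partial>lborel)"
    using borel_representative[OF v] by blast
  note [measurable] = w(1) borel_measurable_continuous_onI[OF \<eta>]
  have c\<phi>: "continuous_on S \<phi>" for S
    by (rule DERIV_continuous_on[OF has_field_derivative_at_within[OF \<phi>(1)]])
  note [measurable] = borel_measurable_continuous_onI[OF c\<phi>]
  have vi: "v integrable_on {0..b}" using v set_lebesgue_integral_eq_integral(1) by blast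
  define f where "f s t = indicator {0..b} t * \<eta> t * (if s \<le> t then w s else 0)" for s t
  have I\<eta>: "integrable lborel (\<lambda>t. indicator {0..b} t * \<eta> t)"
    using borel_integrable_compact[of "{0..b}" \<eta>] \<eta> by (auto simp: set_integrable_def intro: continuous_on_subset)
  have prod: "integrable (lborel \<Otimes>\<^sub>M lborel) (\<lambda>(s, t). w s * (indicator {0..b} t * \<eta> t))"
    by (rule lborel_pair.Fubini_integrable) (use w(2) I\<eta> in \<open>auto simp: abs_mult\<close>)
  have f: "integrable (lborel \<Otimes>\<^sub>M lborel) (case_prod f)"
  proof (rule Bochner_Integration.integrable_bound[OF prod])
    show "case_prod f \<in> borel_measurable (lborel \<Otimes>\<^sub>M lborel)"
      unfolding f_def[abs_def] by measurable
  qed (auto simp: f_def abs_mult split: if_splits)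
  have inner1: "(\<integral>s. f s t \<partial>lborel) = indicator {0..b} t * (\<eta> t * integral {0..t} v)" for t
  proof (cases "t \<in> {0..b}")
    case True
    have "(\<integral>s. f s t \<partial>lborel) = (\<integral>s. \<eta> t * (indicator {0..t} s * w s) \<partial>lborel)"
    proof (rule integral_cong_AE)
      show "AE s in lborel. f s t = \<eta> t * (indicator {0..t} s * w s)"
        using w(3) by eventually_elim (use True in \<open>auto simp: f_def indicator_def\<close>)
    qed (auto simp: f_def)
    also have "\<dots> = \<eta> t * integral {0..t} v" using w(4)[of 0 t] True by simp
    finally show ?thesis using True by simp
  qed (simp add: f_def)
  have inner2: "(\<integral>t. f s t \<partial>lborel) = - (\<phi> s * w s)" if "w s = indicator {0..b} s * v s" for s
  proof (cases "s \<in> {0..b}")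
    case True
    have "(\<integral>t. f s t \<partial>lborel) = (\<integral>t. w s * (indicator {s..b} t * \<eta> t) \<partial>lborel)"
      by (rule Bochner_Integration.integral_cong) (use True in \<open>auto simp: f_def indicator_def\<close>)
    also have "\<dots> = w s * (\<integral>t. indicator {s..b} t *\<^sub>R \<eta> t \<partial>lborel)" by simp
    also have "(\<integral>t. indicator {s..b} t *\<^sub>R \<eta> t \<partial>lborel) = \<phi> b - \<phi> s"
      using True \<phi>(1) \<eta>
      by (intro integral_FTC_Icc) (auto intro: has_field_derivative_at_within continuous_on_subset
          simp flip: has_real_derivative_iff_has_vector_derivative)
    finally show ?thesis using \<phi>(2) by simp
  next
    case False
    then have "w s = 0" using that by simp
    moreover from this have "f s t = 0" for t by (simp add: f_def)
    ultimately show ?thesis by simp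
  qed
  have "(\<integral>t. (\<integral>s. f s t \<partial>lborel) \<partial>lborel) = (\<integral>s. (\<integral>t. f s t \<partial>lborel) \<partial>lborel)"
    by (rule lborel_pair.Fubini_integral[OF f])
  also have "(\<integral>t. (\<integral>s. f s t \<partial>lborel) \<partial>lborel) = integral {0..b} (\<lambda>t. \<eta> t * integral {0..t} v)"
  proof -
    have "continuous_on {0..b} (\<lambda>t. \<eta> t * integral {0..t} v)"
      by (intro continuous_intros continuous_on_subset[OF \<eta>] indefinite_integral_continuous_1[OF vi]) auto
    then have "set_integrable lborel {0..b} (\<lambda>t. \<eta> t * integral {0..t} v)"
      by (intro borel_integrable_atLeastAtMost') 
    then show ?thesis unfolding inner1
      using set_borel_integral_eq_integral(2)[of "{0..b}" "\<lambda>t. \<eta> t * integral {0..t} v"]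
      by (simp add: set_lebesgue_integral_def)
  qed
  also have "(\<integral>s. (\<integral>t. f s t \<partial>lborel) \<partial>lborel) = (\<integral>s. - (\<phi> s * w s) \<partial>lborel)"
  proof (rule integral_cong_AE)
    show "AE s in lborel. (\<integral>t. f s t \<partial>lborel) = - (\<phi> s * w s)"
      using w(3) by eventually_elim (rule inner2)
    show "(\<lambda>s. \<integral>t. f s t \<partial>lborel) \<in> borel_measurable lborel"
      by (rule borel_measurable_integrable[OF lborel_pair.integrable_fst[OF f]])
  qed simp
  also have "\<dots> = - (\<integral>s. \<phi> s * w s \<partial>lborel)" by simp
  also have "(\<integral>s. \<phi> s * w s \<partial>lborel) = integral {0..b} (\<lambda>t. \<phi> t * v t)"
  proof -
    have "(\<lambda>t. \<phi> t * v t) absolutely_integrable_on {0..b}"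
      by (intro absolutely_integrable_bounded_measurable_product_real v
          continuous_imp_measurable_on_sets_lebesgue compact_imp_bounded compact_continuous_image c\<phi>) auto
    from borel_representative[OF this] obtain w2 where w2: "w2 \<in> borel_measurable borel" "integrable lborel w2"
      "AE t in lborel. w2 t = indicator {0..b} t * (\<phi> t * v t)"
      "\<And>x y. 0 \<le> x \<Longrightarrow> y \<le> b \<Longrightarrow> integral {x..y} (\<lambda>t. \<phi> t * v t) = (\<integral>t. indicator {x..y} t * w2 t \<partial>lborel)"
      by blast
    have "(\<integral>s. \<phi> s * w s \<partial>lborel) = (\<integral>s. indicator {0..b} s * w2 s \<partial>lborel)"
    proof (rule integral_cong_AE)
      show "AE s in lborel. \<phi> s * w s = indicator {0..b} s * w2 s"
        using w(3) w2(3) by eventually_elim (auto simp: indicator_def)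
    qed (use w2(1) in auto)
    then show ?thesis using w2(4)[of 0 b] by simp
  qed
  finally show ?thesis .
qed

text \<open>By parts, the primitive of \<open>v\<close> has weak derivative \<open>v\<close>, so its
  difference from \<open>u\<close> has weak derivative zero.\<close>

lemma AE_eq_integral_if_weak_derivative:
  fixes u v :: "real \<Rightarrow> real"
  assumes u: "\<And>T. u absolutely_integrable_on {0..T}" and v: "\<And>T. v absolutely_integrable_on {0..T}"
    and weak: "\<And>\<phi> T. test_function \<phi> \<Longrightarrow> (\<And>t. t \<ge> T \<Longrightarrow> \<phi> t = 0) \<Longrightarrow> (\<And>t. t \<ge> T \<Longrightarrow> deriv \<phi> t = 0) \<Longrightarrow>
      integral {0..T} (\<lambda>t. deriv \<phi> t * u t) = - integral {0..T} (\<lambda>t. \<phi> t * v t)"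
  obtains c where "AE t in lebesgue. t \<ge> 0 \<longrightarrow> u t = c + integral {0..t} v"
proof -
  have vi: "v integrable_on {0..T}" for T using v set_lebesgue_integral_eq_integral(1) by blast
  have V: "(\<lambda>t. integral {0..t} v) absolutely_integrable_on {0..T}" for T
    by (rule absolutely_integrable_continuous_real[OF indefinite_integral_continuous_1[OF vi]])
  obtain c where "AE t in lebesgue. t \<ge> 0 \<longrightarrow> u t - integral {0..t} v = c"
  proof (rule AE_const_if_weak_derivative_0)
    show "(\<lambda>t. u t - integral {0..t} v) absolutely_integrable_on {0..T}" for T
      by (intro set_integral_diff u V)
    fix \<phi> T assume \<phi>: "test_function \<phi>" "elementary_smooth (deriv \<phi>)"
      "\<And>t. t \<ge> T \<Longrightarrow> \<phi> t = 0" "\<And>t. t \<ge> T \<Longrightarrow> deriv \<phi> t = 0"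
    show "integral {0..T} (\<lambda>t. deriv \<phi> t * (u t - integral {0..t} v)) = 0"
    proof (cases "0 \<le> T")
      case True
      have d: "(\<phi> has_real_derivative deriv \<phi> t) (at t)" for t
        using \<phi>(1) unfolding test_function_def by (metis DERIV_deriv_iff_field_differentiable funpow_0)
      have "integral {0..T} (\<lambda>t. deriv \<phi> t * (u t - integral {0..t} v))
        = integral {0..T} (\<lambda>t. deriv \<phi> t * u t) - integral {0..T} (\<lambda>t. deriv \<phi> t * integral {0..t} v)"
        unfolding right_diff_distrib
        by (intro Henstock_Kurzweil_Integration.integral_diff elementary_smooth_times_integrable \<phi>(2) u V order_refl)
      also have "integral {0..T} (\<lambda>t. deriv \<phi> t * integral {0..t} v) = - integral {0..T} (\<lambda>t. \<phi> t * v t)"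
        by (rule integral_by_parts_indefinite[OF v True d]) (use \<phi> elementary_smooth_continuous in auto)
      finally show ?thesis using weak[OF \<phi>(1,3,4)] by simp
    qed simp
  qed blast
  then have "AE t in lebesgue. t \<ge> 0 \<longrightarrow> u t = c + integral {0..t} v" by eventually_elim auto
  then show thesis by (rule that)
qed

section \<open>Strongly measurable functions under linear functionals\<close>

text \<open>Applied to the simple approximations, \<open>h\<close> gives real simple functions, and
  their \<open>lim\<close> is measurable regardless of where they converge. Completeness of Lebesgue
  measure transfers this to \<open>h (g t)\<close>. Continuity of \<open>h\<close> suffices, so the
  norm is included.\<close>

lemma strongly_measurable_compose:
  fixes g :: "real \<Rightarrow> 'b::real_normed_vector" and h :: "'b \<Rightarrow> real"
  assumes g: "strongly_measurable (lebesgue_on S) g" and h: "continuous_on UNIV h" and S: "S \<in> sets lebesgue"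
  shows "(\<lambda>t. h (g t)) \<in> borel_measurable (lebesgue_on S)"
proof -
  obtain s where s: "\<And>i. simple_function (lebesgue_on S) (s i)"
    and lim: "AE t in lebesgue_on S. (\<lambda>i. s i t) \<longlonglongrightarrow> g t"
    using g unfolding strongly_measurable_def by blast
  define k where "k t = lim (\<lambda>i. h (s i t))" for t
  have k: "k \<in> borel_measurable (lebesgue_on S)"
    unfolding k_def[abs_def]
    by (intro borel_measurable_lim_metric borel_measurable_simple_function simple_function_compose1[where f = "s _" and g = h] s)
  have "AE t in lebesgue_on S. k t = h (g t)"
    using lim
  proof eventually_elim
    case (elim t)
    then have "(\<lambda>i. h (s i t)) \<longlonglongrightarrow> h (g t)"
      using h by (metis UNIV_I continuous_on_tendsto_compose eventually_sequentiallyI)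
    then show ?case unfolding k_def by (rule limI)
  qed
  then have "AE t in lebesgue. (if t \<in> S then k t else 0) = (if t \<in> S then h (g t) else 0)"
    using S by (subst (asm) AE_restrict_space_iff) auto
  moreover have "(\<lambda>t. if t \<in> S then k t else 0) \<in> borel_measurable lebesgue"
    using k S borel_measurable_if_lebesgue_on[of S UNIV k] by (simp add: lebesgue_on_UNIV_eq)
  ultimately have "(\<lambda>t. if t \<in> S then h (g t) else 0) \<in> borel_measurable lebesgue"
    by (rule borel_measurable_AE[rotated])
  then show ?thesis
    using S borel_measurable_if_lebesgue_on[of S UNIV "\<lambda>t. h (g t)"] by (simp add: lebesgue_on_UNIV_eq)
qed

text \<open>A bounded functional maps the approximating simple functions to real ones and multiplies
  the L1 error by at most its bound. Vector-valued weak derivatives thereby become scalar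
  ones.\<close>

lemma strong_integral_functional:
  fixes g :: "real \<Rightarrow> 'b::real_normed_vector" and h :: "'b \<Rightarrow> real"
  assumes g: "has_strong_integral (lebesgue_on S) g I" and h: "bounded_linear h" and S: "S \<in> sets lebesgue"
  shows "has_bochner_integral (lebesgue_on S) (\<lambda>t. h (g t)) (h I)"
proof -
  interpret h: bounded_linear h by fact
  obtain K where K: "K > 0" "\<And>x. norm (h x) \<le> norm x * K" using h.pos_bounded by blast
  obtain s where s: "\<And>i. Bochner_Integration.simple_bochner_integrable (lebesgue_on S) (s i)"
    "(\<lambda>i. \<integral>\<^sup>+t. ennreal (norm (g t - s i t)) \<partial>lebesgue_on S) \<longlonglongrightarrow> 0"
    "(\<lambda>i. Bochner_Integration.simple_bochner_integral (lebesgue_on S) (s i)) \<longlonglongrightarrow> I"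
    and meas: "strongly_measurable (lebesgue_on S) g"
    using g unfolding has_strong_integral_def by blast
  have norm_meas: "(\<lambda>t. norm (g t - s i t)) \<in> borel_measurable (lebesgue_on S)" for i
  proof (rule strongly_measurable_compose[where h = norm, OF _ _ S])
    have sf: "simple_function (lebesgue_on S) (s i)" using s(1) by (auto elim: simple_bochner_integrable.cases)
    obtain u where u: "\<And>j. simple_function (lebesgue_on S) (u j)" "AE t in lebesgue_on S. (\<lambda>j. u j t) \<longlonglongrightarrow> g t"
      using meas unfolding strongly_measurable_def by blast
    show "strongly_measurable (lebesgue_on S) (\<lambda>t. g t - s i t)"
      unfolding strongly_measurable_def
    proof (intro exI[of _ "\<lambda>j t. u j t - s i t"] conjI allI)
      show "simple_function (lebesgue_on S) (\<lambda>t. u j t - s i t)" for j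
        by (rule simple_function_compose2[where h = minus, OF u(1) sf])
      show "AE t in lebesgue_on S. (\<lambda>j. u j t - s i t) \<longlonglongrightarrow> g t - s i t"
        using u(2) by eventually_elim (intro tendsto_intros)
    qed
  qed (intro continuous_intros)
  show ?thesis
  proof (rule has_bochner_integral.intros)
    show "(\<lambda>t. h (g t)) \<in> borel_measurable (lebesgue_on S)"
      by (rule strongly_measurable_compose[OF meas h.continuous_on[OF continuous_on_id] S])
    show "Bochner_Integration.simple_bochner_integrable (lebesgue_on S) (\<lambda>t. h (s i t))" for i
      by (rule simple_bochner_integrable_compose2[where p = "\<lambda>x y. h x", OF h.zero s(1) s(1)])
    show "(\<lambda>i. \<integral>\<^sup>+t. ennreal (norm (h (g t) - h (s i t))) \<partial>lebesgue_on S) \<longlonglongrightarrow> 0"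
    proof (rule tendsto_sandwich[where f = "\<lambda>_. 0"])
      show "\<forall>\<^sub>F i in sequentially. (\<integral>\<^sup>+t. ennreal (norm (h (g t) - h (s i t))) \<partial>lebesgue_on S)
          \<le> ennreal K * (\<integral>\<^sup>+t. ennreal (norm (g t - s i t)) \<partial>lebesgue_on S)"
      proof (intro always_eventually allI)
        fix i
        have "(\<integral>\<^sup>+t. ennreal (norm (h (g t) - h (s i t))) \<partial>lebesgue_on S)
            \<le> (\<integral>\<^sup>+t. ennreal K * ennreal (norm (g t - s i t)) \<partial>lebesgue_on S)"
          using K by (intro nn_integral_mono) (simp add: h.diff[symmetric] ennreal_mult[symmetric] ennreal_leI mult.commute)
        also have "\<dots> = ennreal K * (\<integral>\<^sup>+t. ennreal (norm (g t - s i t)) \<partial>lebesgue_on S)"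
          using norm_meas by (intro nn_integral_cmult) auto
        finally show "(\<integral>\<^sup>+t. ennreal (norm (h (g t) - h (s i t))) \<partial>lebesgue_on S)
          \<le> ennreal K * (\<integral>\<^sup>+t. ennreal (norm (g t - s i t)) \<partial>lebesgue_on S)" .
      qed
      have "(\<lambda>i. ennreal K * (\<integral>\<^sup>+t. ennreal (norm (g t - s i t)) \<partial>lebesgue_on S)) \<longlonglongrightarrow> ennreal K * 0"
        by (intro ennreal_tendsto_cmult s(2)) simp
      then show "(\<lambda>i. ennreal K * (\<integral>\<^sup>+t. ennreal (norm (g t - s i t)) \<partial>lebesgue_on S)) \<longlonglongrightarrow> 0" by simp
    qed auto
    show "(\<lambda>i. Bochner_Integration.simple_bochner_integral (lebesgue_on S) (\<lambda>t. h (s i t))) \<longlonglongrightarrow> h I"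
      using h.tendsto[OF s(3)] by (simp add: simple_bochner_integral_linear[OF h.linear s(1)])
  qed
qed

lemma strongly_measurable_cong_AE:
  "AE t in M. f t = g t \<Longrightarrow> strongly_measurable M f \<Longrightarrow> strongly_measurable M g"
  unfolding strongly_measurable_def
proof (elim exE conjE)
  fix s assume "AE t in M. f t = g t" "\<forall>i. simple_function M (s i)" "AE t in M. (\<lambda>i. s i t) \<longlonglongrightarrow> f t"
  then show "\<exists>s. (\<forall>i. simple_function M (s i)) \<and> (AE t in M. (\<lambda>i. s i t) \<longlonglongrightarrow> g t)"
    by (intro exI[of _ s]) (auto elim!: eventually_elim2)
qed

lemma has_strong_integral_cong_AE:
  assumes "AE t in M. f t = g t" "has_strong_integral M f I"
  shows "has_strong_integral M g I"
proof -
  have "(\<integral>\<^sup>+t. ennreal (norm (f t - s t)) \<partial>M) = (\<integral>\<^sup>+t. ennreal (norm (g t - s t)) \<partial>M)" for s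
    by (rule nn_integral_cong_AE) (use assms(1) in \<open>auto elim!: eventually_mono\<close>)
  then show ?thesis
    using assms strongly_measurable_cong_AE[OF assms(1)] unfolding has_strong_integral_def by simp
qed

lemma square_integrable_imp_absolutely_integrable_on:
  fixes g :: "real \<Rightarrow> real"
  assumes m: "g \<in> borel_measurable (lebesgue_on {0..})" and i: "integrable (lebesgue_on {0..}) (\<lambda>t. (g t)\<^sup>2)"
  shows "g absolutely_integrable_on {0..T}"
proof -
  have 1: "integrable lebesgue (\<lambda>t. indicator {0..} t * (g t)\<^sup>2)"
    using i by (subst (asm) integrable_restrict_space) auto
  have 2: "integrable lebesgue (indicat_real {0..T})"
    by (rule integrable_real_indicator) (auto simp: emeasure_lborel_Icc_eq)
  have 3: "g \<in> borel_measurable (lebesgue_on {0..T})"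
    by (rule measurable_restrict_mono[OF m]) auto
  then have 4: "(\<lambda>t. indicator {0..T} t *\<^sub>R g t) \<in> borel_measurable lebesgue"
    by (subst (asm) borel_measurable_restrict_space_iff) auto
  have "integrable lebesgue (\<lambda>t. indicator {0..T} t *\<^sub>R g t)"
  proof (rule Bochner_Integration.integrable_bound[OF Bochner_Integration.integrable_add[OF 2 1] 4], rule AE_I2)
    fix t
    \<comment> \<open>This gives |g| \<le> 1 + g^2, whose right-hand side is integrable on a bounded
      interval.\<close>
    have "0 \<le> (\<bar>g t\<bar> - 1)\<^sup>2" by simp
    then have "\<bar>g t\<bar> \<le> 1 + (g t)\<^sup>2" unfolding power2_diff by (simp add: power2_eq_square)
    then show "norm (indicator {0..T} t *\<^sub>R g t) \<le> norm (indicat_real {0..T} t + indicat_real {0..} t * (g t)\<^sup>2)"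
      by (auto simp: indicator_def)
  qed
  then show ?thesis by (simp add: set_integrable_def)
qed

section \<open>Continuous representatives of Sobolev functions\<close>

lemma integral_cong_AE_lebesgue:
  fixes f g :: "real \<Rightarrow> real"
  assumes "AE t in lebesgue. t \<in> S \<longrightarrow> f t = g t"
  shows "integral S f = integral S g"
proof -
  obtain N where N: "N \<in> null_sets lebesgue" "{t \<in> space lebesgue. \<not> (t \<in> S \<longrightarrow> f t = g t)} \<subseteq> N"
    using assms unfolding eventually_ae_filter by blast
  show ?thesis
    by (rule integral_spike[of N]) (use N in \<open>auto simp: negligible_iff_null_sets\<close>)
qed

lemma integral_bochner_halfline:
  fixes k :: "real \<Rightarrow> real"
  assumes "has_bochner_integral (lebesgue_on {0..}) k x" "\<And>t. t \<in> {0..} \<Longrightarrow> t \<notin> S \<Longrightarrow> k t = 0" "S \<subseteq> {0..}"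
  shows "integral S k = x"
proof -
  have "integral {0..} k = x"
    using assms(1) lebesgue_integral_eq_integral[of "{0..}" k] by (simp add: has_bochner_integral_iff)
  then show ?thesis using integral_zero_extension[OF assms(3,2)] by simp
qed

lemma test_function_deriv:
  assumes "test_function \<phi>"
  shows "test_function (deriv \<phi>)"
proof -
  obtain a b where ab: "0 < a" "\<And>t. t \<notin> {a..b} \<Longrightarrow> \<phi> t = 0"
    using assms unfolding test_function_def by blast
  have "deriv \<phi> t = 0" if "t \<notin> {a..b}" for t
  proof (rule DERIV_imp_deriv)
    have "((\<lambda>_. 0) has_real_derivative 0) (at t)" by simp
    then show "(\<phi> has_real_derivative 0) (at t)"
      by (rule has_field_derivative_transform_within_open[of _ _ _ "- {a..b}"]) (use that ab in auto)
  qed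
  moreover have "(deriv ^^ k) (deriv \<phi>) field_differentiable at t" for k t
    using assms unfolding test_function_def by (metis comp_apply funpow_Suc_right)
  ultimately show ?thesis using ab(1) unfolding test_function_def by blast
qed

text \<open>The inner product is a parameter because the space carrying it is given only as a Banach
  space; it will be pulled back from X along an isometry. A real inner product is enough, as its
  functionals separate points and recover the norm.\<close>

locale inner_norm =
  fixes ip :: "'w::banach \<Rightarrow> 'w \<Rightarrow> real"
  assumes ip_commute: "ip x y = ip y x"
    and ip_add: "ip x (y + z) = ip x y + ip x z"
    and ip_scaleR: "ip x (c *\<^sub>R y) = c * ip x y"
    and ip_norm: "ip x x = (norm x)\<^sup>2"
begin

lemma cauchy_schwarz: "\<bar>ip x y\<bar> \<le> norm x * norm y"
proof (cases "y = 0")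
  case True
  then show ?thesis using ip_scaleR[of x 0 0] by simp
next
  case False
  define t where "t = ip x y / (norm y)\<^sup>2"
  have diff: "ip u (v - c *\<^sub>R w) = ip u v - c * ip u w" for u v w c
    using ip_add[of u v "(- c) *\<^sub>R w"] ip_scaleR[of u "- c" w] by simp
  have "0 \<le> ip (x - t *\<^sub>R y) (x - t *\<^sub>R y)" by (simp add: ip_norm)
  also have "\<dots> = ip x x - t * ip x y - t * (ip x y - t * ip y y)"
    by (simp add: diff ip_commute[of "x - t *\<^sub>R y"] ip_commute[of y x] algebra_simps)
  also have "\<dots> = (norm x)\<^sup>2 - (ip x y)\<^sup>2 / (norm y)\<^sup>2"
    using False by (simp add: ip_norm t_def power2_eq_square field_simps)
  finally have "(ip x y)\<^sup>2 \<le> (norm x * norm y)\<^sup>2"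
    using False by (simp add: field_simps power_mult_distrib)
  then show ?thesis by (metis abs_le_square_iff abs_mult abs_norm_cancel)
qed

lemma bounded_linear_ip: "bounded_linear (ip y)"
  by (rule bounded_linear_intro[where K = "norm y"])
    (use cauchy_schwarz[of y] in \<open>auto simp: ip_add ip_scaleR mult.commute\<close>)

lemma ip_diff: "ip x (y - z) = ip x y - ip x z"
  by (rule bounded_linear.linear[OF bounded_linear_ip, THEN linear_diff])

lemma ip_eqI: "(\<And>y. ip y v = ip y w) \<Longrightarrow> v = w"
  using ip_norm[of "v - w"] by (simp add: ip_diff)

lemma ip_integral:
  fixes g :: "real \<Rightarrow> 'w"
  assumes "continuous_on {a..b} g"
  shows "integral {a..b} (\<lambda>s. ip y (g s)) = ip y (integral {a..b} g)"
  using integral_linear[OF integrable_continuous_real[OF assms] bounded_linear_ip] by (simp add: o_def)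

lemma weak_derivative_functional:
  assumes "weak_derivative j f g" "test_function \<phi>"
  obtains I where "has_bochner_integral (lebesgue_on {0..}) (\<lambda>t. (deriv ^^ j) \<phi> t * ip y (f t)) I"
    "has_bochner_integral (lebesgue_on {0..}) (\<lambda>t. \<phi> t * ip y (g t)) ((-1) ^ j * I)"
proof -
  obtain I where I: "has_strong_integral (lebesgue_on {0..}) (\<lambda>t. (deriv ^^ j) \<phi> t *\<^sub>R f t) I"
    "has_strong_integral (lebesgue_on {0..}) (\<lambda>t. \<phi> t *\<^sub>R g t) ((-1) ^ j *\<^sub>R I)"
    using assms unfolding weak_derivative_def by blast
  have S: "{0::real..} \<in> sets lebesgue" by simp
  from strong_integral_functional[OF I(1) bounded_linear_ip S] strong_integral_functional[OF I(2) bounded_linear_ip S]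
  show thesis by (intro that[of "ip y I"]) (simp_all add: ip_scaleR)
qed

text \<open>The definition relates each weak derivative only to \<open>f\<close>. Testing order j
  with \<phi>' and order j + 1 with \<phi> produces the same integral of \<open>f\<close>, which
  links consecutive orders.\<close>

lemma weak_derivative_consecutive:
  assumes g: "weak_derivative j f g" and h: "weak_derivative (Suc j) f h" and \<phi>: "test_function \<phi>"
    and supp: "\<And>t. t \<ge> T \<Longrightarrow> \<phi> t = 0" "\<And>t. t \<ge> T \<Longrightarrow> deriv \<phi> t = 0"
  shows "integral {0..T} (\<lambda>t. deriv \<phi> t * ip y (g t)) = - integral {0..T} (\<lambda>t. \<phi> t * ip y (h t))"
proof -
  obtain I where I: "has_bochner_integral (lebesgue_on {0..}) (\<lambda>t. (deriv ^^ j) (deriv \<phi>) t * ip y (f t)) I"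
    "has_bochner_integral (lebesgue_on {0..}) (\<lambda>t. deriv \<phi> t * ip y (g t)) ((-1) ^ j * I)"
    using weak_derivative_functional[OF g test_function_deriv[OF \<phi>]] by blast
  obtain I' where I': "has_bochner_integral (lebesgue_on {0..}) (\<lambda>t. (deriv ^^ Suc j) \<phi> t * ip y (f t)) I'"
    "has_bochner_integral (lebesgue_on {0..}) (\<lambda>t. \<phi> t * ip y (h t)) ((-1) ^ Suc j * I')"
    using weak_derivative_functional[OF h \<phi>] by blast
  have "(deriv ^^ Suc j) \<phi> = (deriv ^^ j) (deriv \<phi>)" by (simp add: funpow_swap1)
  with I(1) I'(1) have "I = I'" by (simp add: has_bochner_integral_eq)
  moreover have "integral {0..T} (\<lambda>t. deriv \<phi> t * ip y (g t)) = (-1) ^ j * I"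
    by (rule integral_bochner_halfline[OF I(2)]) (use supp in auto)
  moreover have "integral {0..T} (\<lambda>t. \<phi> t * ip y (h t)) = (-1) ^ Suc j * I'"
    by (rule integral_bochner_halfline[OF I'(2)]) (use supp in auto)
  ultimately show ?thesis by simp
qed

text \<open>This makes the definite description in \<open>initial_derivative\<close> meaningful.
  Both functions have the same pairings with bumps after applying a functional, and continuity
  upgrades equality of integrals to equality at every point.\<close>

lemma weak_derivative_continuous_unique:
  fixes g h :: "real \<Rightarrow> 'w"
  assumes g: "weak_derivative j f g" "continuous_on {0..} g" and h: "weak_derivative j f h" "continuous_on {0..} h"
    and "t \<ge> 0"
  shows "g t = h t"
proof (rule ip_eqI)
  fix y
  have c: "continuous_on {0..} (\<lambda>t. ip y (g t - h t))"
    by (intro bounded_linear.continuous_on[OF bounded_linear_ip] continuous_on_diff g h)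
  have "ip y (g t - h t) = 0"
  proof (rule integral_determines_continuous[OF c continuous_on_const _ \<open>t \<ge> 0\<close>])
    fix T :: real assume T: "T \<ge> 0"
    have "integral {0..T} (\<lambda>t. ip y (g t - h t)) = 0"
    proof (rule integral_Icc_eq_0_if_bump_integrals_0[OF _ _ T])
      show "(\<lambda>t. ip y (g t - h t)) absolutely_integrable_on {0..T}" for T
        by (rule absolutely_integrable_continuous_real, rule continuous_on_subset[OF c]) auto
      fix a b :: real and n assume ab: "0 < a" "a < b"
      obtain I where I: "has_bochner_integral (lebesgue_on {0..}) (\<lambda>t. (deriv ^^ j) (bump a b n) t * ip y (f t)) I"
        "has_bochner_integral (lebesgue_on {0..}) (\<lambda>t. bump a b n t * ip y (g t)) ((-1) ^ j * I)"
        using weak_derivative_functional[OF g(1) test_function_bump[OF ab(1)]] by blast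
      obtain I' where I': "has_bochner_integral (lebesgue_on {0..}) (\<lambda>t. (deriv ^^ j) (bump a b n) t * ip y (f t)) I'"
        "has_bochner_integral (lebesgue_on {0..}) (\<lambda>t. bump a b n t * ip y (h t)) ((-1) ^ j * I')"
        using weak_derivative_functional[OF h(1) test_function_bump[OF ab(1)]] by blast
      have "I = I'" using I(1) I'(1) by (rule has_bochner_integral_eq)
      with has_bochner_integral_diff[OF I(2) I'(2)]
      have "has_bochner_integral (lebesgue_on {0..}) (\<lambda>t. bump a b n t * ip y (g t - h t)) 0"
        by (simp add: ip_diff right_diff_distrib)
      then show "integral {a..b} (\<lambda>t. bump a b n t * ip y (g t - h t)) = 0"
        by (rule integral_bochner_halfline) (use ab in \<open>auto simp: bump_eq_0\<close>)
    qed
    then show "integral {0..T} (\<lambda>t. ip y (g t - h t)) = integral {0..T} (\<lambda>t. 0)" by simp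
  qed
  then show "ip y (g t) = ip y (h t)" by (simp add: ip_diff)
qed

lemma L2_halflineD:
  fixes u :: "real \<Rightarrow> 'w"
  assumes "u \<in> L2_halfline"
  shows "(\<lambda>t. norm (u t)) absolutely_integrable_on {0..T}"
    and "(\<lambda>t. ip y (u t)) absolutely_integrable_on {0..T}"
    and "(\<lambda>t. (norm (u t))\<^sup>2) integrable_on {0..}"
proof -
  have u: "strongly_measurable (lebesgue_on {0..}) u" "integrable (lebesgue_on {0..}) (\<lambda>t. (norm (u t))\<^sup>2)"
    using assms unfolding L2_halfline_def by auto
  have S: "{0::real..} \<in> sets lebesgue" by simp
  have m: "(\<lambda>t. norm (u t)) \<in> borel_measurable (lebesgue_on {0..})"
    "(\<lambda>t. ip y (u t)) \<in> borel_measurable (lebesgue_on {0..})"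
    by (rule strongly_measurable_compose[OF u(1) _ S],
        intro continuous_intros bounded_linear.continuous_on[OF bounded_linear_ip])+
  show "(\<lambda>t. norm (u t)) absolutely_integrable_on {0..T}"
    by (rule square_integrable_imp_absolutely_integrable_on[OF m(1) u(2)])
  have "integrable (lebesgue_on {0..}) (\<lambda>t. (ip y (u t))\<^sup>2)"
  proof (rule Bochner_Integration.integrable_bound, rule integrable_mult_right[OF u(2), of "(norm y)\<^sup>2"])
    have "(ip y v)\<^sup>2 \<le> (norm y)\<^sup>2 * (norm v)\<^sup>2" for v
      using cauchy_schwarz[of y v] by (metis abs_le_square_iff abs_mult abs_norm_cancel power_mult_distrib)
    then show "AE t in lebesgue_on {0..}. norm ((ip y (u t))\<^sup>2) \<le> norm ((norm y)\<^sup>2 * (norm (u t))\<^sup>2)" by simp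
  qed (use m in measurable)
  then show "(\<lambda>t. ip y (u t)) absolutely_integrable_on {0..T}"
    by (rule square_integrable_imp_absolutely_integrable_on[OF m(2)])
  show "(\<lambda>t. (norm (u t))\<^sup>2) integrable_on {0..}"
    using has_integral_integral_lebesgue_on[OF u(2) S] by blast
qed

lemma L2_halfline_subset_L1_loc: "(u :: real \<Rightarrow> 'w) \<in> L2_halfline \<Longrightarrow> u \<in> L1_loc_halfline"
  using L2_halflineD(1)[of u] unfolding L1_loc_halfline_def L2_halfline_def
  by (auto simp: set_integrable_def integrable_restrict_space)

text \<open>Weak differentiability is tested against functionals. A countable family of them suffices for
  the estimate \<open>norm (u t - u s) \<le> \<integral>\<^sub>s\<^sup>t norm v\<close> outside a null set, because \<open>u\<close> is almost separably
  valued; \<open>u\<close> then extends continuously from a dense set.\<close>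

lemma continuous_representative:
  fixes u v :: "real \<Rightarrow> 'w"
  assumes u: "u \<in> L2_halfline" and v: "v \<in> L2_halfline"
    and weak: "\<And>\<phi> T y. test_function \<phi> \<Longrightarrow> (\<And>t. t \<ge> T \<Longrightarrow> \<phi> t = 0) \<Longrightarrow> (\<And>t. t \<ge> T \<Longrightarrow> deriv \<phi> t = 0) \<Longrightarrow>
      integral {0..T} (\<lambda>t. deriv \<phi> t * ip y (u t)) = - integral {0..T} (\<lambda>t. \<phi> t * ip y (v t))"
  obtains U where "continuous_on {0..} U" "AE t in lebesgue. t \<ge> 0 \<longrightarrow> u t = U t"
    "\<And>a b. 0 \<le> a \<Longrightarrow> a \<le> b \<Longrightarrow> norm (U b - U a) \<le> integral {0..b} (\<lambda>t. norm (v t)) - integral {0..a} (\<lambda>t. norm (v t))"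
    "\<And>y t. t \<ge> 0 \<Longrightarrow> ip y (U t) - ip y (U 0) = integral {0..t} (\<lambda>s. ip y (v s))"
proof -
  have "\<exists>c. AE t in lebesgue. t \<ge> 0 \<longrightarrow> ip y (u t) = c + integral {0..t} (\<lambda>s. ip y (v s))" for y
    by (rule AE_eq_integral_if_weak_derivative[OF L2_halflineD(2)[OF u] L2_halflineD(2)[OF v] weak]) blast+
  then obtain c where c: "\<And>y. AE t in lebesgue. t \<ge> 0 \<longrightarrow> ip y (u t) = c y + integral {0..t} (\<lambda>s. ip y (v s))"
    by metis
  obtain \<sigma> where \<sigma>: "\<And>i. simple_function (lebesgue_on {0..}) (\<sigma> i)"
    "AE t in lebesgue_on {0..}. (\<lambda>i. \<sigma> i t) \<longlonglongrightarrow> u t"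
    using u unfolding L2_halfline_def strongly_measurable_def by blast
  \<comment> \<open>The countably many values of the approximations are dense around almost all
    values of \<open>u\<close>. Their differences \<open>S\<close> are the test vectors, because the
    estimate needs a vector close to \<open>u t - u s\<close> itself.\<close>
  define S0 where "S0 = (\<Union>i. \<sigma> i ` {0..})"
  define S where "S = (\<lambda>(a, b). a - b) ` (S0 \<times> S0)"
  have "finite (\<sigma> i ` {0..})" for i
    using simple_functionD(1)[OF \<sigma>(1)[of i]] by simp
  then have "countable S0" unfolding S0_def by (auto intro: countable_finite)
  then have S: "countable S" unfolding S_def by auto
  have AE1: "AE t in lebesgue. t \<ge> 0 \<longrightarrow> u t \<in> closure S0"
  proof -
    have "AE t in lebesgue. t \<in> {0..} \<longrightarrow> (\<lambda>i. \<sigma> i t) \<longlonglongrightarrow> u t"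
      using \<sigma>(2) by (subst (asm) AE_restrict_space_iff) auto
    then show ?thesis
    proof eventually_elim
      case (elim t)
      show ?case
      proof
        assume "t \<ge> 0"
        then have "\<forall>i. \<sigma> i t \<in> S0" unfolding S0_def by auto
        with elim \<open>t \<ge> 0\<close> show "u t \<in> closure S0" unfolding closure_sequential by (intro exI[of _ "\<lambda>i. \<sigma> i t"]) auto
      qed
    qed
  qed
  have AE2: "AE t in lebesgue. \<forall>y\<in>S. t \<ge> 0 \<longrightarrow> ip y (u t) = c y + integral {0..t} (\<lambda>s. ip y (v s))"
    by (rule AE_ball_countable[THEN iffD2, OF S]) (use c in blast)
  \<comment> \<open>The full-measure set of times at which the scalar identities hold simultaneously
    for all test vectors in \<open>S\<close>.\<close>
  define X where "X = {t. t \<ge> 0 \<and> u t \<in> closure S0 \<and> (\<forall>y\<in>S. ip y (u t) = c y + integral {0..t} (\<lambda>s. ip y (v s)))}"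
  have X: "AE t in lebesgue. t \<ge> 0 \<longrightarrow> t \<in> X"
    using AE1 AE2 by eventually_elim (auto simp: X_def)
  have closX: "closure X = {0..}"
  proof
    show "closure X \<subseteq> {0..}" by (rule closure_minimal) (auto simp: X_def)
    have "t \<in> closure X" if "t \<in> {0<..}" for t
    proof (rule mem_closed_if_AE_lebesgue_open[OF _ closed_closure _ that])
      show "AE t\<in>{0<..} in lebesgue. t \<in> closure X"
        using X by eventually_elim (auto intro: closure_subset[THEN subsetD])
    qed simp
    then have "closure {0<..} \<subseteq> closure X" by (intro closure_minimal) auto
    then show "{0..} \<subseteq> closure X" by (simp add: closure_greaterThan)
  qed
  define K where "K t = integral {0..t} (\<lambda>t. norm (v t))" for t
  have nvi: "(\<lambda>t. norm (v t)) integrable_on {a..b}" if "0 \<le> a" for a b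
  proof -
    have "(\<lambda>t. norm (v t)) absolutely_integrable_on {a..b}"
      by (rule absolutely_integrable_on_subinterval[OF L2_halflineD(1)[OF v]]) (use that in auto)
    then show ?thesis using set_lebesgue_integral_eq_integral(1) by blast
  qed
  have ipi: "(\<lambda>t. ip y (v t)) integrable_on {a..b}" if "0 \<le> a" for a b y
  proof -
    have "(\<lambda>t. ip y (v t)) absolutely_integrable_on {a..b}"
      by (rule absolutely_integrable_on_subinterval[OF L2_halflineD(2)[OF v]]) (use that in auto)
    then show ?thesis using set_lebesgue_integral_eq_integral(1) by blast
  qed
  have Kdiff: "K b - K a = integral {a..b} (\<lambda>t. norm (v t))" if "0 \<le> a" "a \<le> b" for a b
    using Henstock_Kurzweil_Integration.integral_combine[OF that nvi[of 0]] unfolding K_def by simp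
  have Kmono: "K a \<le> K b" if "0 \<le> a" "a \<le> b" for a b
    using Kdiff[OF that] integral_nonneg[OF nvi[OF that(1)], of b] by simp
  have est: "norm (u t - u s) \<le> K t - K s" if st: "s \<in> X" "t \<in> X" "s \<le> t" for s t
  proof -
    define d where "d = u t - u s"
    have s0: "0 \<le> s" using st by (simp add: X_def)
    have dS: "d \<in> closure S"
    proof -
      obtain a where a: "\<And>n. a n \<in> S0" "a \<longlonglongrightarrow> u t" using st(2) unfolding X_def closure_sequential by blast
      obtain b where b: "\<And>n. b n \<in> S0" "b \<longlonglongrightarrow> u s" using st(1) unfolding X_def closure_sequential by blast
      have "(\<lambda>n. a n - b n) \<longlonglongrightarrow> d" unfolding d_def by (intro tendsto_intros a b)
      moreover have "\<forall>n. a n - b n \<in> S" unfolding S_def using a b by force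
      ultimately show ?thesis unfolding closure_sequential by (intro exI[of _ "\<lambda>n. a n - b n"]) blast
    qed
    have yd: "\<bar>ip y d\<bar> \<le> norm y * (K t - K s)" if "y \<in> S" for y
    proof -
      have "integral {0..s} (\<lambda>r. ip y (v r)) + integral {s..t} (\<lambda>r. ip y (v r)) = integral {0..t} (\<lambda>r. ip y (v r))"
        using st(3) s0 ipi by (intro Henstock_Kurzweil_Integration.integral_combine) auto
      then have "ip y d = integral {s..t} (\<lambda>r. ip y (v r))"
        using st(1,2) that by (simp add: d_def ip_diff X_def)
      also have "norm \<dots> \<le> integral {s..t} (\<lambda>r. norm y * norm (v r))"
        using cauchy_schwarz[of y] s0
        by (intro integral_norm_bound_integral ipi integrable_on_mult_right nvi) auto
      finally show ?thesis using Kdiff[OF s0 st(3)] by simp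
    qed
    \<comment> \<open>Letting test vectors tend to \<open>d\<close> yields |d|^2 \<le> |d| (K t - K
      s), from which one factor |d| cancels.\<close>
    obtain y where y: "\<And>n. y n \<in> S" "y \<longlonglongrightarrow> d" using dS unfolding closure_sequential by blast
    have "(\<lambda>n. \<bar>ip d (y n)\<bar>) \<longlonglongrightarrow> \<bar>ip d d\<bar>"
      by (intro tendsto_rabs bounded_linear.tendsto[OF bounded_linear_ip] y)
    moreover have "(\<lambda>n. norm (y n) * (K t - K s)) \<longlonglongrightarrow> norm d * (K t - K s)"
      by (intro tendsto_intros y)
    ultimately have "\<bar>ip d d\<bar> \<le> norm d * (K t - K s)"
      by (rule LIMSEQ_le) (use yd y(1) ip_commute[of d] in auto)
    then have "norm d * norm d \<le> norm d * (K t - K s)" by (simp add: ip_norm power2_eq_square)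
    then show ?thesis using Kmono[OF s0 st(3)] by (cases "d = 0") (auto simp: d_def)
  qed
  define B where "B = integral {0..} (\<lambda>t. (norm (v t))\<^sup>2)"
  \<comment> \<open>Young's inequality |v| \<le> h |v|^2 + 1 / (4 h), integrated. The L2 bound makes
    \<open>K\<close> uniformly continuous on the whole half-line, as the extension from a dense set
    requires.\<close>
  have Kunif: "K t - K s \<le> h * B + (t - s) / (4 * h)" if "h > 0" "0 \<le> s" "s \<le> t" for h s t
  proof -
    have sq: "(\<lambda>t. (norm (v t))\<^sup>2) integrable_on {s..t}"
      by (rule integrable_on_subinterval[OF L2_halflineD(3)[OF v]]) (use that in auto)
    have "K t - K s = integral {s..t} (\<lambda>r. norm (v r))" by (rule Kdiff[OF that(2,3)])
    also have "\<dots> \<le> integral {s..t} (\<lambda>r. h * (norm (v r))\<^sup>2 + 1 / (4 * h))"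
    proof (rule integral_le[OF nvi[OF that(2)]])
      show "(\<lambda>r. h * (norm (v r))\<^sup>2 + 1 / (4 * h)) integrable_on {s..t}"
        by (intro Henstock_Kurzweil_Integration.integrable_add integrable_on_mult_right sq) auto
      fix r
      have "0 \<le> (2 * h * norm (v r) - 1)\<^sup>2 / (4 * h)" using that(1) by simp
      also have "\<dots> = h * (norm (v r))\<^sup>2 + 1 / (4 * h) - norm (v r)"
        using that(1) by (simp add: power2_eq_square field_simps)
      finally show "norm (v r) \<le> h * (norm (v r))\<^sup>2 + 1 / (4 * h)" by simp
    qed
    also have "\<dots> = h * integral {s..t} (\<lambda>r. (norm (v r))\<^sup>2) + (t - s) / (4 * h)"
      using that sq by (subst Henstock_Kurzweil_Integration.integral_add) (auto intro!: integrable_on_mult_right)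
    also have "integral {s..t} (\<lambda>r. (norm (v r))\<^sup>2) \<le> B"
      unfolding B_def using that by (intro integral_subset_le sq L2_halflineD(3)[OF v]) auto
    finally show ?thesis using that(1) by simp
  qed
  have "B \<ge> 0" unfolding B_def by (intro integral_nonneg L2_halflineD(3)[OF v]) simp
  have uc: "uniformly_continuous_on X u"
    unfolding uniformly_continuous_on_def
  proof (intro allI impI)
    fix e :: real assume e: "e > 0"
    \<comment> \<open>With this \<open>h\<close> the term h * B is below e / 2, and t - s < 2 * h *
      e makes the other term smaller than e / 2.\<close>
    define h where "h = e / (2 * (B + 1))"
    have h: "h > 0" using e \<open>B \<ge> 0\<close> by (simp add: h_def)
    have hB: "h * B < e / 2" using e \<open>B \<ge> 0\<close> by (simp add: h_def field_simps)
    have *: "norm (u t - u s) < e" if "s \<in> X" "t \<in> X" "s \<le> t" "t - s < 2 * h * e" for s t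
    proof -
      have "norm (u t - u s) \<le> h * B + (t - s) / (4 * h)"
        using est[OF that(1-3)] Kunif[OF h _ that(3)] that(1) by (auto simp: X_def)
      moreover have "(t - s) / (4 * h) < e / 2" using that(4) h by (simp add: field_simps)
      ultimately show ?thesis using hB by linarith
    qed
    show "\<exists>d>0. \<forall>x\<in>X. \<forall>x'\<in>X. dist x' x < d \<longrightarrow> dist (u x') (u x) < e"
    proof (intro exI[of _ "2 * h * e"] conjI ballI impI)
      fix x x' assume "x \<in> X" "x' \<in> X" "dist x' x < 2 * h * e"
      then show "dist (u x') (u x) < e"
        using *[of x x'] *[of x' x] by (cases "x \<le> x'") (auto simp: dist_norm norm_minus_commute)
    qed (use h e in auto)
  qed
  obtain U where U: "uniformly_continuous_on {0..} U" "\<And>t. t \<in> X \<Longrightarrow> u t = U t"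
    by (rule uniformly_continuous_on_extension_on_closure[OF uc, unfolded closX]) blast
  have cU: "continuous_on {0..} U" using U(1) by (rule uniformly_continuous_imp_continuous)
  have AEU: "AE t in lebesgue. t \<ge> 0 \<longrightarrow> u t = U t"
    using X by eventually_elim (use U(2) in auto)
  have cK: "continuous_on {0..} K"
    unfolding continuous_on_iff
  proof (intro ballI allI impI)
    fix x e :: real assume x: "x \<in> {0..}" and e: "e > 0"
    have "continuous_on {0..x + 1} K" unfolding K_def by (rule indefinite_integral_continuous_1[OF nvi]) simp
    then obtain d where d: "d > 0" "\<And>y. y \<in> {0..x + 1} \<Longrightarrow> dist y x < d \<Longrightarrow> dist (K y) (K x) < e"
      using x e unfolding continuous_on_iff by (metis atLeastAtMost_iff atLeast_iff le_add_same_cancel1 zero_le_one)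
    then show "\<exists>d>0. \<forall>x'\<in>{0..}. dist x' x < d \<longrightarrow> dist (K x') (K x) < e"
      by (intro exI[of _ "min d 1"]) (auto simp: dist_real_def)
  qed
  have UK: "norm (U b - U a) \<le> K b - K a" if ab: "0 \<le> a" "a \<le> b" for a b
  proof -
    \<comment> \<open>The absolute value makes the estimate symmetric, so it can be extended by
      density from all of X \<times> X without tracking the order of the two times.\<close>
    have "0 \<le> \<bar>K (snd (a, b)) - K (fst (a, b))\<bar> - norm (U (snd (a, b)) - U (fst (a, b)))"
    proof (rule continuous_ge_on_closure[where S = "X \<times> X" and f = "\<lambda>p. \<bar>K (snd p) - K (fst p)\<bar> - norm (U (snd p) - U (fst p))"])
      show "continuous_on (closure (X \<times> X)) (\<lambda>p. \<bar>K (snd p) - K (fst p)\<bar> - norm (U (snd p) - U (fst p)))"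
        unfolding closure_Times closX
        by (intro continuous_intros continuous_on_compose2[OF cK] continuous_on_compose2[OF cU]) auto
      show "(a, b) \<in> closure (X \<times> X)" unfolding closure_Times closX using ab by simp
      fix p assume "p \<in> X \<times> X"
      then have p: "fst p \<in> X" "snd p \<in> X" by auto
      then show "0 \<le> \<bar>K (snd p) - K (fst p)\<bar> - norm (U (snd p) - U (fst p))"
        using est[OF p] est[OF p(2,1)] U(2)[OF p(1)] U(2)[OF p(2)]
        by (cases "fst p \<le> snd p") (auto simp: norm_minus_commute)
    qed
    then show ?thesis using Kmono[OF ab] by simp
  qed
  have ipU: "ip y (U t) - ip y (U 0) = integral {0..t} (\<lambda>s. ip y (v s))" if t: "t \<ge> 0" for y t
  proof -
    \<comment> \<open>\<open>D\<close> is continuous and almost everywhere equal to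
      \<open>c y\<close>, hence equal to it everywhere; comparing \<open>t\<close> with 0 eliminates
      the unknown constant.\<close>
    define D where "D t = ip y (U t) - integral {0..t} (\<lambda>s. ip y (v s))" for t
    have cD: "continuous_on {0..x} D" for x
      unfolding D_def
      by (intro continuous_on_diff bounded_linear.continuous_on[OF bounded_linear_ip] continuous_on_subset[OF cU]
          indefinite_integral_continuous_1 ipi) auto
    have AED: "AE t in lebesgue. t \<ge> 0 \<longrightarrow> D t = c y"
      using AEU c[of y] by eventually_elim (auto simp: D_def)
    have "D s = c y" if "s \<in> {0..t + 1}" for s
    proof -
      have cl: "closed {x \<in> {0..t + 1}. D x = c y}"
        by (rule continuous_closed_preimage_constant[OF cD]) simp
      have "x \<in> {x \<in> {0..t + 1}. D x = c y}" if "x \<in> {0<..<t + 1}" for x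
      proof (rule mem_closed_if_AE_lebesgue_open[OF _ cl _ that])
        show "AE x\<in>{0<..<t + 1} in lebesgue. x \<in> {x \<in> {0..t + 1}. D x = c y}"
          using AED by eventually_elim auto
      qed simp
      then have "closure {0<..<t + 1} \<subseteq> {x \<in> {0..t + 1}. D x = c y}"
        by (intro closure_minimal cl) auto
      then show ?thesis using \<open>s \<in> _\<close> t by auto
    qed
    from this[of t] this[of 0] t show ?thesis by (simp add: D_def)
  qed
  show thesis
    by (rule that[OF cU AEU _ ipU]) (use UK in \<open>simp_all add: K_def\<close>)
qed

lemma weak_derivative_cong_AE:
  assumes "AE t in lebesgue. t \<ge> 0 \<longrightarrow> g t = h t" "weak_derivative j f g"
  shows "weak_derivative j f h"
  unfolding weak_derivative_def
proof (intro allI impI)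
  fix \<phi> assume "test_function \<phi>"
  then obtain I where I: "has_strong_integral (lebesgue_on {0..}) (\<lambda>t. (deriv ^^ j) \<phi> t *\<^sub>R f t) I"
    "has_strong_integral (lebesgue_on {0..}) (\<lambda>t. \<phi> t *\<^sub>R g t) ((-1) ^ j *\<^sub>R I)"
    using assms(2) unfolding weak_derivative_def by blast
  have "AE t in lebesgue_on {0..}. g t = h t"
    using assms(1) by (subst AE_restrict_space_iff) auto
  then have "AE t in lebesgue_on {0..}. \<phi> t *\<^sub>R g t = \<phi> t *\<^sub>R h t" by eventually_elim simp
  from has_strong_integral_cong_AE[OF this I(2)] I(1)
  show "\<exists>I. has_strong_integral (lebesgue_on {0..}) (\<lambda>t. (deriv ^^ j) \<phi> t *\<^sub>R f t) I \<and>
      has_strong_integral (lebesgue_on {0..}) (\<lambda>t. \<phi> t *\<^sub>R h t) ((-1) ^ j *\<^sub>R I)" by blast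
qed

text \<open>A weak derivative of order q + 1 in L2 makes those up to order q continuous. The top
  derivative survives only through \<open>K\<close>, the primitive of its norm, which dominates the
  variation of \<open>U q\<close>.\<close>

theorem Sobolev_representatives:
  fixes f :: "real \<Rightarrow> 'w"
  assumes f: "f \<in> Sobolev_halfline (Suc q)"
  obtains U K where
    "\<And>j. j \<le> q \<Longrightarrow> continuous_on {0..} (U j)"
    "\<And>j. j \<le> q \<Longrightarrow> initial_derivative j f = U j 0"
    "AE t in lebesgue_on {0..}. U 0 t = f t"
    "\<And>j t. j < q \<Longrightarrow> t \<ge> 0 \<Longrightarrow> U j t = U j 0 + integral {0..t} (U (Suc j))"
    "\<And>a b. 0 \<le> a \<Longrightarrow> a \<le> b \<Longrightarrow> norm (U q b - U q a) \<le> K b - K a"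
proof -
  \<comment> \<open>For order 0 the function \<open>f\<close> itself is selected, so that
    \<open>U 0\<close> represents \<open>f\<close> and not just some weak derivative of order
    0.\<close>
  have "\<forall>j. \<exists>g. j \<le> Suc q \<longrightarrow> g \<in> L2_halfline \<and> weak_derivative j f g \<and> (j = 0 \<longrightarrow> g = f)"
  proof
    fix j
    show "\<exists>g. j \<le> Suc q \<longrightarrow> g \<in> L2_halfline \<and> weak_derivative j f g \<and> (j = 0 \<longrightarrow> g = f)"
    proof (cases "j = 0")
      case True
      obtain g where "weak_derivative 0 f g" using f unfolding Sobolev_halfline_def by blast
      then have "weak_derivative 0 f f" unfolding weak_derivative_def by fastforce
      moreover have "f \<in> L2_halfline" using f unfolding Sobolev_halfline_def by blast
      ultimately show ?thesis using True by blast
    next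
      case False
      then show ?thesis using f unfolding Sobolev_halfline_def by blast
    qed
  qed
  then obtain g where g: "\<And>j. j \<le> Suc q \<Longrightarrow> g j \<in> L2_halfline"
    "\<And>j. j \<le> Suc q \<Longrightarrow> weak_derivative j f (g j)" "g 0 = f" by (metis le0)
  define P where "P j U \<longleftrightarrow> continuous_on {0..} U \<and> (AE t in lebesgue. t \<ge> 0 \<longrightarrow> g j t = U t) \<and>
      (\<forall>a b. 0 \<le> a \<longrightarrow> a \<le> b \<longrightarrow> norm (U b - U a) \<le> integral {0..b} (\<lambda>t. norm (g (Suc j) t)) - integral {0..a} (\<lambda>t. norm (g (Suc j) t))) \<and>
      (\<forall>y t. t \<ge> 0 \<longrightarrow> ip y (U t) - ip y (U 0) = integral {0..t} (\<lambda>s. ip y (g (Suc j) s)))" for j U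
  have "\<exists>U. P j U" if j: "j \<le> q" for j
  proof -
    have js: "j \<le> Suc q" "Suc j \<le> Suc q" using j by auto
    show ?thesis unfolding P_def
      by (rule continuous_representative[OF g(1)[OF js(1)] g(1)[OF js(2)]
            weak_derivative_consecutive[OF g(2)[OF js(1)] g(2)[OF js(2)]]]) blast+
  qed
  then have "\<forall>j. \<exists>U. j \<le> q \<longrightarrow> P j U" by blast
  then obtain U where "\<forall>j. j \<le> q \<longrightarrow> P j (U j)" by (rule choice[THEN exE])
  then have U: "continuous_on {0..} (U j)" "AE t in lebesgue. t \<ge> 0 \<longrightarrow> g j t = U j t"
    "0 \<le> a \<Longrightarrow> a \<le> b \<Longrightarrow> norm (U j b - U j a) \<le> integral {0..b} (\<lambda>t. norm (g (Suc j) t)) - integral {0..a} (\<lambda>t. norm (g (Suc j) t))"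
    "t \<ge> 0 \<Longrightarrow> ip y (U j t) - ip y (U j 0) = integral {0..t} (\<lambda>s. ip y (g (Suc j) s))"
    if "j \<le> q" for j a b y t
    using that unfolding P_def by blast+
  have wU: "weak_derivative j f (U j)" if "j \<le> q" for j
    by (rule weak_derivative_cong_AE[OF U(2)[OF that] g(2)]) (use that in simp)
  show thesis
  proof
    show "continuous_on {0..} (U j)" if "j \<le> q" for j by (rule U(1)[OF that])
    show "initial_derivative j f = U j 0" if j: "j \<le> q" for j
      unfolding initial_derivative_def
    proof (rule the_equality)
      show "\<exists>g. continuous_on {0..} g \<and> weak_derivative j f g \<and> g 0 = U j 0"
        using U(1)[OF j] wU[OF j] by blast
      show "v = U j 0" if "\<exists>g. continuous_on {0..} g \<and> weak_derivative j f g \<and> g 0 = v" for v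
        using that weak_derivative_continuous_unique[OF _ _ wU[OF j] U(1)[OF j], of _ 0] by auto
    qed
    have "AE t in lebesgue. t \<in> {0..} \<longrightarrow> U 0 t = f t"
      using U(2)[of 0] by (auto simp: g(3) elim!: eventually_mono)
    then show "AE t in lebesgue_on {0..}. U 0 t = f t" by (subst AE_restrict_space_iff) auto
    show "U j t = U j 0 + integral {0..t} (U (Suc j))" if j: "j < q" and t: "t \<ge> 0" for j t
    proof (rule ip_eqI)
      fix y
      have "ip y (U j t) - ip y (U j 0) = integral {0..t} (\<lambda>s. ip y (g (Suc j) s))"
        using U(4)[of j t y] j t by simp
      also have "\<dots> = integral {0..t} (\<lambda>s. ip y (U (Suc j) s))"
      proof (rule integral_cong_AE_lebesgue)
        have "AE s in lebesgue. s \<ge> 0 \<longrightarrow> g (Suc j) s = U (Suc j) s" by (rule U(2)) (use j in simp)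
        then show "AE s in lebesgue. s \<in> {0..t} \<longrightarrow> ip y (g (Suc j) s) = ip y (U (Suc j) s)"
          by eventually_elim auto
      qed
      also have "\<dots> = ip y (integral {0..t} (U (Suc j)))"
        by (rule ip_integral, rule continuous_on_subset[OF U(1)]) (use j in auto)
      finally show "ip y (U j t) = ip y (U j 0 + integral {0..t} (U (Suc j)))" by (simp add: ip_add)
    qed
    show "norm (U q b - U q a) \<le> integral {0..b} (\<lambda>t. norm (g (Suc q) t)) - integral {0..a} (\<lambda>t. norm (g (Suc q) t))"
      if "0 \<le> a" "a \<le> b" for a b by (rule U(3)[OF order_refl that])
  qed
qed

end

section \<open>The pencil on the extrapolation space\<close>

lemma bounded_clinearI:
  assumes "\<And>x y. f (x + y) = f x + f y" "\<And>c x. f (c *\<^sub>C x) = c *\<^sub>C f x"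
    "\<And>x. norm (f x) \<le> K * norm x"
  shows "bounded_clinear f"
  unfolding bounded_clinear_def
proof (intro conjI allI assms(2) bounded_linear_intro[where K = K])
  show "f (k *\<^sub>R x) = k *\<^sub>R f x" for k x
    using assms(2)[of "of_real k" x] by (simp add: scaleC_of_real)
  show "norm (f x) \<le> norm x * K" for x
    using assms(3)[of x] by (simp add: mult.commute)
qed (rule assms(1))

lemma bounded_clinear_scaleC_left: "bounded_clinear f \<Longrightarrow> bounded_clinear (\<lambda>x. c *\<^sub>C f x)"
  unfolding bounded_clinear_def
  by (simp add: bounded_linear_compose[OF scaleC.bounded_linear_right] scaleC_scaleC mult.commute)

lemma bounded_clinear_diff: "bounded_clinear f \<Longrightarrow> bounded_clinear g \<Longrightarrow> bounded_clinear (\<lambda>x. f x - g x)"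
  unfolding bounded_clinear_def by (simp add: bounded_linear_sub scaleC.diff_right)

lemma bounded_clinear_compose:
  "bounded_clinear f \<Longrightarrow> bounded_clinear g \<Longrightarrow> bounded_clinear (\<lambda>x. f (g x))"
  unfolding bounded_clinear_def by (simp add: bounded_linear_compose)

text \<open>Density of the domain thus settles the definite description in
  \<open>bounded_extension\<close>.\<close>

lemma bounded_clinear_unique:
  assumes "bounded_clinear f" "bounded_clinear g" "closure D = UNIV" "\<And>x. x \<in> D \<Longrightarrow> f x = g x"
  shows "f = g"
proof
  fix x
  have "f x - g x = 0"
  proof (rule continuous_constant_on_closure[of D])
    show "continuous_on (closure D) (\<lambda>x. f x - g x)"
        by (intro continuous_on_diff bounded_linear.continuous_on[OF bounded_clinear_bounded_linear[OF assms(1)]]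
          bounded_linear.continuous_on[OF bounded_clinear_bounded_linear[OF assms(2)]] continuous_on_id)
  qed (use assms in auto)
  then show "f x = g x" by simp
qed

lemma clinear_onD:
  assumes "clinear_on D A" "x \<in> D"
  shows "y \<in> D \<Longrightarrow> x + y \<in> D" "c *\<^sub>C x \<in> D" "y \<in> D \<Longrightarrow> A (x + y) = A x + A y"
    "A (c *\<^sub>C x) = c *\<^sub>C A x"
  using assms unfolding clinear_on_def by blast+

lemma clinear_on_UNIV_simps:
  assumes "clinear_on UNIV f"
  shows "f (x + y) = f x + f y" "f (c *\<^sub>C x) = c *\<^sub>C f x" "f (x - y) = f x - f y" "f 0 = 0"
proof -
  show add: "f (x + y) = f x + f y" and sc: "f (c *\<^sub>C x) = c *\<^sub>C f x" for x y c
    using assms unfolding clinear_on_def by blast+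
  show "f (x - y) = f x - f y" using add[of "x - y" y] by simp
  show "f 0 = 0" using add[of 0 0] by simp
qed

lemma isometric_extension:
  fixes T :: "'x::complex_normed_vector \<Rightarrow> 'w::complex_banach"
  assumes T: "clinear_on D T" and iso: "\<And>x. x \<in> D \<Longrightarrow> norm (T x) = norm x" and dense: "closure D = UNIV"
  obtains S where "bounded_clinear S" "\<And>x. x \<in> D \<Longrightarrow> S x = T x" "\<And>x. norm (S x) = norm x"
proof -
  have diff: "x - y \<in> D" "T (x - y) = T x - T y" if "x \<in> D" "y \<in> D" for x y
    using clinear_onD(1,3)[OF T that(1) clinear_onD(2)[OF T that(2), of "- 1"]] clinear_onD(4)[OF T that(2), of "- 1"]
    by (simp_all add: scaleC.minus_left)
  have "uniformly_continuous_on D T"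
    unfolding uniformly_continuous_on_def by (metis diff dist_norm iso)
  then obtain S where S: "uniformly_continuous_on (closure D) S" "\<And>x. x \<in> D \<Longrightarrow> T x = S x"
    by (rule uniformly_continuous_on_extension_on_closure) blast
  have contS: "continuous_on UNIV S" using S(1) dense uniformly_continuous_imp_continuous by metis
  have seq: "\<exists>u. (\<forall>n. u n \<in> D) \<and> u \<longlonglongrightarrow> x" for x
    using dense closure_sequential[of x D] by simp
  have lim: "(\<lambda>n. S (u n)) \<longlonglongrightarrow> S x" if "u \<longlonglongrightarrow> x" for u x
    using contS that by (metis UNIV_I continuous_on_tendsto_compose eventually_sequentiallyI)
  show thesis
  proof
    show norm: "norm (S x) = norm x" for x
    proof -
      obtain u where u: "\<And>n. u n \<in> D" "u \<longlonglongrightarrow> x" using seq by blast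
      have "(\<lambda>n. norm (S (u n))) \<longlonglongrightarrow> norm (S x)" by (intro tendsto_intros lim u)
      moreover have "(\<lambda>n. norm (S (u n))) \<longlonglongrightarrow> norm x"
        using tendsto_norm[OF u(2)] S(2) iso u(1) by (simp flip: S(2))
      ultimately show ?thesis by (rule LIMSEQ_unique)
    qed
    show "bounded_clinear S"
    proof (rule bounded_clinearI[where K = 1])
      fix x y c
      obtain u where u: "\<And>n. u n \<in> D" "u \<longlonglongrightarrow> x" using seq by blast
      obtain v where v: "\<And>n. v n \<in> D" "v \<longlonglongrightarrow> y" using seq by blast
      have "(\<lambda>n. S (u n + v n)) \<longlonglongrightarrow> S (x + y)" by (intro lim tendsto_intros u v)
      moreover have "(\<lambda>n. S (u n + v n)) \<longlonglongrightarrow> S x + S y"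
      proof -
        have "S (u n + v n) = S (u n) + S (v n)" for n
          using clinear_onD(1,3)[OF T u(1) v(1)] u(1) v(1) by (simp flip: S(2))
        then show ?thesis using tendsto_add[OF lim[OF u(2)] lim[OF v(2)]] by simp
      qed
      ultimately show "S (x + y) = S x + S y" by (rule LIMSEQ_unique)
      have "(\<lambda>n. S (c *\<^sub>C u n)) \<longlonglongrightarrow> S (c *\<^sub>C x)" by (intro lim tendsto_intros u)
      moreover have "(\<lambda>n. S (c *\<^sub>C u n)) \<longlonglongrightarrow> c *\<^sub>C S x"
      proof -
        have "S (c *\<^sub>C u n) = c *\<^sub>C S (u n)" for n
          using clinear_onD(2,4)[OF T u(1)] u(1) by (simp flip: S(2))
        then show ?thesis using tendsto_scaleC[OF tendsto_const[of c] lim[OF u(2)]] by simp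
      qed
      ultimately show "S (c *\<^sub>C x) = c *\<^sub>C S x" by (rule LIMSEQ_unique)
    qed (simp add: norm)
  qed (simp add: S)
qed

locale extrapolated_pencil =
  fixes E :: "'x::complex_banach \<Rightarrow> 'z::complex_normed_vector" and D :: "'x set" and A :: "'x \<Rightarrow> 'z"
    and \<mu> :: complex and \<iota> :: "'z \<Rightarrow> 'w::complex_banach"
  assumes E: "bounded_clinear E"
    and A: "closed_densely_defined D A"
    and \<mu>: "\<mu> \<in> pencil_resolvent_set E D A"
    and \<iota>: "is_extrapolation_space E D A \<mu> \<iota>"
begin

lemma clin_A: "clinear_on D A" and dense: "closure D = UNIV"
  using A unfolding closed_densely_defined_def by auto

lemma clin_\<iota>: "clinear_on UNIV \<iota>" and dense_\<iota>: "closure (range \<iota>) = UNIV"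
  and norm_\<iota>: "norm (\<iota> z) = norm (pencil_resolvent E D A \<mu> z)"
  using \<iota> unfolding is_extrapolation_space_def by auto

lemma resolvent:
  assumes "\<zeta> \<in> pencil_resolvent_set E D A"
  shows "bounded_clinear (pencil_resolvent E D A \<zeta>)"
    "pencil_resolvent E D A \<zeta> z \<in> D"
    "\<zeta> *\<^sub>C E (pencil_resolvent E D A \<zeta> z) - A (pencil_resolvent E D A \<zeta> z) = z"
    "x \<in> D \<Longrightarrow> pencil_resolvent E D A \<zeta> (\<zeta> *\<^sub>C E x - A x) = x"
proof -
  have bij: "bij_betw (\<lambda>x. \<zeta> *\<^sub>C E x - A x) D UNIV"
    and 1: "bounded_clinear (pencil_resolvent E D A \<zeta>)"
    using assms unfolding pencil_resolvent_set_def by auto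
  show "bounded_clinear (pencil_resolvent E D A \<zeta>)" by (rule 1)
  show "pencil_resolvent E D A \<zeta> z \<in> D"
    using bij unfolding pencil_resolvent_def by (metis UNIV_I bij_betw_imp_surj_on inv_into_into)
  show "\<zeta> *\<^sub>C E (pencil_resolvent E D A \<zeta> z) - A (pencil_resolvent E D A \<zeta> z) = z"
    using bij unfolding pencil_resolvent_def by (simp add: bij_betw_def f_inv_into_f[where f = "\<lambda>x. \<zeta> *\<^sub>C E x - A x"])
  show "x \<in> D \<Longrightarrow> pencil_resolvent E D A \<zeta> (\<zeta> *\<^sub>C E x - A x) = x"
    using bij unfolding pencil_resolvent_def by (simp add: bij_betw_def inv_into_f_f[where f = "\<lambda>x. \<zeta> *\<^sub>C E x - A x"])
qed

lemma bounded_clinear_\<iota>: "bounded_clinear \<iota>"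
proof -
  have "bounded_linear (pencil_resolvent E D A \<mu>)"
    using resolvent(1)[OF \<mu>] by (rule bounded_clinear_bounded_linear)
  then obtain K where "\<And>z. norm (pencil_resolvent E D A \<mu> z) \<le> norm z * K"
    using bounded_linear.bounded by blast
  then show ?thesis
    using norm_\<iota> by (intro bounded_clinearI[where K = K] clinear_on_UNIV_simps[OF clin_\<iota>]) (simp add: mult.commute)
qed

text \<open>The resolvent at \<mu> is injective and the norm of \<open>\<iota> z\<close> is computed
  through it; equations between embedded vectors can therefore be read in the original
  space.\<close>

lemma \<iota>_eq_0_iff: "\<iota> z = 0 \<longleftrightarrow> z = 0"
proof
  assume "\<iota> z = 0"
  then have "pencil_resolvent E D A \<mu> z = 0" using norm_\<iota>[of z] by simp
  with resolvent(3)[OF \<mu>, of z] clin_A show "z = 0"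
    by (metis bounded_clinear_simps(3)[OF E] clinear_onD(4) clinear_on_def diff_self scaleC_simps)
qed (simp add: clinear_on_UNIV_simps(4)[OF clin_\<iota>])

text \<open>\<open>\<mu> E - A\<^sub>-\<^sub>1\<close> is an isometry of \<open>X\<close> onto \<open>Z\<^sub>-\<^sub>1\<close>; its inverse provides the Hilbert space
  structure of \<open>Z\<^sub>-\<^sub>1\<close>.\<close>

lemma extension_isometry:
  obtains J where "bounded_clinear J" "\<And>w. norm (J w) = norm w"
    "\<And>w. \<mu> *\<^sub>C \<iota> (E (J w)) - bounded_extension D A \<iota> (J w) = w"
    "\<And>x. J (\<mu> *\<^sub>C \<iota> (E x) - bounded_extension D A \<iota> x) = x"
    "bounded_clinear (bounded_extension D A \<iota>)"
    "\<And>x. x \<in> D \<Longrightarrow> bounded_extension D A \<iota> x = \<iota> (A x)"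
proof -
  note io = clinear_on_UNIV_simps[OF clin_\<iota>] and es = bounded_clinear_simps[OF E]
  obtain T where T: "bounded_clinear T" "\<And>x. x \<in> D \<Longrightarrow> T x = \<iota> (\<mu> *\<^sub>C E x - A x)" "\<And>x. norm (T x) = norm x"
  proof (rule isometric_extension)
    show "clinear_on D (\<lambda>x. \<iota> (\<mu> *\<^sub>C E x - A x))"
      using clin_A unfolding clinear_on_def
      by (auto simp: io es scaleC.diff_right scaleC_add_right scaleC_scaleC mult.commute)
    show "norm (\<iota> (\<mu> *\<^sub>C E x - A x)) = norm x" if "x \<in> D" for x
      using norm_\<iota> resolvent(4)[OF \<mu> that] by simp
  qed (use dense in auto)
  note ts = bounded_clinear_simps[OF T(1)]
  have inj: "inj T"
    by (rule injI) (metis T(3) eq_iff_diff_eq_0 norm_eq_zero ts(2))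
  \<comment> \<open>An isometric image of a complete space is closed; as it contains the dense range
    of \<open>\<iota>\<close>, the isometry is onto.\<close>
  have "closed (range T)"
  proof (rule complete_imp_closed, rule complete_isometric_image[where e = 1])
    show "complete (UNIV::'x set)" by (rule complete_UNIV)
  qed (auto simp: T(3) bounded_clinear_bounded_linear[OF T(1)])
  moreover have "range \<iota> \<subseteq> range T"
  proof
    fix w assume "w \<in> range \<iota>"
    then obtain z where "w = \<iota> z" by auto
    then have "w = T (pencil_resolvent E D A \<mu> z)"
      using resolvent(2,3)[OF \<mu>, of z] by (simp add: T(2))
    then show "w \<in> range T" by auto
  qed
  ultimately have surj: "range T = UNIV" using dense_\<iota> closure_minimal by blast
  define J where "J = inv T"
  have TJ: "T (J w) = w" for w unfolding J_def by (rule f_inv_into_f) (simp add: surj)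
  have JT: "J (T x) = x" for x unfolding J_def by (rule inv_f_f[OF inj])
  have Jn: "norm (J w) = norm w" for w using T(3)[of "J w"] TJ by simp
  have J: "bounded_clinear J"
  proof (rule bounded_clinearI[where K = 1])
    show "J (x + y) = J x + J y" for x y by (metis JT TJ ts(1))
    show "J (c *\<^sub>C x) = c *\<^sub>C J x" for c x by (metis JT TJ ts(5))
  qed (simp add: Jn)
  \<comment> \<open>On \<open>D\<close> the isometry is the embedded \<mu> E - A, so subtracting it
    from the embedded \<mu> E leaves an extension of A.\<close>
  define B where "B x = \<mu> *\<^sub>C \<iota> (E x) - T x" for x
  have B: "bounded_clinear B"
    unfolding B_def by (intro bounded_clinear_diff bounded_clinear_scaleC_left T(1)
        bounded_clinear_compose[OF bounded_clinear_\<iota> E])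
  have BA: "B x = \<iota> (A x)" if "x \<in> D" for x
    using that by (simp add: B_def T(2) io)
  have "bounded_extension D A \<iota> = B"
    unfolding bounded_extension_def
    by (rule the_equality) (auto simp: B BA intro!: bounded_clinear_unique[OF _ B dense])
  then show thesis
    by (intro that[of J]) (simp_all add: J Jn B BA, simp_all add: B_def TJ JT)
qed

text \<open>Since \<open>(\<zeta> E - A\<^sub>-\<^sub>1)\<^sup>-\<^sup>1 = (I - (\<zeta> - \<mu>) (\<zeta> E - A)\<^sup>-\<^sup>1 E) (\<mu> E - A\<^sub>-\<^sub>1)\<^sup>-\<^sup>1\<close>, the extended pencil loses at
  most one power of growth.\<close>

lemma extended_resolvent:
  assumes \<zeta>: "\<zeta> \<in> pencil_resolvent_set E D A"
  defines "B \<equiv> bounded_extension D A \<iota>"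
  shows "\<zeta> \<in> pencil_resolvent_set (\<iota> \<circ> E) UNIV B"
    and "onorm (pencil_resolvent (\<iota> \<circ> E) UNIV B \<zeta>)
      \<le> 1 + cmod (\<zeta> - \<mu>) * (onorm (pencil_resolvent E D A \<zeta>) * onorm E)"
proof -
  obtain J where J: "bounded_clinear J" "\<And>w. norm (J w) = norm w"
    "\<And>w. \<mu> *\<^sub>C \<iota> (E (J w)) - B (J w) = w"
    "\<And>x. J (\<mu> *\<^sub>C \<iota> (E x) - B x) = x"
    and B: "bounded_clinear B" "\<And>x. x \<in> D \<Longrightarrow> B x = \<iota> (A x)"
    unfolding B_def by (rule extension_isometry) blast
  note io = clinear_on_UNIV_simps[OF clin_\<iota>] and es = bounded_clinear_simps[OF E]
    and bs = bounded_clinear_simps[OF B(1)]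
  let ?R = "pencil_resolvent E D A \<zeta>"
  let ?P = "\<lambda>x. \<zeta> *\<^sub>C \<iota> (E x) - B x"
  define N where "N w = J w - (\<zeta> - \<mu>) *\<^sub>C ?R (E (J w))" for w
  have P_D: "?P d = \<iota> (\<zeta> *\<^sub>C E d - A d)" if "d \<in> D" for d
    using that by (simp add: B io)
  have P_N: "?P (N w) = w" for w
  proof -
    have "?P (N w) = ?P (J w) - (\<zeta> - \<mu>) *\<^sub>C ?P (?R (E (J w)))"
      unfolding N_def by (simp add: es io bs scaleC.diff_right scaleC_scaleC mult.commute)
    also have "?P (?R (E (J w))) = \<iota> (E (J w))"
      using resolvent(2,3)[OF \<zeta>] P_D by simp
    also have "?P (J w) - (\<zeta> - \<mu>) *\<^sub>C \<iota> (E (J w)) = \<mu> *\<^sub>C \<iota> (E (J w)) - B (J w)"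
      by (simp add: scaleC.diff_left)
    finally show ?thesis by (simp add: J)
  qed
  have P_diff: "?P (x - y) = ?P x - ?P y" for x y by (simp add: es io bs scaleC.diff_right)
  have P_inj: "x = 0" if "?P x = 0" for x
  proof -
    \<comment> \<open>For x in the kernel, the extended \<mu> E - A maps x to (\<mu> - \<zeta>) E x,
      which lies in the original space. Hence x = d lies in \<open>D\<close>, where \<zeta> E - A is
      injective.\<close>
    define d where "d = - (\<zeta> - \<mu>) *\<^sub>C pencil_resolvent E D A \<mu> (E x)"
    have d: "d \<in> D" unfolding d_def by (intro clinear_onD(2)[OF clin_A] resolvent \<mu>)
    have "\<mu> *\<^sub>C \<iota> (E d) - B d = - (\<zeta> - \<mu>) *\<^sub>C (\<mu> *\<^sub>C \<iota> (E (pencil_resolvent E D A \<mu> (E x))) - B (pencil_resolvent E D A \<mu> (E x)))"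
      unfolding d_def by (simp only: es io bs scaleC.diff_right scaleC_scaleC mult.commute)
    also have "\<mu> *\<^sub>C \<iota> (E (pencil_resolvent E D A \<mu> (E x))) - B (pencil_resolvent E D A \<mu> (E x)) = \<iota> (E x)"
      using resolvent(2,3)[OF \<mu>, of "E x"] by (simp add: B flip: io)
    also have "- (\<zeta> - \<mu>) *\<^sub>C \<iota> (E x) = \<mu> *\<^sub>C \<iota> (E x) - B x"
      using that by (simp add: scaleC.minus_left scaleC.diff_left algebra_simps)
    finally have "x = d" using J(4) by metis
    then have "\<iota> (\<zeta> *\<^sub>C E x - A x) = 0" using that P_D d by simp
    then have "\<zeta> *\<^sub>C E x - A x = 0" by (simp add: \<iota>_eq_0_iff)
    then show "x = 0" using resolvent(1,4)[OF \<zeta>] \<open>x = d\<close> d bounded_clinear_simps(3) by metis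
  qed
  have N_P: "N (?P x) = x" for x
    using P_inj[of "N (?P x) - x"] P_N[of "?P x"] P_diff by simp
  have N: "bounded_clinear N"
    unfolding N_def by (intro bounded_clinear_diff bounded_clinear_scaleC_left J(1)
        bounded_clinear_compose[OF resolvent(1)[OF \<zeta>]] bounded_clinear_compose[OF E])
  have bij: "bij ?P" by (rule bij_betw_byWitness[where f' = N]) (auto simp: P_N N_P)
  have eq: "pencil_resolvent (\<iota> \<circ> E) UNIV B \<zeta> = N"
    unfolding pencil_resolvent_def
  proof
    fix w show "inv_into UNIV (\<lambda>x. \<zeta> *\<^sub>C (\<iota> \<circ> E) x - B x) w = N w"
      using bij P_N by (simp add: bij_def inv_f_eq)
  qed
  show "\<zeta> \<in> pencil_resolvent_set (\<iota> \<circ> E) UNIV B"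
    unfolding pencil_resolvent_set_def using bij N by (simp add: eq)
  have on: "norm (?R z) \<le> onorm ?R * norm z" "norm (E x) \<le> onorm E * norm x" for z x
    by (intro onorm bounded_clinear_bounded_linear resolvent(1)[OF \<zeta>] E)+
  have pos: "0 \<le> onorm ?R" "0 \<le> onorm E"
    by (intro onorm_pos_le bounded_clinear_bounded_linear resolvent(1)[OF \<zeta>] E)+
  show "onorm (pencil_resolvent (\<iota> \<circ> E) UNIV B \<zeta>) \<le> 1 + cmod (\<zeta> - \<mu>) * (onorm ?R * onorm E)"
    unfolding eq
  proof (rule onorm_bound)
    show "0 \<le> 1 + cmod (\<zeta> - \<mu>) * (onorm ?R * onorm E)" using pos by simp
    fix w
    have "norm (N w) \<le> norm (J w) + cmod (\<zeta> - \<mu>) * norm (?R (E (J w)))"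
      unfolding N_def by (rule order_trans[OF norm_triangle_ineq4]) (simp add: norm_scaleC)
    also have "\<dots> \<le> norm (J w) + cmod (\<zeta> - \<mu>) * (onorm ?R * (onorm E * norm w))"
    proof (intro add_left_mono mult_left_mono)
      show "norm (?R (E (J w))) \<le> onorm ?R * (onorm E * norm w)"
        by (rule order_trans[OF on(1) mult_left_mono[OF _ pos(1)]]) (use on(2)[of "J w"] J(2) in simp)
    qed simp
    finally show "norm (N w) \<le> (1 + cmod (\<zeta> - \<mu>) * (onorm ?R * onorm E)) * norm w"
      by (simp add: J(2) algebra_simps)
  qed
qed

text \<open>Ensures that the least element defining the index of the extended pencil is attained, so
  that its growth bound can be used.\<close>

lemma resolvent_growth_extended:
  assumes "resolvent_growth E D A q"
  shows "resolvent_growth (\<iota> \<circ> E) UNIV (bounded_extension D A \<iota>) (q + 1)"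
proof -
  obtain \<omega> C where C: "C > 0" "\<And>\<zeta>. Re \<zeta> > \<omega> \<Longrightarrow> \<zeta> \<in> pencil_resolvent_set E D A"
    "\<And>\<zeta>. Re \<zeta> > \<omega> \<Longrightarrow> onorm (pencil_resolvent E D A \<zeta>) \<le> C * cmod \<zeta> powi (int q - 1)"
    using assms unfolding resolvent_growth_def by blast
  have eE: "0 \<le> onorm E" by (intro onorm_pos_le bounded_clinear_bounded_linear E)
  define C' where "C' = 1 + (1 + cmod \<mu>) * (C * onorm E)"
  show ?thesis unfolding resolvent_growth_def
  \<comment> \<open>Beyond abscissa 1 we have |\<zeta>| \<ge> 1, so the additive constants are
    absorbed: |\<zeta> - \<mu>| \<le> |\<zeta>| (1 + |\<mu>|) and 1 \<le> |\<zeta>|^q.\<close>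
  proof (rule exI[of _ "max \<omega> 1"], rule exI[of _ C'], intro conjI allI impI)
    show "C' > 0" unfolding C'_def using C(1) eE by (intro add_pos_nonneg mult_nonneg_nonneg) auto
    fix \<zeta> assume z: "max \<omega> 1 < Re \<zeta>"
    then have \<zeta>: "\<zeta> \<in> pencil_resolvent_set E D A" using C by simp
    show "\<zeta> \<in> pencil_resolvent_set (\<iota> \<circ> E) UNIV (bounded_extension D A \<iota>)"
      by (rule extended_resolvent(1)[OF \<zeta>])
    have z1: "1 \<le> cmod \<zeta>" using z abs_Re_le_cmod[of \<zeta>] by linarith
    have p: "cmod \<zeta> * cmod \<zeta> powi (int q - 1) = cmod \<zeta> ^ q"
      using z1 by (cases "cmod \<zeta> = 0") (simp_all add: power_int_diff field_simps)
    have "onorm (pencil_resolvent (\<iota> \<circ> E) UNIV (bounded_extension D A \<iota>) \<zeta>)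
      \<le> 1 + cmod (\<zeta> - \<mu>) * (onorm (pencil_resolvent E D A \<zeta>) * onorm E)"
      by (rule extended_resolvent(2)[OF \<zeta>])
    also have "\<dots> \<le> 1 + (cmod \<zeta> * (1 + cmod \<mu>)) * ((C * cmod \<zeta> powi (int q - 1)) * onorm E)"
    proof (intro add_left_mono mult_mono)
      have "cmod (\<zeta> - \<mu>) \<le> cmod \<zeta> + 1 * cmod \<mu>" using norm_triangle_ineq4[of \<zeta> \<mu>] by simp
      also have "\<dots> \<le> cmod \<zeta> + cmod \<zeta> * cmod \<mu>" using z1 by (intro add_left_mono mult_right_mono) auto
      finally show "cmod (\<zeta> - \<mu>) \<le> cmod \<zeta> * (1 + cmod \<mu>)" by (simp add: algebra_simps)
      show "0 \<le> onorm (pencil_resolvent E D A \<zeta>) * onorm E"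
        by (intro mult_nonneg_nonneg onorm_pos_le bounded_clinear_bounded_linear resolvent(1)[OF \<zeta>] E)
    qed (use C z eE z1 in auto)
    also have "\<dots> = 1 + ((1 + cmod \<mu>) * (C * onorm E)) * (cmod \<zeta> * cmod \<zeta> powi (int q - 1))"
      by (simp add: mult_ac)
    also have "\<dots> = 1 + ((1 + cmod \<mu>) * (C * onorm E)) * cmod \<zeta> ^ q" by (simp only: p)
    also have "\<dots> \<le> cmod \<zeta> ^ q + ((1 + cmod \<mu>) * (C * onorm E)) * cmod \<zeta> ^ q"
      using one_le_power[OF z1, of q] by simp
    also have "\<dots> = C' * cmod \<zeta> powi (int (q + 1) - 1)" by (simp add: C'_def algebra_simps)
    finally show "onorm (pencil_resolvent (\<iota> \<circ> E) UNIV (bounded_extension D A \<iota>) \<zeta>) \<le> C' * cmod \<zeta> powi (int (q + 1) - 1)" .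
  qed
qed

end

section \<open>Classical solutions\<close>

lemma scaled_power_derivative:
  "((\<lambda>t. (t ^ Suc i / fact (Suc i)) *\<^sub>R w) has_vector_derivative (t ^ i / fact i) *\<^sub>R w) (at (t::real) within S)"
proof -
  have "((\<lambda>t::real. t ^ Suc i / fact (Suc i)) has_real_derivative t ^ i / fact i) (at t within S)"
    by (rule derivative_eq_intros refl | simp add: field_simps del: of_nat_Suc)+
  from has_vector_derivative_scaleR[OF this has_vector_derivative_const[of w]] show ?thesis by simp
qed

lemma sum_scaled_power_derivative:
  fixes a :: "nat \<Rightarrow> 'a::real_normed_vector"
  shows "((\<lambda>t. \<Sum>i\<le>Suc k. (t ^ i / fact i) *\<^sub>R a i) has_vector_derivative
    (\<Sum>i\<le>k. (t ^ i / fact i) *\<^sub>R a (Suc i))) (at (t::real) within S)"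
proof -
  have "((\<lambda>t. a 0 + (\<Sum>i\<le>k. (t ^ Suc i / fact (Suc i)) *\<^sub>R a (Suc i))) has_vector_derivative
      0 + (\<Sum>i\<le>k. (t ^ i / fact i) *\<^sub>R a (Suc i))) (at t within S)"
    by (intro has_vector_derivative_add has_vector_derivative_sum has_vector_derivative_const scaled_power_derivative)
  then show ?thesis by (simp add: sum.atMost_Suc_shift del: sum.atMost_Suc power_Suc fact_Suc)
qed

lemma sum_scaled_power_at_0:
  fixes a :: "nat \<Rightarrow> 'a::real_normed_vector"
  shows "(\<Sum>i\<le>k. ((0::real) ^ i / fact i) *\<^sub>R a i) = a 0"
  by (induction k) simp_all

context pencil_growth
begin

text \<open>The polynomial \<open>\<Sum>\<^sub>j t\<^sup>j/j! x\<^sub>j\<close> solves the equation up to a remainder whose derivatives up to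
  order \<open>q\<close> vanish at \<open>0\<close>; that remainder is treated by \<open>integrated_solution\<close>.\<close>

theorem compatible_solution:
  fixes U :: "nat \<Rightarrow> real \<Rightarrow> 'w" and x :: "nat \<Rightarrow> 'x" and K :: "real \<Rightarrow> real"
  assumes U: "\<And>j. j \<le> q \<Longrightarrow> continuous_on {0..} (U j)"
    and U_Suc: "\<And>j t. j < q \<Longrightarrow> t \<ge> 0 \<Longrightarrow> U j t = U j 0 + integral {0..t} (U (Suc j))"
    and K: "\<And>a b. 0 \<le> a \<Longrightarrow> a \<le> b \<Longrightarrow> norm (U q b - U q a) \<le> K b - K a"
    and compat: "\<And>j. j \<le> q \<Longrightarrow> e (x (Suc j)) = b (x j) + U j 0"
  obtains X where "continuous_on {0..} X" "X 0 = x 0"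
    "\<And>t. t \<ge> 0 \<Longrightarrow> ((\<lambda>s. e (X s)) has_vector_derivative b (X t) + U 0 t) (at t within {0..})"
proof -
  note es = bounded_clinear_simps[OF e] and bs = bounded_clinear_simps[OF b]
  \<comment> \<open>The top coefficient \<open>x (Suc q)\<close> enters the polynomial without a
    compatibility condition for its image under \<open>b\<close>; this image is left in the
    remainder.\<close>
  define B where "B = b (x (Suc q))"
  \<comment> \<open>\<open>R k\<close> is the derivative of order q - k of the remainder: a Taylor
    remainder of \<open>U (q - k)\<close> plus the term from \<open>B\<close>. Thus
    \<open>R 0\<close> plays the role of G, \<open>R q\<close> is the full right-hand side, and each
    \<open>R (Suc k)\<close> is the primitive of \<open>R k\<close>.\<close>
  define R where "R k t = U (q - k) t - (\<Sum>i\<le>k. (t ^ i / fact i) *\<^sub>R U (q - k + i) 0)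
      + (t ^ Suc k / fact (Suc k)) *\<^sub>R B" for k t
  define H where "H = rec_nat (R 0) (\<lambda>_ h t. integral {0..t} h)"
  have H: "H 0 = R 0" "\<And>k t. H (Suc k) t = integral {0..t} (H k)" by (simp_all add: H_def)
  have U_der: "(U j has_vector_derivative U (Suc j) t) (at t within {0..})" if "j < q" "t \<ge> 0" for j t
  proof (rule has_vector_derivative_transform[OF _ _ ])
    show "((\<lambda>t. U j 0 + integral {0..t} (U (Suc j))) has_vector_derivative U (Suc j) t) (at t within {0..})"
      by (rule has_vector_derivative_eq_rhs, rule has_vector_derivative_add[OF has_vector_derivative_const
            integral_has_vector_derivative_Ici]) (use that U in auto)
    show "t \<in> {0..}" using that(2) by simp
    show "U j s = U j 0 + integral {0..s} (U (Suc j))" if "s \<in> {0..}" for s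
      by (rule U_Suc) (use that \<open>j < q\<close> in auto)
  qed
  have R0: "R k 0 = 0" for k
    unfolding R_def sum_scaled_power_at_0 by simp
  have H_eq: "H k t = R k t" if "k \<le> q" "t \<ge> 0" for k t
    using that
  proof (induction k arbitrary: t)
    case (Suc k)
    have der: "(R (Suc k) has_vector_derivative R k s) (at s within {0..})" if "s \<ge> 0" for s
    proof -
      have eq: "Suc (q - Suc k) = q - k" "\<And>i. q - Suc k + Suc i = q - k + i" using Suc.prems by auto
      have "(R (Suc k) has_vector_derivative U (Suc (q - Suc k)) s
          - (\<Sum>i\<le>k. (s ^ i / fact i) *\<^sub>R U (q - Suc k + Suc i) 0) + (s ^ Suc k / fact (Suc k)) *\<^sub>R B) (at s within {0..})"
        unfolding R_def[abs_def]
        by (intro has_vector_derivative_add has_vector_derivative_diff U_der sum_scaled_power_derivative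
            scaled_power_derivative) (use Suc.prems that in auto)
      then show ?thesis unfolding eq R_def .
    qed
    have "(R k has_integral (R (Suc k) t - R (Suc k) 0)) {0..t}"
      using Suc.prems by (intro fundamental_theorem_of_calculus has_vector_derivative_within_subset[OF der]) auto
    moreover have "integral {0..t} (H k) = integral {0..t} (R k)"
      by (rule Henstock_Kurzweil_Integration.integral_cong) (use Suc in auto)
    ultimately show ?case by (simp add: H R0 integral_unique)
  qed (simp add: H)
  have R_cont: "continuous_on {0..} (R k)" if "k \<le> q" for k
    unfolding R_def[abs_def] using U[of "q - k"] by (intro continuous_intros) auto
  \<comment> \<open>The linear term covers the summand t B of \<open>R 0\<close>; subtracting the
    constant \<open>U q 0\<close> does not change increments.\<close>
  define M where "M t = K t + t * norm B" for t
  have "variation_bounded (R 0) M"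
  proof
    show "continuous_on {0..} (R 0)" by (rule R_cont) simp
    show "R 0 0 = 0" by (rule R0)
    fix a b :: real assume ab: "0 \<le> a" "a \<le> b"
    have "R 0 b - R 0 a = (U q b - U q a) + (b - a) *\<^sub>R B"
      by (simp add: R_def scaleR_diff_left)
    also have "norm \<dots> \<le> (K b - K a) + (b - a) * norm B"
      by (rule order_trans[OF norm_triangle_ineq add_mono[OF K[OF ab]]]) (use ab in simp)
    finally show "norm (R 0 b - R 0 a) \<le> M b - M a" by (simp add: M_def algebra_simps)
  qed
  then obtain z where z: "continuous_on {0..} z" "z 0 = 0"
    "\<And>t. t \<ge> 0 \<Longrightarrow> e (z t) = b (integral {0..t} z) + H (q + 1) t"
    by (rule integrated_solution[where H = H]) (auto simp: H)
  define X where "X t = (\<Sum>j\<le>Suc q. (t ^ j / fact j) *\<^sub>R x j) + z t" for t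
  have lin_e: "linear e" and lin_b: "linear b"
    using e b bounded_clinear_bounded_linear bounded_linear.linear by blast+
  have X_e: "e (X t) = (\<Sum>j\<le>Suc q. (t ^ j / fact j) *\<^sub>R e (x j)) + (b (integral {0..t} z) + integral {0..t} (R q))"
    if t: "t \<ge> 0" for t
  proof -
    have "H (q + 1) t = integral {0..t} (R q)"
      using H_eq by (simp add: H) (rule Henstock_Kurzweil_Integration.integral_cong, auto)
    then show ?thesis
      unfolding X_def es(1) z(3)[OF t] linear_sum[OF lin_e] by (simp only: es(6))
  qed
  show thesis
  proof
    show "continuous_on {0..} X" unfolding X_def by (intro continuous_intros z) auto
    show "X 0 = x 0" unfolding X_def sum_scaled_power_at_0 by (simp add: z)
    fix t :: real assume t: "t \<ge> 0"
    have "((\<lambda>s. (\<Sum>j\<le>Suc q. (s ^ j / fact j) *\<^sub>R e (x j)) + (b (integral {0..s} z) + integral {0..s} (R q)))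
        has_vector_derivative (\<Sum>i\<le>q. (t ^ i / fact i) *\<^sub>R e (x (Suc i))) + (b (z t) + R q t)) (at t within {0..})"
      by (intro has_vector_derivative_add sum_scaled_power_derivative
          bounded_linear.has_vector_derivative[OF bounded_clinear_bounded_linear[OF b]]
          integral_has_vector_derivative_Ici z R_cont t order_refl)
    note der = this
    \<comment> \<open>The compatibility conditions turn the derivative of the polynomial into
      \<open>b\<close> of its terms up to degree q plus the Taylor polynomial of \<open>U 0\<close>,
      which cancels against \<open>R q\<close>; the term in \<open>B\<close> supplies degree q +
      1.\<close>
    have eq: "(\<Sum>i\<le>q. (t ^ i / fact i) *\<^sub>R e (x (Suc i))) + (b (z t) + R q t) = b (X t) + U 0 t"
    proof -
      have "(\<Sum>i\<le>q. (t ^ i / fact i) *\<^sub>R e (x (Suc i)))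
          = (\<Sum>i\<le>q. (t ^ i / fact i) *\<^sub>R b (x i)) + (\<Sum>i\<le>q. (t ^ i / fact i) *\<^sub>R U i 0)"
        unfolding sum.distrib[symmetric] by (rule sum.cong) (simp_all add: compat scaleR_add_right)
      moreover have "b (X t) = (\<Sum>i\<le>q. (t ^ i / fact i) *\<^sub>R b (x i)) + (t ^ Suc q / fact (Suc q)) *\<^sub>R B + b (z t)"
        unfolding X_def bs(1) linear_sum[OF lin_b] by (simp add: bs(6) B_def del: power_Suc fact_Suc)
      ultimately show ?thesis by (simp add: R_def del: power_Suc fact_Suc)
    qed
    show "((\<lambda>s. e (X s)) has_vector_derivative b (X t) + U 0 t) (at t within {0..})"
    proof (rule has_vector_derivative_transform[OF _ _ der[unfolded eq]])
      show "t \<in> {0..}" using t by simp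
      show "e (X s) = (\<Sum>j\<le>Suc q. (s ^ j / fact j) *\<^sub>R e (x j)) + (b (integral {0..s} z) + integral {0..s} (R q))"
        if "s \<in> {0..}" for s by (rule X_e) (use that in simp)
    qed
  qed
qed

end

section \<open>Instantiation for the extended pencil and conclusion\<close>

lemma (in extrapolated_pencil) pencil_growth_extended:
  assumes "resolvent_growth (\<iota> \<circ> E) UNIV (bounded_extension D A \<iota>) q"
  obtains r \<omega> C where "pencil_growth (\<lambda>x. \<iota> (E x)) (bounded_extension D A \<iota>) r \<omega> C q"
proof -
  define B where "B = bounded_extension D A \<iota>"
  have B: "bounded_clinear B"
    unfolding B_def by (rule extension_isometry)
  obtain \<omega> C where C: "C > 0" "\<And>\<zeta>. Re \<zeta> > \<omega> \<Longrightarrow> \<zeta> \<in> pencil_resolvent_set (\<iota> \<circ> E) UNIV B"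
    "\<And>\<zeta>. Re \<zeta> > \<omega> \<Longrightarrow> onorm (pencil_resolvent (\<iota> \<circ> E) UNIV B \<zeta>) \<le> C * cmod \<zeta> powi (int q - 1)"
    using assms unfolding resolvent_growth_def B_def by blast
  have "pencil_growth (\<lambda>x. \<iota> (E x)) B (pencil_resolvent (\<iota> \<circ> E) UNIV B) (max \<omega> 1) C q"
  proof
    show "bounded_clinear (\<lambda>x. \<iota> (E x))" by (rule bounded_clinear_compose[OF bounded_clinear_\<iota> E])
    fix \<zeta> assume z: "max \<omega> 1 < Re \<zeta>"
    then have \<zeta>: "\<zeta> \<in> pencil_resolvent_set (\<iota> \<circ> E) UNIV B" by (intro C) simp
    then have bij: "bij (\<lambda>x. \<zeta> *\<^sub>C (\<iota> \<circ> E) x - B x)" and bc: "bounded_clinear (pencil_resolvent (\<iota> \<circ> E) UNIV B \<zeta>)"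
      unfolding pencil_resolvent_set_def by auto
    show "bounded_clinear (pencil_resolvent (\<iota> \<circ> E) UNIV B \<zeta>)" by (rule bc)
    show "\<zeta> *\<^sub>C \<iota> (E (pencil_resolvent (\<iota> \<circ> E) UNIV B \<zeta> w)) - B (pencil_resolvent (\<iota> \<circ> E) UNIV B \<zeta> w) = w" for w
      using surj_f_inv_f[OF bij_is_surj[OF bij], of w] unfolding pencil_resolvent_def by simp
    show "pencil_resolvent (\<iota> \<circ> E) UNIV B \<zeta> (\<zeta> *\<^sub>C \<iota> (E x) - B x) = x" for x
      using inv_f_f[OF bij_is_inj[OF bij], of x] unfolding pencil_resolvent_def by simp
    have nz: "cmod \<zeta> \<noteq> 0" using z by auto
    \<comment> \<open>Writing q - 1 as (q + 1) - 2 gives natural exponents even for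
      \<open>q = 0\<close>; the splitting is valid since \<zeta> is nonzero.\<close>
    have "cmod \<zeta> powi (int q - 1) = cmod \<zeta> powi (int (q + 1) - int 2)" by simp
    also have "\<dots> = cmod \<zeta> ^ (q + 1) / (cmod \<zeta>)\<^sup>2"
      using nz by (subst power_int_diff) (simp_all only: power_int_of_nat, simp)
    finally have pw: "cmod \<zeta> powi (int q - 1) = cmod \<zeta> ^ (q + 1) / (cmod \<zeta>)\<^sup>2" .
    show "norm (pencil_resolvent (\<iota> \<circ> E) UNIV B \<zeta> w) \<le> C * (cmod \<zeta> ^ (q + 1) / (cmod \<zeta>)\<^sup>2) * norm w" for w
    proof -
      have "norm (pencil_resolvent (\<iota> \<circ> E) UNIV B \<zeta> w) \<le> onorm (pencil_resolvent (\<iota> \<circ> E) UNIV B \<zeta>) * norm w"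
        by (rule onorm[OF bounded_clinear_bounded_linear[OF bc]])
      also have "\<dots> \<le> C * (cmod \<zeta> ^ (q + 1) / (cmod \<zeta>)\<^sup>2) * norm w"
        unfolding pw[symmetric] by (intro mult_right_mono C) (use z in auto)
      finally show ?thesis .
    qed
  qed (use C B in auto)
  then show thesis unfolding B_def by (rule that)
qed

text \<open>Pulls the inner product of X back to the extrapolation space. Its real part suffices,
  because it induces the same norm and yields real functionals.\<close>

lemma inner_norm_isometry:
  fixes J :: "'w::complex_banach \<Rightarrow> 'x::complex_hilbert"
  assumes J: "bounded_clinear J" "\<And>w. norm (J w) = norm w"
  shows "inner_norm (\<lambda>v w. Re (cinner (J v) (J w)))"
proof
  note js = bounded_clinear_simps[OF J(1)]
  fix v w u :: 'w and c :: real
  show "Re (cinner (J v) (J w)) = Re (cinner (J w) (J v))"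
    using cinner_commute[of "J v" "J w"] by simp
  show "Re (cinner (J v) (J (w + u))) = Re (cinner (J v) (J w)) + Re (cinner (J v) (J u))"
    by (simp add: js cinner_add_right)
  show "Re (cinner (J v) (J (c *\<^sub>R w))) = c * Re (cinner (J v) (J w))"
    using cinner_scaleC_right[of "J v" "of_real c" "J w"] by (simp add: js scaleC_of_real)
  show "Re (cinner (J v) (J v)) = (norm v)\<^sup>2"
    by (simp add: cinner_norm J(2) del: of_real_power)
qed

lemma Sobolev_halfline_antimono: "q \<le> p \<Longrightarrow> Sobolev_halfline p \<subseteq> Sobolev_halfline q"
  unfolding Sobolev_halfline_def by auto

theorem theorem2p14:
  fixes E :: "'x::complex_hilbert \<Rightarrow> 'z::complex_hilbert"
    and D :: "'x set" and A :: "'x \<Rightarrow> 'z"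
    and \<mu> :: complex
    and \<iota> :: "'z \<Rightarrow> 'w::complex_banach"
    and A_ext :: "'x \<Rightarrow> 'w"
    and p :: nat and f :: "real \<Rightarrow> 'w" and x :: "nat \<Rightarrow> 'x"
  assumes "bounded_clinear E"
    and "closed_densely_defined D A"
    and "\<mu> \<in> pencil_resolvent_set E D A"
    and "is_extrapolation_space E D A \<mu> \<iota>"
    and "A_ext = bounded_extension D A \<iota>"
    and "has_complex_resolvent_index E D A"
    and "p \<ge> complex_resolvent_index (\<iota> \<circ> E) UNIV A_ext + 1"
    and "f \<in> Sobolev_halfline p"
    and "\<And>j. j < p \<Longrightarrow> \<iota> (E (x (j + 1))) = A_ext (x j) + initial_derivative j f"
  shows "(x 0, f) \<in> classical_data L1_loc_halfline E \<iota> A_ext \<and>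
    (f \<in> L1_halfline \<longrightarrow> (x 0, f) \<in> classical_data L1_halfline E \<iota> A_ext)"
proof -
  interpret extrapolated_pencil E D A \<mu> \<iota> by (rule extrapolated_pencil.intro) fact+
  obtain J :: "'w \<Rightarrow> 'x" where J: "bounded_clinear J" "\<And>w. norm (J w) = norm w" and A_ext: "bounded_clinear A_ext"
    unfolding assms(5) by (rule extension_isometry) blast
  interpret inner_norm "\<lambda>v w. Re (cinner (J v) (J w))" by (rule inner_norm_isometry[OF J])
  define q where "q = complex_resolvent_index (\<iota> \<circ> E) UNIV A_ext"
  have "\<exists>q. resolvent_growth (\<iota> \<circ> E) UNIV A_ext q"
    using assms(6) resolvent_growth_extended unfolding has_complex_resolvent_index_def assms(5) by blast
  then have "resolvent_growth (\<iota> \<circ> E) UNIV A_ext q"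
    unfolding q_def complex_resolvent_index_def by (rule LeastI_ex)
  then obtain r \<omega> C where "pencil_growth (\<lambda>x. \<iota> (E x)) A_ext r \<omega> C q"
    unfolding assms(5) by (rule pencil_growth_extended)
  then interpret pencil_growth "\<lambda>x. \<iota> (E x)" A_ext r \<omega> C q .
  have p: "Suc q \<le> p" using assms(7) by (simp add: q_def)
  then have "f \<in> Sobolev_halfline (Suc q)" using assms(8) Sobolev_halfline_antimono by blast
  then obtain U K where U: "\<And>j. j \<le> q \<Longrightarrow> continuous_on {0..} (U j)"
    "\<And>j. j \<le> q \<Longrightarrow> initial_derivative j f = U j 0"
    "AE t in lebesgue_on {0..}. U 0 t = f t"
    "\<And>j t. j < q \<Longrightarrow> t \<ge> 0 \<Longrightarrow> U j t = U j 0 + integral {0..t} (U (Suc j))"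
    "\<And>a b. 0 \<le> a \<Longrightarrow> a \<le> b \<Longrightarrow> norm (U q b - U q a) \<le> K b - K a"
    by (rule Sobolev_representatives) blast
  have compat: "\<iota> (E (x (Suc j))) = A_ext (x j) + U j 0" if "j \<le> q" for j
    using assms(9)[of j] U(2)[OF that] p that by simp
  obtain X where X: "continuous_on {0..} X" "X 0 = x 0"
    "\<And>t. t \<ge> 0 \<Longrightarrow> ((\<lambda>s. \<iota> (E (X s))) has_vector_derivative A_ext (X t) + U 0 t) (at t within {0..})"
    by (rule compatible_solution[of U K x, OF U(1,4,5) compat]) blast+
  have sol: "classical_solution E \<iota> A_ext (x 0) (U 0) X"
    unfolding classical_solution_def
  proof (intro conjI exI[of _ "\<lambda>t. A_ext (X t) + U 0 t"] allI impI)
    show "continuous_on {0..} (\<lambda>t. E (X t))"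
      by (rule bounded_linear.continuous_on[OF bounded_clinear_bounded_linear[OF assms(1)] X(1)])
    show "continuous_on {0..} (\<lambda>t. A_ext (X t) + U 0 t)"
      by (intro continuous_on_add bounded_linear.continuous_on[OF bounded_clinear_bounded_linear[OF A_ext] X(1)] U(1)) simp
  qed (use X in auto)
  have "f \<in> L2_halfline" using assms(8) unfolding Sobolev_halfline_def by blast
  then have "f \<in> L1_loc_halfline" by (rule L2_halfline_subset_L1_loc)
  with sol U(3) show ?thesis unfolding classical_data_def by blast
qed

end
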